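(* Let $1<p<+\infty$. Assume that $E\subset\mathbb{R}^n$ is a closed set and that there exists a ball $B(x,r_a)$ with $x\in E$ such that $E$ is locally uniformly $p$-fat at $E\cap\overline{B(x,r_a)}$ with some constant $c_{\mathrm{fat}}$ and radius $r_0>0$. Then there exist $\varepsilon=\varepsilon(n,p,c_{\mathrm{fat}})$ with $0<\varepsilon<p-1$ and a constant $\widetilde c_{\mathrm{fat}}=\widetilde c_{\mathrm{fat}}(n,p,c_{\mathrm{fat}})$ such that $E$ is locally uniformly $(p-\varepsilon)$-fat at $E\cap\overline{B(x,\tilde r_0)}$ with parameters $\widetilde c_{\mathrm{fat}}$ and $\tilde r_0:=\frac14\min\{r_a,r_0\}$.
   Context: For $1\le s<\infty$ and compact $K\subset O$ open, $\mathrm{cap}_s(K;O)=\inf\{\int_O|\nabla u|^s:u\in\mathrm{Lip}(\overline O),u\ge\chi_K,u|_{\partial O}=0\}$. A closed set $E$ is locally uniformly $s$-fat at a subset $S\subset E$ with parameters $c>0$ and $\rho>0$ if $\mathrm{cap}_s(\{y\in\overline{B(0,\frac12)}:z+ry\in E\};B(0,1))\ge c$ for every $z\in S$ and every $0<r<\rho$. *)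

theory Defs
  imports "HOL-Analysis.Analysis"
begin

text \<open>Norm of the gradient of a real-valued function at a point: the operator norm of
the Frechet derivative where it exists (Lipschitz functions are differentiable a.e.
by Rademacher's theorem), and 0 elsewhere (a null set for Lipschitz functions).\<close>
definition grad_norm :: "('a::euclidean_space \<Rightarrow> real) \<Rightarrow> 'a \<Rightarrow> real" where
  "grad_norm u y = (if u differentiable (at y) then onorm (frechet_derivative u (at y)) else 0)"

definition cap_admissible :: "'a::euclidean_space set \<Rightarrow> 'a set \<Rightarrow> ('a \<Rightarrow> real) \<Rightarrow> bool" where
  "cap_admissible K U u \<longleftrightarrow>
     (\<exists>L. L-lipschitz_on (closure U) u) \<and>
     (\<forall>y\<in>closure U. u y \<ge> (if y \<in> K then 1 else 0)) \<and>
     (\<forall>y\<in>frontier U. u y = 0)"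

definition cap :: "real \<Rightarrow> 'a::euclidean_space set \<Rightarrow> 'a set \<Rightarrow> ennreal" where
  "cap s K U = (INF u\<in>{u. cap_admissible K U u}.
       \<integral>\<^sup>+ y. indicator U y * ennreal (grad_norm u y powr s) \<partial>lebesgue)"

definition unif_fat :: "real \<Rightarrow> 'a::euclidean_space set \<Rightarrow> 'a set \<Rightarrow> real \<Rightarrow> real \<Rightarrow> bool" where
  "unif_fat s E S c \<rho> \<longleftrightarrow>
     (\<forall>z\<in>S. \<forall>r. 0 < r \<and> r < \<rho> \<longrightarrow>
        ennreal c \<le> cap s {y \<in> cball 0 (1/2). z + r *\<^sub>R y \<in> E} (ball 0 1))"

end

theory Submission
  imports Defs "HOL-Real_Asymp.Real_Asymp"
begin

text \<open>
After rescaling, let \<open>u\<close> compete for the \<open>q\<close>-capacity of \<open>E\<close> in the unit ball, where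
\<open>q = p - \<epsilon>\<close>, let \<open>g\<close> be its pointwise Lipschitz constant and \<open>w\<close> the function \<open>max 0 (1 - u)\<close>
cut off near the origin, so that \<open>w\<close> vanishes on \<open>E\<close>. Fatness gives, for every Lipschitz
\<open>h\<close> vanishing on \<open>E\<close>, the weak Hardy inequality \<open>h(x)^p \<le> C d(x, E)^p M(|\<nabla>h|^p)(x)\<close>.
As in the work of Keith and Zhong, it is applied to the average of the Lipschitz truncations of \<open>w\<close>
at \<open>k\<close> heights \<open>4^i t\<close>; their gradients are at most \<open>|\<nabla>w|\<close> where \<open>w \<le> 4^i t d(\<cdot>, E)\<close> and
\<open>M g \<le> 4^i t\<close>, and at most \<open>C 4^i t\<close> elsewhere. This bounds \<open>|{w > t d(\<cdot>, E)}|\<close> by the measures of the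
same sets at the heights \<open>4^i t\<close> and by truncated energies of \<open>g\<close>. Summing
against \<open>t^q\<close> over \<open>t = 4^j t0\<close>, the level sets are absorbed once \<open>k\<close> is large and then
\<open>\<epsilon>\<close> is small, which leaves \<open>|{w > t0 d(\<cdot>, E)}| \<le> C \<integral> g^q\<close>. Near the origin
this set contains \<open>{u < 1/2}\<close>, and \<open>|{u \<ge> 1/2}| \<le> C \<integral> g^q\<close> by the Poincare inequality, so
\<open>\<integral> g^q\<close> is bounded below.

Since the gradient in the definition of capacity is set to 0 where \<open>u\<close> is not differentiable,
Rademacher's theorem is needed to identify it with \<open>g\<close> almost everywhere.
\<close>

section \<open>Superlevel sets of the maximal function\<close>

text \<open>A single truncation would return the level sets with a factor that is not small, and
  nothing could be absorbed. At a point that is bad for some of the k heights, the average of the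
  truncations has an extra slope of order 4^m t / k, where m is the largest bad index. Its p-th
  power carries k^(-p), while adding up the k heights costs only k. This gain k^(1-p) is secured
  before \<epsilon> is chosen; an \<epsilon> of order 1/k then keeps below 2 the loss
  (4^\<epsilon>)^k that comes from summing against t^q instead of t^p. So every parameter depends on
  n, p and the fatness constant alone. The pointwise Lipschitz constant is a Borel function defined
  everywhere, and it dominates \<open>grad_norm\<close> at every point. Fatness can therefore be
  tested with it directly; almost-everywhere equality matters only when the energy of an arbitrary
  competitor is bounded from below. The Lipschitz constant of that competitor enters only
  qualitatively: high level sets are empty, so the sum to be absorbed is finite.\<close>

lemma ball_in_borel [measurable, simp]: "ball (x::'a::euclidean_space) r \<in> sets borel"
  and cball_in_borel [measurable, simp]: "cball x r \<in> sets borel"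
  by auto

lemma emeasure_lborel_ball_scale:
  fixes c d :: "'a::euclidean_space"
  assumes "0 \<le> k" "0 \<le> r"
  shows "emeasure lborel (ball c (k * r)) = ennreal (k ^ DIM('a)) * emeasure lborel (ball d r)"
proof -
  have fin: "emeasure lborel (ball x s) = ennreal (measure lborel (ball x s))" for x :: 'a and s
    by (rule emeasure_eq_ennreal_measure) (use emeasure_lborel_ball_finite[of x s] in auto)
  have "measure lborel (ball c (k * r)) = k ^ DIM('a) * measure lborel (ball d r)"
    using content_ball_conv_unit_ball[of "k * r" c] content_ball_conv_unit_ball[of r d] assms
    by (simp add: power_mult_distrib)
  then show ?thesis
    using assms by (simp add: fin ennreal_mult)
qed

lemma emeasure_lborel_ball_eq:
  fixes x :: "'a::euclidean_space"
  shows "emeasure lborel (ball x r) = ennreal (measure lborel (ball x r))"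
    by (rule emeasure_eq_ennreal_measure) (use emeasure_lborel_ball_finite[of x r] in auto)

text \<open>\<^term>\<open>maxset F t\<close> is the set where the centred Hardy--Littlewood maximal function of \<^term>\<open>F\<close> exceeds \<^term>\<open>t\<close>.\<close>

definition maxset :: "('a::euclidean_space \<Rightarrow> ennreal) \<Rightarrow> real \<Rightarrow> 'a set" where
  "maxset F t = {x. \<exists>r>0. ennreal t * emeasure lborel (ball x r) < (\<integral>\<^sup>+y\<in>ball x r. F y \<partial>lborel)}"

lemma not_in_maxset:
  "x \<notin> maxset F t \<Longrightarrow> 0 < r \<Longrightarrow> (\<integral>\<^sup>+y\<in>ball x r. F y \<partial>lborel) \<le> ennreal t * emeasure lborel (ball x r)"
  unfolding maxset_def using not_less by blast

text \<open>By continuity of the measure from below, the strict inequality survives on a slightly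
  smaller concentric ball, and that ball lies in the ball of the full radius about every nearby
  centre. Openness also settles measurability.\<close>

lemma open_maxset:
  fixes F :: "'a::euclidean_space \<Rightarrow> ennreal"
  assumes [measurable]: "F \<in> borel_measurable borel"
  shows "open (maxset F t)"
proof (subst open_contains_ball, rule ballI)
  fix x assume "x \<in> maxset F t"
  then obtain r where r: "0 < r" "ennreal t * emeasure lborel (ball x r) < (\<integral>\<^sup>+y\<in>ball x r. F y \<partial>lborel)"
    by (auto simp: maxset_def)
  define R where "R n = r - r / (real n + 2)" for n :: nat
  have R: "0 < R n" "R n < r" for n
    using r(1) by (auto simp: R_def field_simps add_pos_nonneg)
  have incR: "incseq R"
    unfolding incseq_def R_def using r(1) by (auto intro!: divide_left_mono)
  have "(\<Union>n. ball x (R n)) = ball x r"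
  proof -
    have "R \<longlonglongrightarrow> r - 0"
      unfolding R_def by (intro tendsto_intros) real_asymp
    then have "\<exists>n. dist x y < R n" if "dist x y < r" for y
      using order_tendstoD(1)[of R r sequentially "dist x y"] that by (auto simp: eventually_sequentially)
    then show ?thesis using R(2) by (auto intro: less_trans[OF _ R(2)])
  qed
  then have "(\<integral>\<^sup>+y\<in>ball x r. F y \<partial>lborel) = emeasure (density lborel F) (\<Union>n. ball x (R n))"
    by (simp add: emeasure_density)
  also have "\<dots> = (SUP n. emeasure (density lborel F) (ball x (R n)))"
    by (rule SUP_emeasure_incseq[symmetric]) (use incR in \<open>auto simp: incseq_def intro!: subset_ball\<close>)
  finally obtain n where n: "ennreal t * emeasure lborel (ball x r) < (\<integral>\<^sup>+y\<in>ball x (R n). F y \<partial>lborel)"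
    using r(2) by (auto simp: less_SUP_iff emeasure_density)
  have "ball x (r - R n) \<subseteq> maxset F t"
  proof
    fix x' assume x': "x' \<in> ball x (r - R n)"
    then have sub: "ball x (R n) \<subseteq> ball x' r"
    proof (intro subsetI)
      fix y assume "y \<in> ball x (R n)"
      then have "dist x y < R n" "dist x x' < r - R n" using x' by auto
      then show "y \<in> ball x' r" using dist_triangle2[of x' y x] by (simp add: dist_commute)
    qed
    have "ennreal t * emeasure lborel (ball x' r) = ennreal t * emeasure lborel (ball x r)"
      using emeasure_lborel_ball_scale[of 1 r x' x] r(1) by simp
    also have "\<dots> < (\<integral>\<^sup>+y\<in>ball x (R n). F y \<partial>lborel)" by (rule n)
    also have "\<dots> \<le> (\<integral>\<^sup>+y\<in>ball x' r. F y \<partial>lborel)"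
      using sub by (intro nn_set_integral_set_mono) auto
    finally show "x' \<in> maxset F t" using r(1) by (auto simp: maxset_def)
  qed
  then show "\<exists>e>0. ball x e \<subseteq> maxset F t" using R(2)[of n] by (intro exI[of _ "r - R n"]) auto
qed

text \<open>Weak-type (1,1) bound: Vitali's lemma selects countably many disjoint witness balls
  whose fivefold enlargements cover the set, whence the factor 5^n.\<close>

lemma emeasure_maxset_le:
  fixes F :: "'a::euclidean_space \<Rightarrow> ennreal"
  assumes [measurable]: "F \<in> borel_measurable borel" and t: "0 < t"
  shows "ennreal t * emeasure lborel (maxset F t) \<le> ennreal (5 ^ DIM('a)) * (\<integral>\<^sup>+y. F y \<partial>lborel)"
proof (cases "(\<integral>\<^sup>+y. F y \<partial>lborel) = \<infinity>")
  case True
  then show ?thesis by (simp add: ennreal_mult_top)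
next
  case False
  then obtain I where I: "(\<integral>\<^sup>+y. F y \<partial>lborel) = ennreal I" "0 \<le> I"
    by (cases "\<integral>\<^sup>+y. F y \<partial>lborel") auto
  define A where "A = maxset F t"
  have "\<forall>x\<in>A. \<exists>r>0. ennreal t * emeasure lborel (ball x r) < (\<integral>\<^sup>+y\<in>ball x r. F y \<partial>lborel)"
    by (auto simp: A_def maxset_def)
  then obtain r where r: "\<And>x. x \<in> A \<Longrightarrow> 0 < r x"
     "\<And>x. x \<in> A \<Longrightarrow> ennreal t * emeasure lborel (ball x (r x)) < (\<integral>\<^sup>+y\<in>ball x (r x). F y \<partial>lborel)"
    by metis
  define \<omega> where "\<omega> = measure lborel (ball (0::'a) 1)"
  have \<omega>: "0 < \<omega>" unfolding \<omega>_def by (rule content_ball_pos) simp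
  \<comment> \<open>Vitali's lemma wants bounded radii. A witness ball has measure below I / t, and
    r \<le> r^n for r > 1 turns this into a bound on the radius; hence the maximum with 1.\<close>
  define B where "B = max 1 (I / (t * \<omega>))"
  have rB: "r x \<le> B" if "x \<in> A" for x
  proof (cases "r x \<le> 1")
    case False
    have "ennreal (t * (r x ^ DIM('a) * \<omega>)) = ennreal t * emeasure lborel (ball x (r x))"
      using r(1)[OF that] t \<omega> content_ball_conv_unit_ball[of "r x" x]
      by (simp add: emeasure_lborel_ball_eq \<omega>_def ennreal_mult)
    also have "\<dots> < (\<integral>\<^sup>+y\<in>ball x (r x). F y \<partial>lborel)" by (rule r(2)[OF that])
    also have "\<dots> \<le> (\<integral>\<^sup>+y. F y \<partial>lborel)" by (intro nn_integral_mono) (auto simp: indicator_def)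
    finally have "t * (r x ^ DIM('a) * \<omega>) < I" 
      using I t \<omega> r(1)[OF that] by (simp add: ennreal_less_iff)
    then have "r x ^ DIM('a) \<le> I / (t * \<omega>)" using t \<omega> by (simp add: field_simps)
    moreover have "r x \<le> r x ^ DIM('a)" using False by (intro self_le_power) auto
    ultimately show ?thesis by (simp add: B_def)
  qed (simp add: B_def)
  obtain C where C: "countable C" "C \<subseteq> A" "pairwise (\<lambda>i j. disjnt (ball i (r i)) (ball j (r j))) C"
      "A \<subseteq> (\<Union>i\<in>C. ball i (5 * r i))"
    using Vitali_covering_lemma_balls[of A "\<lambda>x. x" r A B] r(1) rB by force
  have Am[measurable]: "A \<in> sets borel" unfolding A_def by (intro borel_open open_maxset) simp
  have "ennreal t * emeasure lborel A \<le> ennreal t * emeasure lborel (\<Union>i\<in>C. ball i (5 * r i))"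
    using C(1,4) by (intro mult_left_mono emeasure_mono) (auto intro!: borel_open)
  also have "\<dots> \<le> ennreal t * (\<integral>\<^sup>+i. emeasure lborel (ball i (5 * r i)) \<partial>count_space C)"
  proof (intro mult_left_mono)
    have meas: "emeasure lborel (\<Union>i\<in>C. ball i (5 * r i)) = (\<integral>\<^sup>+x. indicator (\<Union>i\<in>C. ball i (5 * r i)) x \<partial>lborel)"
      by (rule nn_integral_indicator[symmetric]) (auto intro!: borel_open)
    also have "\<dots> \<le> (\<integral>\<^sup>+x. \<integral>\<^sup>+i. indicator (ball i (5 * r i)) x \<partial>count_space C \<partial>lborel)"
    proof (intro nn_integral_mono)
      fix x
      show "indicator (\<Union>i\<in>C. ball i (5 * r i)) x \<le> (\<integral>\<^sup>+i. indicator (ball i (5 * r i)) x \<partial>count_space C)"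
      proof (cases "\<exists>i\<in>C. x \<in> ball i (5 * r i)")
        case True
        then obtain i where i: "i \<in> C" "x \<in> ball i (5 * r i)" by blast
        have "(\<integral>\<^sup>+j. indicator {i} j \<partial>count_space C) \<le> (\<integral>\<^sup>+i. indicator (ball i (5 * r i)) x \<partial>count_space C)"
          using i by (intro nn_integral_mono) (auto simp: indicator_def)
        then show ?thesis using i by (auto simp: indicator_def[of "\<Union>i\<in>C. ball i (5 * r i)"])
      qed (auto simp: indicator_def)
    qed
    also have "\<dots> = (\<integral>\<^sup>+i. \<integral>\<^sup>+x. indicator (ball i (5 * r i)) x \<partial>lborel \<partial>count_space C)"
      by (rule nn_integral_count_space_nn_integral) (use C(1) in auto)
    finally show "emeasure lborel (\<Union>i\<in>C. ball i (5 * r i)) \<le> (\<integral>\<^sup>+i. emeasure lborel (ball i (5 * r i)) \<partial>count_space C)"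
      by simp
  qed simp
  also have "\<dots> = ennreal (5 ^ DIM('a)) * (\<integral>\<^sup>+i. ennreal t * emeasure lborel (ball i (r i)) \<partial>count_space C)"
  proof -
    have "emeasure lborel (ball i (5 * r i)) = ennreal (5 ^ DIM('a)) * emeasure lborel (ball i (r i))" if "i \<in> C" for i
      by (rule emeasure_lborel_ball_scale) (use r(1)[OF subsetD[OF C(2) that]] in auto)
    then have "(\<integral>\<^sup>+i. emeasure lborel (ball i (5 * r i)) \<partial>count_space C) = 
       (\<integral>\<^sup>+i. ennreal (5 ^ DIM('a)) * emeasure lborel (ball i (r i)) \<partial>count_space C)"
      by (intro nn_integral_cong) auto
    then show ?thesis by (simp add: nn_integral_cmult mult.left_commute)
  qed
  also have "\<dots> \<le> ennreal (5 ^ DIM('a)) * (\<integral>\<^sup>+i. emeasure (density lborel F) (ball i (r i)) \<partial>count_space C)"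
    using r(2) C(2) by (intro mult_left_mono nn_integral_mono) (auto simp: emeasure_density intro!: less_imp_le)
  also have "\<dots> = ennreal (5 ^ DIM('a)) * emeasure (density lborel F) (\<Union>i\<in>C. ball i (r i))"
    using C(1,3) by (subst emeasure_UN_countable) (auto simp: disjoint_family_on_def pairwise_def disjnt_def)
  also have "\<dots> \<le> ennreal (5 ^ DIM('a)) * emeasure (density lborel F) UNIV"
    by (intro mult_left_mono emeasure_mono) auto
  finally show ?thesis by (simp add: A_def emeasure_density)
qed

text \<open>The part of F up to t/2 contributes at most t/2 to any average, so the rest must account
  for the other half. This cut is what lets the weak-type bounds be summed over heights.\<close>

lemma maxset_subset_cut:
  fixes F :: "'a::euclidean_space \<Rightarrow> ennreal"
  assumes [measurable]: "F \<in> borel_measurable borel" and "0 \<le> t"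
  shows "maxset F t \<subseteq> maxset (\<lambda>y. F y * indicator {y. ennreal (t/2) < F y} y) (t/2)"
proof
  fix x assume "x \<in> maxset F t"
  then obtain r where r: "0 < r" "ennreal t * emeasure lborel (ball x r) < (\<integral>\<^sup>+y\<in>ball x r. F y \<partial>lborel)"
    by (auto simp: maxset_def)
  let ?G = "\<lambda>y. F y * indicator {y. ennreal (t/2) < F y} y"
  let ?b = "emeasure lborel (ball x r)"
  have "(\<integral>\<^sup>+y\<in>ball x r. F y \<partial>lborel) \<le> (\<integral>\<^sup>+y\<in>ball x r. (?G y + ennreal (t/2)) \<partial>lborel)"
    by (intro nn_integral_mono) (auto simp: indicator_def not_less)
  also have "\<dots> = (\<integral>\<^sup>+y\<in>ball x r. ?G y \<partial>lborel) + ennreal (t/2) * ?b"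
  proof -
    have m: "(\<lambda>y. ?G y * indicator (ball x r) y) \<in> borel_measurable lborel" by measurable
    have "(\<integral>\<^sup>+y\<in>ball x r. (?G y + ennreal (t/2)) \<partial>lborel) =
        (\<integral>\<^sup>+y. ?G y * indicator (ball x r) y + ennreal (t/2) * indicator (ball x r) y \<partial>lborel)"
      by (simp only: distrib_right)
    also have "\<dots> = (\<integral>\<^sup>+y\<in>ball x r. ?G y \<partial>lborel) + (\<integral>\<^sup>+y. ennreal (t/2) * indicator (ball x r) y \<partial>lborel)"
      by (rule nn_integral_add[OF m]) simp
    also have "(\<integral>\<^sup>+y. ennreal (t/2) * indicator (ball x r) y \<partial>lborel) = ennreal (t/2) * ?b"
      by (rule nn_integral_cmult_indicator) simp
    finally show ?thesis .
  qed
  finally have *: "ennreal t * ?b < (\<integral>\<^sup>+y\<in>ball x r. ?G y \<partial>lborel) + ennreal (t/2) * ?b"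
    using r(2) by simp
  have "ennreal t * ?b = ennreal (t/2) * ?b + ennreal (t/2) * ?b"
    using assms(2) ennreal_plus[of "t/2" "t/2"] distrib_right[of "ennreal (t/2)" "ennreal (t/2)" ?b] by simp
  then have "ennreal (t/2) * ?b < (\<integral>\<^sup>+y\<in>ball x r. ?G y \<partial>lborel)"
    using * by (metis add_right_mono not_less)
  then show "x \<in> maxset ?G (t/2)" using r(1) by (auto simp: maxset_def)
qed

section \<open>Density and Lebesgue points\<close>

text \<open>Open sets \<open>U k\<close> around S with small excess reduce this to the weak-type
  bound: near a point of S a small ball lies in \<open>U k\<close>, so its part outside S belongs to
  \<open>U k - S\<close>, whose averages about x are, for some k, at most 1 / Suc m unless x lies in
  a null set.\<close>

lemma AE_density_point:
  fixes S :: "'a::euclidean_space set"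
  assumes [measurable]: "S \<in> sets borel"
  shows "AE x in lborel. x \<in> S \<longrightarrow> (\<forall>e>0. \<exists>R>0. \<forall>r. 0 < r \<and> r < R \<longrightarrow>
           emeasure lborel (ball x r - S) \<le> ennreal e * emeasure lborel (ball x r))"
proof -
  have "\<exists>U. open U \<and> S \<subseteq> U \<and> emeasure lborel (U - S) < ennreal (1 / Suc k)" for k
  proof -
    have "S \<in> sets lebesgue" using assms by (simp add: sets_completionI_sets)
    then obtain T where T: "open T" "S \<subseteq> T" "emeasure lebesgue (T - S) < ennreal (1 / Suc k)"
      using sets_lebesgue_outer_open[of S "1 / Suc k"] by (metis of_nat_0_less_iff zero_less_Suc zero_less_divide_1_iff)
    moreover have "T - S \<in> sets lborel" using T(1) by auto
    ultimately show ?thesis by auto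
  qed
  then obtain U where U: "\<And>k. open (U k)" "\<And>k. S \<subseteq> U k" "\<And>k. emeasure lborel (U k - S) < ennreal (1 / Suc k)"
    by metis
  have [measurable]: "U k \<in> sets borel" for k using U(1) by auto
  define N where "N m = (\<Inter>k. maxset (indicator (U k - S)) (1 / Suc m))" for m
  have maxm: "maxset (indicator (U k - S)) (1 / Suc m) \<in> sets borel" for m k
    by (intro borel_open open_maxset) simp
  have N: "N m \<in> null_sets lborel" for m
  proof (rule null_setsI)
    show "N m \<in> sets lborel" unfolding N_def using maxm by (auto intro!: sets.countable_INT)
    have "ennreal (1 / Suc m) * emeasure lborel (N m) \<le> ennreal (5 ^ DIM('a) * (1 / Suc k))" for k
    proof -
      have "ennreal (1 / Suc m) * emeasure lborel (N m) \<le> ennreal (1 / Suc m) * emeasure lborel (maxset (indicator (U k - S)) (1 / Suc m))"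
        using maxm by (intro mult_left_mono emeasure_mono) (auto simp: N_def)
      also have "\<dots> \<le> ennreal (5 ^ DIM('a)) * (\<integral>\<^sup>+y. indicator (U k - S) y \<partial>lborel)"
        by (rule emeasure_maxset_le) auto
      also have "(\<integral>\<^sup>+y. indicator (U k - S) y \<partial>lborel) \<le> ennreal (1 / Suc k)"
        using U(3)[of k] by simp
      finally show ?thesis by (subst ennreal_mult) (auto simp: mult_left_mono)
    qed
    moreover have "(\<lambda>k. ennreal (5 ^ DIM('a) * (1 / Suc k))) \<longlonglongrightarrow> ennreal 0"
      by (intro tendsto_ennrealI) real_asymp
    ultimately have "ennreal (1 / Suc m) * emeasure lborel (N m) \<le> ennreal 0"
      by (intro LIMSEQ_le_const) auto
    then show "emeasure lborel (N m) = 0" by (simp add: ennreal_zero_less_divide)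
  qed
  have "AE x in lborel. \<forall>m. x \<notin> N m"
    using N by (subst AE_all_countable) (auto intro: AE_not_in)
  then show ?thesis
  proof (rule AE_mp, intro AE_I2 impI allI)
    fix x and e :: real assume x: "\<forall>m. x \<notin> N m" "x \<in> S" and e: "0 < e"
    obtain m where m: "1 / Suc m < e" using nat_approx_posE[OF e] by blast
    obtain k where k: "x \<notin> maxset (indicator (U k - S)) (1 / Suc m)" using x(1) by (auto simp: N_def)
    obtain R where R: "0 < R" "ball x R \<subseteq> U k" using U(1,2) x(2) open_contains_ball by (metis subsetD)
    show "\<exists>R>0. \<forall>r. 0 < r \<and> r < R \<longrightarrow> emeasure lborel (ball x r - S) \<le> ennreal e * emeasure lborel (ball x r)"
    proof (intro exI[of _ R] conjI R(1) allI impI)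
      fix r assume r: "0 < r \<and> r < R"
      then have sub: "ball x r \<subseteq> U k" using R(2) subset_ball[of r R x] by auto
      have "emeasure lborel (ball x r - S) = (\<integral>\<^sup>+y. indicator (ball x r - S) y \<partial>lborel)"
        by (rule nn_integral_indicator[symmetric]) simp
      also have "\<dots> \<le> (\<integral>\<^sup>+y\<in>ball x r. indicator (U k - S) y \<partial>lborel)"
        using sub by (intro nn_integral_mono) (auto simp: indicator_def)
      also have "\<dots> \<le> ennreal (1 / Suc m) * emeasure lborel (ball x r)"
        using not_in_maxset[OF k] r by auto
      also have "\<dots> \<le> ennreal e * emeasure lborel (ball x r)"
        using m by (intro mult_right_mono ennreal_leI) auto
      finally show "emeasure lborel (ball x r - S) \<le> ennreal e * emeasure lborel (ball x r)" .
    qed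
  qed
qed

text \<open>Values are sorted into bands of width 1 / Suc m. At a density point of its own band, F
  differs from F x by at most that width except on a small proportion of each small ball, where the
  crude bound 2 * B suffices.\<close>

lemma AE_lebesgue_point:
  fixes F :: "'a::euclidean_space \<Rightarrow> real"
  assumes [measurable]: "F \<in> borel_measurable borel" and B: "\<And>x. \<bar>F x\<bar> \<le> B"
  shows "AE x in lborel. \<forall>e>0. \<exists>R>0. \<forall>r. 0 < r \<and> r < R \<longrightarrow>
           (\<integral>\<^sup>+y\<in>ball x r. ennreal \<bar>F y - F x\<bar> \<partial>lborel) \<le> ennreal e * emeasure lborel (ball x r)"
proof -
  define S where "S m i = {y. \<lfloor>real (Suc m) * F y\<rfloor> = i}" for m :: nat and i :: int
  have [measurable]: "S m i \<in> sets borel" for m i unfolding S_def by measurable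
  have "AE x in lborel. \<forall>m i. x \<in> S m i \<longrightarrow> (\<forall>e>0. \<exists>R>0. \<forall>r. 0 < r \<and> r < R \<longrightarrow>
           emeasure lborel (ball x r - S m i) \<le> ennreal e * emeasure lborel (ball x r))"
    unfolding AE_all_countable by (intro allI AE_density_point) simp
  then show ?thesis
  proof (rule AE_mp, intro AE_I2 impI allI)
    fix x and e :: real
    assume x: "\<forall>m i. x \<in> S m i \<longrightarrow> (\<forall>e>0. \<exists>R>0. \<forall>r. 0 < r \<and> r < R \<longrightarrow>
           emeasure lborel (ball x r - S m i) \<le> ennreal e * emeasure lborel (ball x r))"
    assume e: "0 < e"
    have B0: "0 \<le> B" using B[of x] by linarith
    obtain m where m: "1 / Suc m < e / 2" using nat_approx_posE[of "e/2"] e by auto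
    define i where "i = \<lfloor>real (Suc m) * F x\<rfloor>"
    define e' where "e' = e / (4 * B + 4)"
    have e': "0 < e'" using e B0 by (simp add: e'_def)
    obtain R where R: "0 < R" "\<And>r. 0 < r \<Longrightarrow> r < R \<Longrightarrow>
           emeasure lborel (ball x r - S m i) \<le> ennreal e' * emeasure lborel (ball x r)"
    proof -
      have "x \<in> S m i" by (simp add: S_def i_def)
      then show ?thesis using x e' that by blast
    qed
    show "\<exists>R>0. \<forall>r. 0 < r \<and> r < R \<longrightarrow>
           (\<integral>\<^sup>+y\<in>ball x r. ennreal \<bar>F y - F x\<bar> \<partial>lborel) \<le> ennreal e * emeasure lborel (ball x r)"
    proof (intro exI[of _ R] conjI R(1) allI impI)
      fix r assume r: "0 < r \<and> r < R"
      let ?b = "emeasure lborel (ball x r)"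
      have close: "\<bar>F y - F x\<bar> \<le> 1 / Suc m" if "y \<in> S m i" for y
      proof -
        define N where "N = real (Suc m)"
        have N: "0 < N" by (simp add: N_def)
        have "\<lfloor>N * F y\<rfloor> = \<lfloor>N * F x\<rfloor>" using that by (simp only: S_def i_def N_def mem_Collect_eq)
        then have "\<bar>N * F y - N * F x\<bar> < 1" by linarith
        then have "N * \<bar>F y - F x\<bar> < 1" using N by (simp add: abs_mult flip: right_diff_distrib)
        then have "\<bar>F y - F x\<bar> \<le> 1 / N" using N by (simp add: field_simps)
        then show ?thesis by (simp add: N_def)
      qed
      have far: "\<bar>F y - F x\<bar> \<le> 2 * B" for y using B[of x] B[of y] by linarith
      have "(\<integral>\<^sup>+y\<in>ball x r. ennreal \<bar>F y - F x\<bar> \<partial>lborel) \<le>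
         (\<integral>\<^sup>+y. ennreal (e/2) * indicator (ball x r) y + ennreal (2 * B) * indicator (ball x r - S m i) y \<partial>lborel)"
      proof (intro nn_integral_mono)
        fix y 
        show "ennreal \<bar>F y - F x\<bar> * indicator (ball x r) y \<le> ennreal (e/2) * indicator (ball x r) y + ennreal (2 * B) * indicator (ball x r - S m i) y"
          using close[of y] far[of y] m e B0
          by (cases "y \<in> S m i") (auto simp: indicator_def intro!: ennreal_leI add_increasing)
      qed
      also have "\<dots> = ennreal (e/2) * ?b + ennreal (2 * B) * emeasure lborel (ball x r - S m i)"
        by (subst nn_integral_add) (auto simp: nn_integral_cmult_indicator)
      also have "\<dots> \<le> ennreal (e/2) * ?b + ennreal (2 * B) * (ennreal e' * ?b)"
        using R(2) r by (intro add_left_mono mult_left_mono) auto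
      also have "\<dots> = ennreal (e/2 + 2 * B * e') * ?b"
        using e e' B0 by (simp add: ennreal_mult distrib_right mult.assoc)
      also have "\<dots> \<le> ennreal e * ?b"
      proof (intro mult_right_mono ennreal_leI)
        have "2 * B * e' \<le> e / 2" using e B0 by (simp add: e'_def field_simps)
        then show "e/2 + 2 * B * e' \<le> e" by simp
      qed simp
      finally show "(\<integral>\<^sup>+y\<in>ball x r. ennreal \<bar>F y - F x\<bar> \<partial>lborel) \<le> ennreal e * ?b" .
    qed
  qed
qed

section \<open>Lipschitz functions on the line\<close>

text \<open>The Stieltjes measures of $L t + f(t)$ and $L t - f(t)$ add up to $2 L$ times Lebesgue measure, so the first one has a bounded density.\<close>

lemma lipschitz_real_density:
  fixes f :: "real \<Rightarrow> real"
  assumes lip: "L-lipschitz_on UNIV f"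
  obtains r where "r \<in> borel_measurable borel" "\<And>t. \<bar>r t\<bar> \<le> L"
    "\<And>a b. a \<le> b \<Longrightarrow> (LINT t:{a<..b}|lborel. r t) = f b - f a"
proof -
  have L: "0 \<le> L" using lip by (rule lipschitz_on_nonneg)
  have lipschitz_UNIV_absD: "\<bar>f x - f y\<bar> \<le> L * \<bar>x - y\<bar>" for x y
    using lipschitz_onD[OF lip, of x y] by (simp add: dist_real_def)
  have cont: "continuous_on UNIV f" using lip by (rule lipschitz_on_continuous_on)
  define F where "F t = L * t + f t" for t
  define G where "G t = L * t - f t" for t
  have mF: "F x \<le> F y" and mG: "G x \<le> G y" if "x \<le> y" for x y
    using lipschitz_UNIV_absD[of x y] that unfolding F_def G_def by (auto simp: algebra_simps)
  have "continuous_on UNIV F" "continuous_on UNIV G" 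
    unfolding F_def[abs_def] G_def[abs_def] by (intro continuous_intros cont)+
  then have cF: "continuous (at_right a) F" and cG: "continuous (at_right a) G" for a
    by (auto simp: continuous_on_eq_continuous_within intro: continuous_within_subset)
  define \<mu> where "\<mu> = interval_measure F"
  define \<nu> where "\<nu> = interval_measure G"
  have sets: "sets \<mu> = sets borel" "sets \<nu> = sets borel" by (simp_all add: \<mu>_def \<nu>_def)
  define M where "M = measure_of UNIV (sets borel) (\<lambda>A. emeasure \<mu> A + emeasure \<nu> A)"
  have setsM: "sets M = sets borel" unfolding M_def by (simp add: sets.sigma_sets_eq[of borel, simplified])
  have emM: "emeasure M A = emeasure \<mu> A + emeasure \<nu> A" if A: "A \<in> sets borel" for A
  proof (rule emeasure_measure_of[OF M_def])
    show "A \<in> sets M" using A setsM by simp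
    show "countably_additive (sets M) (\<lambda>A. emeasure \<mu> A + emeasure \<nu> A)"
      unfolding countably_additive_def setsM
    proof (intro allI impI)
      fix X :: "nat \<Rightarrow> real set" assume X: "range X \<subseteq> sets borel" "disjoint_family X"
      have "(\<Sum>i. emeasure \<mu> (X i) + emeasure \<nu> (X i)) = (\<Sum>i. emeasure \<mu> (X i)) + (\<Sum>i. emeasure \<nu> (X i))"
        by (rule suminf_add[symmetric]) auto
      then show "(\<Sum>i. emeasure \<mu> (X i) + emeasure \<nu> (X i)) = emeasure \<mu> (\<Union>(range X)) + emeasure \<nu> (\<Union>(range X))"
        using X sets suminf_emeasure[of X \<mu>] suminf_emeasure[of X \<nu>] by simp
    qed
  qed (auto simp: positive_def)
  have eq: "M = density lborel (\<lambda>_. ennreal (2 * L))"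
  proof (rule measure_eqI_generator_eq[where E = "range (\<lambda>(a, b). {a<..b})" and \<Omega> = UNIV and A = "\<lambda>n. {- real n <.. real n}"])
    show "Int_stable (range (\<lambda>(a, b). {a<..b::real}))"
    proof (rule Int_stableI)
      fix A B assume "A \<in> range (\<lambda>(a, b). {a<..b::real})" "B \<in> range (\<lambda>(a, b). {a<..b::real})"
      then obtain a b c d where "A = {a<..b}" "B = {c<..d}" by auto
      then have "A \<inter> B = (\<lambda>(a,b). {a<..b}) (max a c, min b d)" by auto
      then show "A \<inter> B \<in> range (\<lambda>(a, b). {a<..b})" by blast
    qed
    show sM: "sets M = sigma_sets UNIV (range (\<lambda>(a, b). {a<..b}))"
      unfolding setsM borel_sigma_sets_Ioc by (simp add: sets_measure_of)
    show "sets (density lborel (\<lambda>_::real. ennreal (2 * L))) = sigma_sets UNIV (range (\<lambda>(a, b). {a<..b}))"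
      using sM setsM by simp
    fix X assume "X \<in> range (\<lambda>(a, b). {a<..b::real})"
    then obtain a b where X: "X = {a<..b}" by auto
    have "emeasure M X = ennreal (if a \<le> b then F b - F a else 0) + ennreal (if a \<le> b then G b - G a else 0)"
      unfolding X by (subst emM) (auto simp: \<mu>_def \<nu>_def emeasure_interval_measure_Ioc mF mG cF cG)
    also have "\<dots> = ennreal (if a \<le> b then 2 * L * (b - a) else 0)"
      using mF[of a b] mG[of a b] by (auto simp: F_def G_def algebra_simps simp flip: ennreal_plus)
    also have "\<dots> = emeasure (density lborel (\<lambda>_. ennreal (2 * L))) X"
      unfolding X using L by (auto simp: emeasure_density nn_integral_cmult_indicator ennreal_mult)
    finally show "emeasure M X = emeasure (density lborel (\<lambda>_. ennreal (2 * L))) X" .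
  next
    show "(\<Union>n. {- real n<..real n}) = UNIV"
    proof (intro equalityI subsetI UNIV_I)
      fix x :: real
      obtain n where "\<bar>x\<bar> < real n" using reals_Archimedean2 by blast
      then show "x \<in> (\<Union>n. {- real n<..real n})" by (auto intro!: exI[of _ n])
    qed
    show "emeasure M {- real i<..real i} \<noteq> \<infinity>" for i
      by (subst emM) (auto simp: \<mu>_def \<nu>_def emeasure_interval_measure_Ioc mF mG cF cG)
  qed auto
  \<comment> \<open>Both summands are dominated by M, a constant multiple of Lebesgue
    measure.\<close>
  have ac: "absolutely_continuous (lborel :: real measure) N" if "N = \<mu> \<or> N = \<nu>" for N :: "real measure"
    unfolding absolutely_continuous_def
  proof (intro subsetI null_setsI)
    fix A :: "real set" assume A: "A \<in> null_sets lborel"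
    then have "emeasure M A = 0" using null_setsD1[OF A] null_setsD2[OF A]
      by (subst eq, subst emeasure_density) (auto simp: nn_integral_cmult_indicator)
    then show "emeasure N A = 0" using that A by (subst (asm) emM) auto
    show "A \<in> sets N" using A that sets by auto
  qed
  obtain r1 where r1[measurable]: "r1 \<in> borel_measurable borel" and d1: "density lborel r1 = \<mu>"
    using sigma_finite_measure.Radon_Nikodym[OF sigma_finite_lborel ac[of \<mu>]] sets by auto
  obtain r2 where r2[measurable]: "r2 \<in> borel_measurable borel" and d2: "density lborel r2 = \<nu>"
    using sigma_finite_measure.Radon_Nikodym[OF sigma_finite_lborel ac[of \<nu>]] sets by auto
  have "density lborel (\<lambda>x. r1 x + r2 x) = density lborel (\<lambda>_. ennreal (2 * L))"
  proof (rule measure_eqI)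
    fix A assume "A \<in> sets (density lborel (\<lambda>x. r1 x + r2 x))"
    then have A[measurable]: "A \<in> sets borel" by simp
    have "emeasure (density lborel (\<lambda>x. r1 x + r2 x)) A = emeasure \<mu> A + emeasure \<nu> A"
      by (simp add: emeasure_density distrib_right nn_integral_add flip: d1 d2)
    also have "\<dots> = emeasure (density lborel (\<lambda>_. ennreal (2 * L))) A"
      using emM[OF A] by (simp add: eq)
    finally show "emeasure (density lborel (\<lambda>x. r1 x + r2 x)) A = emeasure (density lborel (\<lambda>_. ennreal (2 * L))) A" .
  qed simp
  then have AE: "AE x in lborel. r1 x + r2 x = ennreal (2 * L)"
    by (subst (asm) sigma_finite_measure.density_unique_iff[OF sigma_finite_lborel]) auto
  \<comment> \<open>The minimum makes the bound hold at every point instead of almost every point;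
    subtracting L undoes the linear term added in F.\<close>
  define r where "r t = min (enn2real (r1 t)) (2 * L) - L" for t
  show thesis
  proof (rule that[of r])
    show rm[measurable]: "r \<in> borel_measurable borel" unfolding r_def[abs_def] by measurable
    show rb: "\<bar>r t\<bar> \<le> L" for t
      using L enn2real_nonneg[of "r1 t"] unfolding r_def abs_le_iff by linarith
    fix a b :: real assume ab: "a \<le> b"
    have AE1: "AE x in lborel. r1 x = ennreal (r x + L)"
      using AE
    proof (rule AE_mp, intro AE_I2 impI)
      fix x assume "r1 x + r2 x = ennreal (2 * L)"
      then have le: "r1 x \<le> ennreal (2 * L)" by (metis add.commute le_iff_add)
      then have "enn2real (r1 x) \<le> 2 * L" using L by (simp add: enn2real_leI)
      moreover have "r1 x = ennreal (enn2real (r1 x))" using le by (metis ennreal_enn2real ennreal_less_top order_le_less_trans)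
      ultimately show "r1 x = ennreal (r x + L)" by (simp add: r_def)
    qed
    have "ennreal (F b - F a) = emeasure \<mu> {a<..b}"
      unfolding \<mu>_def using emeasure_interval_measure_Ioc[OF ab, of F] mF cF by simp
    also have "\<dots> = (\<integral>\<^sup>+x\<in>{a<..b}. r1 x \<partial>lborel)" by (simp add: emeasure_density flip: d1)
    also have "\<dots> = (\<integral>\<^sup>+x. ennreal ((r x + L) * indicator {a<..b} x) \<partial>lborel)"
      by (rule nn_integral_cong_AE, rule AE_mp[OF AE1], rule AE_I2) (auto simp: indicator_def)
    finally have nn: "(\<integral>\<^sup>+x. ennreal ((r x + L) * indicator {a<..b} x) \<partial>lborel) = ennreal (F b - F a)" ..
    have int: "set_integrable lborel {a<..b} r"
      unfolding set_integrable_def using rb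
      by (intro integrableI_bounded_set_indicator[where B = L]) (auto intro!: AE_I2 simp: ab)
    have intL: "set_integrable lborel {a<..b} (\<lambda>_. L)"
      unfolding set_integrable_def by (intro integrableI_bounded_set_indicator[where B = L]) (auto intro!: AE_I2 simp: ab L)
    have "(LINT x:{a<..b}|lborel. r x + L) = enn2real (\<integral>\<^sup>+x. ennreal ((r x + L) * indicator {a<..b} x) \<partial>lborel)"
    proof -
      have nonneg: "0 \<le> r x + L" for x using rb[of x] by linarith
      show ?thesis unfolding set_lebesgue_integral_def
        by (subst integral_eq_nn_integral) (auto simp: mult.commute nonneg)
    qed
    also have "\<dots> = F b - F a" using mF[OF ab] by (simp add: nn)
    also have "(LINT x:{a<..b}|lborel. r x + L) = (LINT x:{a<..b}|lborel. r x) + (LINT x:{a<..b}|lborel. L)"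
      by (rule set_integral_add[OF int intL])
    also have "(LINT x:{a<..b}|lborel. L) = L * (b - a)"
      using ab by (simp add: set_lebesgue_integral_def)
    finally show "(LINT t:{a<..b}|lborel. r t) = f b - f a"
      by (simp add: F_def algebra_simps)
  qed
qed

text \<open>At a Lebesgue point of the density the difference quotients converge to its value. Steps
  1 / Suc n are enough, and later match the liminf in \<open>dini\<close>. The free slope
  \<open>c\<close> in the last clause measures the deviation from an affine function, which is the
  form used at Lebesgue points.\<close>

lemma lipschitz_real_derivative:
  fixes f :: "real \<Rightarrow> real"
  assumes lip: "L-lipschitz_on UNIV f"
  obtains r where "r \<in> borel_measurable borel" "\<And>t. \<bar>r t\<bar> \<le> L"
    "AE t in lborel. (\<lambda>n. (f (t + 1 / real (Suc n)) - f t) * real (Suc n)) \<longlonglongrightarrow> r t"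
    "\<And>a b c. a \<le> b \<Longrightarrow> ennreal \<bar>f b - f a - c * (b - a)\<bar> \<le> (\<integral>\<^sup>+t\<in>{a..b}. ennreal \<bar>r t - c\<bar> \<partial>lborel)"
proof -
  obtain r where r[measurable]: "r \<in> borel_measurable borel" and rb: "\<And>t. \<bar>r t\<bar> \<le> L"
    and rint: "\<And>a b. a \<le> b \<Longrightarrow> (LINT t:{a<..b}|lborel. r t) = f b - f a"
    using lipschitz_real_density[OF lip] by blast
  have incr: "ennreal \<bar>f b - f a - c * (b - a)\<bar> \<le> (\<integral>\<^sup>+t\<in>{a..b}. ennreal \<bar>r t - c\<bar> \<partial>lborel)" if ab: "a \<le> b" for a b c
  proof -
    have int: "set_integrable lborel {a<..b} r"
      unfolding set_integrable_def using rb
      by (intro integrableI_bounded_set_indicator[where B = L]) (auto intro!: AE_I2 simp: ab)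
    have intc: "set_integrable lborel {a<..b} (\<lambda>_. c)"
      unfolding set_integrable_def by (intro integrableI_bounded_set_indicator[where B = "\<bar>c\<bar>"]) (auto intro!: AE_I2 simp: ab)
    have "(LINT t:{a<..b}|lborel. r t - c) = (LINT t:{a<..b}|lborel. r t) - (LINT t:{a<..b}|lborel. c)"
      by (rule set_integral_diff(2)[OF int intc])
    also have "\<dots> = f b - f a - c * (b - a)"
      using ab by (simp add: rint) (simp add: set_lebesgue_integral_def)
    finally have "ennreal \<bar>f b - f a - c * (b - a)\<bar> = ennreal (norm (LINT t:{a<..b}|lborel. r t - c))" by simp
    also have "\<dots> \<le> (\<integral>\<^sup>+t. ennreal (norm (indicator {a<..b} t *\<^sub>R (r t - c))) \<partial>lborel)"
      unfolding set_lebesgue_integral_def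
      using set_integral_diff(1)[OF int intc] unfolding set_integrable_def by (rule integral_norm_bound_ennreal)
    also have "\<dots> \<le> (\<integral>\<^sup>+t\<in>{a..b}. ennreal \<bar>r t - c\<bar> \<partial>lborel)"
      by (intro nn_integral_mono) (auto simp: indicator_def)
    finally show ?thesis .
  qed
  have "AE t in lborel. (\<lambda>n. (f (t + 1 / real (Suc n)) - f t) * real (Suc n)) \<longlonglongrightarrow> r t"
    using AE_lebesgue_point[OF r rb]
  proof (rule AE_mp, intro AE_I2 impI)
    fix t
    assume lp: "\<forall>e>0. \<exists>R>0. \<forall>h. 0 < h \<and> h < R \<longrightarrow>
           (\<integral>\<^sup>+y\<in>ball t h. ennreal \<bar>r y - r t\<bar> \<partial>lborel) \<le> ennreal e * emeasure lborel (ball t h)"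
    show "(\<lambda>n. (f (t + 1 / real (Suc n)) - f t) * real (Suc n)) \<longlonglongrightarrow> r t"
    proof (rule metric_LIMSEQ_I)
      fix e :: real assume e: "0 < e"
      \<comment> \<open>The open ball of radius 2h contains the closed interval from t to t + h and
        has length 4h, so e/8 becomes e/2 times h.\<close>
      obtain R where R: "0 < R" "\<And>h. 0 < h \<Longrightarrow> h < R \<Longrightarrow>
           (\<integral>\<^sup>+y\<in>ball t h. ennreal \<bar>r y - r t\<bar> \<partial>lborel) \<le> ennreal (e/8) * emeasure lborel (ball t h)"
        using lp e by (metis divide_pos_pos zero_less_numeral)
      obtain N where N: "1 / Suc N < R / 2" using nat_approx_posE[of "R/2"] R(1) by auto
      show "\<exists>N. \<forall>n\<ge>N. dist ((f (t + 1 / real (Suc n)) - f t) * real (Suc n)) (r t) < e"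
      proof (intro exI[of _ N] allI impI)
        fix n assume "N \<le> n"
        define M where "M = real (Suc n)"
        have M: "0 < M" by (simp add: M_def)
        define h where "h = 1 / M"
        have h: "0 < h" "h * M = 1" using M by (simp_all add: h_def)
        have "h \<le> 1 / Suc N" using \<open>N \<le> n\<close> by (auto simp: h_def M_def intro!: divide_left_mono)
        then have h2: "2 * h < R" using N by linarith
        have "ennreal \<bar>f (t + h) - f t - r t * h\<bar> \<le> (\<integral>\<^sup>+y\<in>{t..t+h}. ennreal \<bar>r y - r t\<bar> \<partial>lborel)"
          using incr[of t "t + h" "r t"] h(1) by simp
        also have "\<dots> \<le> (\<integral>\<^sup>+y\<in>ball t (2*h). ennreal \<bar>r y - r t\<bar> \<partial>lborel)"
          using h(1) by (intro nn_integral_mono) (auto simp: indicator_def dist_real_def)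
        also have "\<dots> \<le> ennreal (e/8) * emeasure lborel (ball t (2*h))"
          using R(2)[of "2*h"] h h2 by simp
        also have "\<dots> = ennreal (e / 8 * (4 * h))"
        proof -
          have em: "emeasure lborel (ball t (2 * h)) = ennreal (4 * h)"
            using h(1) by (simp add: ball_eq_greaterThanLessThan)
          show ?thesis unfolding em by (rule ennreal_mult[symmetric]) (use h(1) e in auto)
        qed
        finally have "\<bar>f (t + h) - f t - r t * h\<bar> \<le> e / 2 * h"
          using e h(1) by (subst (asm) ennreal_le_iff) auto
        then have "\<bar>f (t + h) - f t - r t * h\<bar> * M \<le> e / 2 * h * M"
          using M by (intro mult_right_mono) auto
        moreover have "(f (t + h) - f t) * M - r t = (f (t + h) - f t - r t * h) * M"
          using h(2) by (simp add: left_diff_distrib mult.assoc)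
        ultimately have "\<bar>(f (t + h) - f t) * M - r t\<bar> \<le> e / 2"
          using h(2) M by (simp add: abs_mult mult.assoc)
        then show "dist ((f (t + 1 / real (Suc n)) - f t) * real (Suc n)) (r t) < e"
          using e unfolding dist_real_def h_def M_def by linarith
      qed
    qed
  qed
  then show thesis by (rule that[OF r rb _ incr])
qed

section \<open>Directional derivatives along a fixed sequence of steps\<close>

text \<open>A lower directional derivative along the step sizes $1/(n+1)$ only: defined everywhere and Borel measurable.\<close>

definition dini :: "('a::real_normed_vector \<Rightarrow> real) \<Rightarrow> 'a \<Rightarrow> 'a \<Rightarrow> real" where
  "dini u v x = real_of_ereal (liminf (\<lambda>n. ereal ((u (x + (1 / real (Suc n)) *\<^sub>R v) - u x) * real (Suc n))))"

lemma dini_eqI: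
  assumes "(\<lambda>n. (u (x + (1 / real (Suc n)) *\<^sub>R v) - u x) * real (Suc n)) \<longlonglongrightarrow> l"
  shows "dini u v x = l"
proof -
  have "(\<lambda>n. ereal ((u (x + (1 / real (Suc n)) *\<^sub>R v) - u x) * real (Suc n))) \<longlonglongrightarrow> ereal l"
    using assms by (rule tendsto_ereal)
  then have "liminf (\<lambda>n. ereal ((u (x + (1 / real (Suc n)) *\<^sub>R v) - u x) * real (Suc n))) = ereal l"
    by (rule lim_imp_Liminf[OF sequentially_bot])
  then show ?thesis unfolding dini_def by (simp only: real_of_ereal.simps)
qed

lemma abs_dini_le:
  assumes "\<And>e. 0 < e \<Longrightarrow> \<forall>\<^sub>F n in sequentially. \<bar>(u (x + (1 / real (Suc n)) *\<^sub>R v) - u x) * real (Suc n)\<bar> \<le> K + e"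
  shows "\<bar>dini u v x\<bar> \<le> K"
proof (rule field_le_epsilon)
  fix e :: real assume e: "0 < e"
  let ?q = "\<lambda>n. (u (x + (1 / real (Suc n)) *\<^sub>R v) - u x) * real (Suc n)"
  have ev: "\<forall>\<^sub>F n in sequentially. \<bar>?q n\<bar> \<le> K + e" by (rule assms[OF e])
  have 1: "ereal (- (K + e)) \<le> liminf (\<lambda>n. ereal (?q n))"
    by (rule Liminf_bounded) (use ev in \<open>auto elim!: eventually_mono\<close>)
  have "liminf (\<lambda>n. ereal (?q n)) \<le> limsup (\<lambda>n. ereal (?q n))" by (rule Liminf_le_Limsup) simp
  also have "\<dots> \<le> ereal (K + e)"
    by (rule Limsup_bounded) (use ev in \<open>auto elim!: eventually_mono\<close>)
  finally have 2: "liminf (\<lambda>n. ereal (?q n)) \<le> ereal (K + e)" .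
  show "\<bar>dini u v x\<bar> \<le> K + e"
    using 1 2 unfolding dini_def by (cases "liminf (\<lambda>n. ereal (?q n))") auto
qed

lemma borel_measurable_dini:
  fixes u :: "'a::euclidean_space \<Rightarrow> real"
  assumes "continuous_on UNIV u"
  shows "dini u v \<in> borel_measurable borel"
proof -
  have [measurable]: "u \<in> borel_measurable borel" using assms by (rule borel_measurable_continuous_onI)
  show ?thesis unfolding dini_def[abs_def] by measurable
qed

text \<open>The restriction of u to a line has a bounded density, which at almost every parameter is
  the limit of the very quotients that define \<open>dini\<close>. As \<open>dini\<close> is defined
  everywhere, the bound holds on every segment, with no exceptional lines.\<close>

lemma segment_dini:
  fixes u :: "'a::euclidean_space \<Rightarrow> real"
  assumes lip: "L-lipschitz_on UNIV u" and t: "0 \<le> t"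
  shows "ennreal \<bar>u (x + t *\<^sub>R v) - u x - c * t\<bar> \<le> (\<integral>\<^sup>+s\<in>{0..t}. ennreal \<bar>dini u v (x + s *\<^sub>R v) - c\<bar> \<partial>lborel)"
proof -
  define f where "f s = u (x + s *\<^sub>R v)" for s
  have "(L * norm v)-lipschitz_on UNIV f"
  proof (rule lipschitz_onI)
    fix s s' :: real
    have "dist (f s) (f s') \<le> L * dist (x + s *\<^sub>R v) (x + s' *\<^sub>R v)"
      unfolding f_def by (rule lipschitz_onD[OF lip]) auto
    also have "dist (x + s *\<^sub>R v) (x + s' *\<^sub>R v) = norm v * dist s s'"
      by (simp add: dist_norm flip: scaleR_left_diff_distrib)
    finally show "dist (f s) (f s') \<le> L * norm v * dist s s'" by (simp add: mult.assoc)
  qed (use lipschitz_on_nonneg[OF lip] in auto)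
  then show ?thesis
  proof (rule lipschitz_real_derivative)
    fix r assume r: "AE t in lborel. (\<lambda>n. (f (t + 1 / real (Suc n)) - f t) * real (Suc n)) \<longlonglongrightarrow> r t"
    "\<And>a b c. a \<le> b \<Longrightarrow> ennreal \<bar>f b - f a - c * (b - a)\<bar> \<le> (\<integral>\<^sup>+t\<in>{a..b}. ennreal \<bar>r t - c\<bar> \<partial>lborel)"
  have "ennreal \<bar>u (x + t *\<^sub>R v) - u x - c * t\<bar> \<le> (\<integral>\<^sup>+s\<in>{0..t}. ennreal \<bar>r s - c\<bar> \<partial>lborel)"
    using r(2)[OF t, of c] by (simp add: f_def)
  also have "\<dots> = (\<integral>\<^sup>+s\<in>{0..t}. ennreal \<bar>dini u v (x + s *\<^sub>R v) - c\<bar> \<partial>lborel)"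
  proof (rule nn_integral_cong_AE, rule AE_mp[OF r(1)], intro AE_I2 impI)
    fix s assume "(\<lambda>n. (f (s + 1 / real (Suc n)) - f s) * real (Suc n)) \<longlonglongrightarrow> r s"
    then have "dini u v (x + s *\<^sub>R v) = r s"
      by (intro dini_eqI) (simp add: f_def scaleR_left_distrib add.assoc)
    then show "ennreal \<bar>r s - c\<bar> * indicator {0..t} s = ennreal \<bar>dini u v (x + s *\<^sub>R v) - c\<bar> * indicator {0..t} s" by simp
  qed
  finally show ?thesis .
  qed
qed

section \<open>Pointwise Lipschitz constants\<close>

text \<open>The infimum is over a nonempty set only if \<^term>\<open>u\<close> is Lipschitz near \<^term>\<open>x\<close>.\<close>

definition local_lip :: "('a::metric_space \<Rightarrow> real) \<Rightarrow> 'a \<Rightarrow> real" where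
  "local_lip u x = Inf {c. 0 \<le> c \<and> (\<exists>r>0. \<forall>y\<in>ball x r. \<bar>u y - u x\<bar> \<le> c * dist y x)}"

lemma lipschitz_on_borel_measurable:
  fixes u :: "'a::euclidean_space \<Rightarrow> real"
  assumes "L-lipschitz_on UNIV u"
  shows "u \<in> borel_measurable borel"
  using lipschitz_on_continuous_on[OF assms] by (rule borel_measurable_continuous_onI)

lemma local_lip_le:
  assumes "0 \<le> c" "0 < r" "\<And>y. dist y x < r \<Longrightarrow> \<bar>u y - u x\<bar> \<le> c * dist y x"
  shows "local_lip u x \<le> c"
  unfolding local_lip_def
  by (rule cInf_lower) (use assms in \<open>auto intro!: bdd_belowI[of _ 0] exI[of _ r] simp: dist_commute\<close>)

lemma local_lip_le_eps:
  assumes "0 \<le> c" and "\<And>e. 0 < e \<Longrightarrow> \<exists>r>0. \<forall>y. dist y x < r \<longrightarrow> \<bar>u y - u x\<bar> \<le> (c + e) * dist y x"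
  shows "local_lip u x \<le> c"
proof (rule field_le_epsilon)
  fix e :: real assume e: "0 < e"
  then obtain r where "r > 0" "\<And>y. dist y x < r \<Longrightarrow> \<bar>u y - u x\<bar> \<le> (c + e) * dist y x"
    using assms(2) by blast
  then show "local_lip u x \<le> c + e" using assms(1) e by (intro local_lip_le) auto
qed

context
  fixes u :: "'a::metric_space \<Rightarrow> real" and L :: real
  assumes lip: "L-lipschitz_on UNIV u"
begin

lemma lipschitz_UNIV_absD: "\<bar>u y - u x\<bar> \<le> L * dist y x"
  using lipschitz_onD[OF lip, of y x] by (simp add: dist_real_def)

lemma local_lip_set_nonempty: "L \<in> {c. 0 \<le> c \<and> (\<exists>r>0. \<forall>y\<in>ball x r. \<bar>u y - u x\<bar> \<le> c * dist y x)}"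
proof -
  have "\<forall>y\<in>ball x 1. \<bar>u y - u x\<bar> \<le> L * dist y x" using lipschitz_UNIV_absD by blast
  then show ?thesis using lipschitz_on_nonneg[OF lip] zero_less_one by blast
qed

lemma local_lip_le_const: "local_lip u x \<le> L"
  by (rule local_lip_le[where r = 1]) (use lipschitz_on_nonneg[OF lip] lipschitz_UNIV_absD in auto)

lemma local_lip_nonneg: "0 \<le> local_lip u x"
  unfolding local_lip_def
  by (rule cInf_greatest) (use local_lip_set_nonempty in blast)+

lemma local_lip_less:
  assumes "local_lip u x < c"
  obtains r where "0 < r" "\<And>y. dist y x < r \<Longrightarrow> \<bar>u y - u x\<bar> \<le> c * dist y x"
proof -
  let ?S = "{c. 0 \<le> c \<and> (\<exists>r>0. \<forall>y\<in>ball x r. \<bar>u y - u x\<bar> \<le> c * dist y x)}"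
  have "?S \<noteq> {}"
    using local_lip_set_nonempty by blast
  then obtain d where d: "d \<in> ?S" "d < c"
    using cInf_lessD[of ?S c] assms unfolding local_lip_def by blast
  then obtain r where r: "0 < r" "\<And>y. y \<in> ball x r \<Longrightarrow> \<bar>u y - u x\<bar> \<le> d * dist y x" by blast
  show thesis
  proof (rule that[OF r(1)])
    fix y assume "dist y x < r"
    then have "\<bar>u y - u x\<bar> \<le> d * dist y x" using r(2)[of y] by (simp add: dist_commute)
    also have "\<dots> \<le> c * dist y x" using d(2) by (intro mult_right_mono) auto
    finally show "\<bar>u y - u x\<bar> \<le> c * dist y x" .
  qed
qed

lemma local_lip_eps:
  assumes "0 < e"
  obtains r where "0 < r" "\<And>y. dist y x < r \<Longrightarrow> \<bar>u y - u x\<bar> \<le> (local_lip u x + e) * dist y x"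
  using local_lip_less[of x "local_lip u x + e"] assms by auto

end

text \<open>With the slope c and the radius 1 / Suc n fixed, the defining condition is an
  intersection over displacements of closed conditions on x. Rational c and natural n then give a
  countable union of closed sets.\<close>

lemma borel_measurable_local_lip:
  fixes u :: "'a::euclidean_space \<Rightarrow> real"
  assumes lip: "L-lipschitz_on UNIV u"
  shows "local_lip u \<in> borel_measurable borel"
proof (rule borel_measurableI_less)
  fix a
  have cont: "continuous_on UNIV u" using lip by (rule lipschitz_on_continuous_on)
  define C where "C c n = {x. \<forall>y\<in>ball x (1 / real (Suc n)). \<bar>u y - u x\<bar> \<le> c * dist y x}" for c n
  have closed: "closed (C c n)" for c n
  proof -
    have "C c n = (\<Inter>v\<in>ball 0 (1 / real (Suc n)). {x. \<bar>u (x + v) - u x\<bar> \<le> c * norm v})"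
    proof (intro set_eqI iffI)
      fix x assume "x \<in> C c n"
      then show "x \<in> (\<Inter>v\<in>ball 0 (1 / real (Suc n)). {x. \<bar>u (x + v) - u x\<bar> \<le> c * norm v})"
        unfolding C_def by (auto simp: dist_norm dest: bspec[of _ _ "x + _"])
    next
      fix x assume x: "x \<in> (\<Inter>v\<in>ball 0 (1 / real (Suc n)). {x. \<bar>u (x + v) - u x\<bar> \<le> c * norm v})"
      show "x \<in> C c n" unfolding C_def
      proof (intro CollectI ballI)
        fix y assume "y \<in> ball x (1 / real (Suc n))"
        then have "y - x \<in> ball 0 (1 / real (Suc n))" by (simp add: dist_norm norm_minus_commute)
        then have "\<bar>u (x + (y - x)) - u x\<bar> \<le> c * norm (y - x)" using x by blast
        then show "\<bar>u y - u x\<bar> \<le> c * dist y x" by (simp add: dist_norm)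
      qed
    qed
    moreover have "closed {x. \<bar>u (x + v) - u x\<bar> \<le> c * norm v}" for v
      by (intro closed_Collect_le continuous_intros continuous_on_compose2[OF cont]) auto
    ultimately show ?thesis by auto
  qed
  have "{x. local_lip u x < a} = (\<Union>c\<in>\<rat> \<inter> {0..<a}. \<Union>n. C c n)"
  proof (intro set_eqI iffI)
    fix x assume "x \<in> {x. local_lip u x < a}"
    then obtain c where c: "c \<in> \<rat>" "local_lip u x < c" "c < a" using Rats_dense_in_real by blast
    obtain r where r: "0 < r" "\<And>y. dist y x < r \<Longrightarrow> \<bar>u y - u x\<bar> \<le> c * dist y x"
      using local_lip_less[OF lip c(2)] by blast
    obtain n where n: "1 / real (Suc n) < r" using nat_approx_posE[OF r(1)] by blast
    have "x \<in> C c n" unfolding C_def using r(2) n by (auto simp: dist_commute)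
    moreover have "0 \<le> c" using c(2) local_lip_nonneg[OF lip, of x] by simp
    ultimately show "x \<in> (\<Union>c\<in>\<rat> \<inter> {0..<a}. \<Union>n. C c n)" using c by auto
  next
    fix x assume "x \<in> (\<Union>c\<in>\<rat> \<inter> {0..<a}. \<Union>n. C c n)"
    then obtain c n where c: "0 \<le> c" "c < a" "x \<in> C c n" by auto
    have "local_lip u x \<le> c"
      by (rule local_lip_le[OF c(1), of "1 / real (Suc n)"]) (use c(3) in \<open>auto simp: C_def dist_commute\<close>)
    then show "x \<in> {x. local_lip u x < a}" using c by simp
  qed
  moreover have "(\<Union>c\<in>\<rat> \<inter> {0..<a}. \<Union>n. C c n) \<in> sets borel"
    using closed by (intro sets.countable_UN' countable_Int1 countable_rat sets.countable_UN) (auto intro: borel_closed)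
  ultimately show "{x \<in> space borel. local_lip u x < a} \<in> sets borel" by simp
qed

section \<open>Comparison of derivatives with the pointwise Lipschitz constant\<close>

lemma grad_norm_nonneg: "0 \<le> grad_norm u y"
proof (cases "u differentiable (at y)")
  case True
  then have "(u has_derivative frechet_derivative u (at y)) (at y)" by (rule frechet_derivative_works[THEN iffD1])
  from onorm_pos_le[OF has_derivative_bounded_linear[OF this]] show ?thesis using True by (simp add: grad_norm_def)
qed (simp add: grad_norm_def)

text \<open>The derivative is tested on small multiples of v, and \<open>grad_norm\<close> is 0
  where there is no derivative. Since this holds at every point, upper bounds for capacities may use
  \<open>local_lip\<close> without any almost-everywhere argument.\<close>

lemma grad_norm_le_local_lip:
  fixes u :: "'a::euclidean_space \<Rightarrow> real"
  assumes lip: "L-lipschitz_on UNIV u"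
  shows "grad_norm u x \<le> local_lip u x"
proof (cases "u differentiable (at x)")
  case True
  let ?D = "frechet_derivative u (at x)"
  have D: "(u has_derivative ?D) (at x)" using True frechet_derivative_works by blast
  have bl: "bounded_linear ?D" using D by (rule has_derivative_bounded_linear)
  have "onorm ?D \<le> local_lip u x"
  proof (rule onorm_le)
    fix v
    show "norm (?D v) \<le> local_lip u x * norm v"
    proof (rule field_le_epsilon)
      fix e :: real assume e: "0 < e"
      define e' where "e' = e / (2 * norm v + 1)"
      have np: "0 < 2 * norm v + 1" by (simp add: add_nonneg_pos)
      have e': "0 < e'" using e np by (simp add: e'_def)
      obtain r1 where r1: "0 < r1" "\<And>y. dist y x < r1 \<Longrightarrow> \<bar>u y - u x\<bar> \<le> (local_lip u x + e') * dist y x"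
        using local_lip_eps[OF lip e'] by blast
      obtain r2 where r2: "0 < r2" "\<And>y. norm (y - x) < r2 \<Longrightarrow> norm (u y - u x - ?D (y - x)) \<le> e' * norm (y - x)"
        using D e' unfolding has_derivative_at_alt by blast
      define t where "t = min r1 r2 / (2 * norm v + 1)"
      have t: "0 < t" using r1 r2 np by (simp add: t_def)
      have "t * norm v < min r1 r2"
      proof -
        have "t * (2 * norm v + 1) = min r1 r2" using np by (simp add: t_def)
        then have "2 * (t * norm v) + t = min r1 r2" by (simp add: algebra_simps)
        moreover have "0 \<le> t * norm v" using t by simp
        ultimately show ?thesis using t by linarith
      qed
      then have small: "norm (t *\<^sub>R v) < r1" "norm (t *\<^sub>R v) < r2" using t by auto
      have "norm (?D (t *\<^sub>R v)) \<le> \<bar>u (x + t *\<^sub>R v) - u x\<bar> + norm (u (x + t *\<^sub>R v) - u x - ?D (t *\<^sub>R v))"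
        by simp
      also have "\<dots> \<le> (local_lip u x + e') * norm (t *\<^sub>R v) + e' * norm (t *\<^sub>R v)"
        using r1(2)[of "x + t *\<^sub>R v"] r2(2)[of "x + t *\<^sub>R v"] small by (intro add_mono) (auto simp: dist_norm)
      also have "\<dots> = t * (local_lip u x * norm v + 2 * e' * norm v)" using t by (simp add: algebra_simps)
      finally have "t * norm (?D v) \<le> t * (local_lip u x * norm v + 2 * e' * norm v)"
        using t by (simp add: linear_cmul[OF bounded_linear.linear[OF bl]] abs_mult)
      then have "norm (?D v) \<le> local_lip u x * norm v + 2 * e' * norm v" using t by simp
      moreover have "2 * e' * norm v \<le> e" using np e by (simp add: e'_def field_simps)
      ultimately show "norm (?D v) \<le> local_lip u x * norm v + e" by linarith
    qed
  qed
  then show ?thesis using True by (simp add: grad_norm_def)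
qed (use local_lip_nonneg[OF lip] in \<open>simp add: grad_norm_def\<close>)

lemma local_lip_le_grad_norm:
  fixes u :: "'a::euclidean_space \<Rightarrow> real"
  assumes "u differentiable (at x)"
  shows "local_lip u x \<le> grad_norm u x"
proof -
  let ?D = "frechet_derivative u (at x)"
  have D: "(u has_derivative ?D) (at x)" using assms frechet_derivative_works by blast
  have bl: "bounded_linear ?D" using D by (rule has_derivative_bounded_linear)
  have "local_lip u x \<le> onorm ?D"
  proof (rule local_lip_le_eps[OF onorm_pos_le[OF bl]])
    fix e :: real assume "0 < e"
    then obtain r where r: "0 < r" "\<And>y. norm (y - x) < r \<Longrightarrow> norm (u y - u x - ?D (y - x)) \<le> e * norm (y - x)"
      using D unfolding has_derivative_at_alt by blast
    show "\<exists>r>0. \<forall>y. dist y x < r \<longrightarrow> \<bar>u y - u x\<bar> \<le> (onorm ?D + e) * dist y x"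
    proof (intro exI[of _ r] conjI r(1) allI impI)
      fix y assume "dist y x < r"
      then have "norm (u y - u x - ?D (y - x)) \<le> e * norm (y - x)" using r(2) by (simp add: dist_norm)
      moreover have "norm (?D (y - x)) \<le> onorm ?D * norm (y - x)" by (rule onorm[OF bl])
      ultimately show "\<bar>u y - u x\<bar> \<le> (onorm ?D + e) * dist y x"
        by (simp add: dist_norm distrib_right)
    qed
  qed
  then show ?thesis using assms by (simp add: grad_norm_def)
qed

lemma abs_dini_le_local_lip:
  fixes u :: "'a::real_normed_vector \<Rightarrow> real"
  assumes lip: "L-lipschitz_on UNIV u"
  shows "\<bar>dini u v x\<bar> \<le> local_lip u x * norm v"
proof (rule abs_dini_le)
  fix e :: real assume e: "0 < e"
  define e' where "e' = e / (norm v + 1)"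
  have np: "0 < norm v + 1" by (simp add: add_nonneg_pos)
  have e': "0 < e'" using e np by (simp add: e'_def)
  obtain r where r: "0 < r" "\<And>y. dist y x < r \<Longrightarrow> \<bar>u y - u x\<bar> \<le> (local_lip u x + e') * dist y x"
    using local_lip_eps[OF lip e'] by blast
  have "(\<lambda>n. norm v / real (Suc n)) \<longlonglongrightarrow> 0" by real_asymp
  then have "\<forall>\<^sub>F n in sequentially. norm v / real (Suc n) < r" using r(1) by (rule order_tendstoD)
  then show "\<forall>\<^sub>F n in sequentially. \<bar>(u (x + (1 / real (Suc n)) *\<^sub>R v) - u x) * real (Suc n)\<bar> \<le> local_lip u x * norm v + e"
  proof (rule eventually_mono)
    fix n assume n: "norm v / real (Suc n) < r"
    define N where "N = real (Suc n)"
    have N: "0 < N" by (simp add: N_def)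
    have d: "dist (x + (1 / N) *\<^sub>R v) x = norm v / N" using N by (simp add: dist_norm)
    have "\<bar>u (x + (1 / N) *\<^sub>R v) - u x\<bar> \<le> (local_lip u x + e') * (norm v / N)"
      using r(2)[of "x + (1 / N) *\<^sub>R v"] n unfolding d N_def[symmetric] by simp
    then have "\<bar>u (x + (1 / N) *\<^sub>R v) - u x\<bar> * N \<le> (local_lip u x + e') * norm v"
      using N by (simp add: field_simps)
    also have "\<dots> \<le> local_lip u x * norm v + e" using np e by (simp add: e'_def field_simps)
    finally show "\<bar>(u (x + (1 / real (Suc n)) *\<^sub>R v) - u x) * real (Suc n)\<bar> \<le> local_lip u x * norm v + e"
      using N unfolding N_def by (simp add: abs_mult)
  qed
qed

section \<open>Rademacher's theorem\<close>

lemma nn_integral_lborel_shift: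
  fixes G :: "'a::euclidean_space \<Rightarrow> ennreal"
  assumes [measurable]: "G \<in> borel_measurable borel"
  shows "(\<integral>\<^sup>+z. G (c + z) \<partial>lborel) = (\<integral>\<^sup>+z. G z \<partial>lborel)"
proof -
  have "(\<integral>\<^sup>+z. G z \<partial>lborel) = (\<integral>\<^sup>+z. G z \<partial>distr lborel borel ((+) c))"
    by (simp add: lborel_distr_plus)
  also have "\<dots> = (\<integral>\<^sup>+z. G (c + z) \<partial>lborel)"
    by (rule nn_integral_distr) auto
  finally show ?thesis ..
qed

text \<open>Fubini turns segment integrals averaged over the starting point into a volume integral:
  for each parameter s the translated small ball stays inside \<open>ball x R\<close>.\<close>

lemma nn_integral_ball_segment_le:
  fixes G :: "'a::euclidean_space \<Rightarrow> ennreal"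
  assumes [measurable]: "G \<in> borel_measurable borel"
    and R: "\<And>s. 0 \<le> s \<Longrightarrow> s \<le> \<tau> \<Longrightarrow> \<rho> + norm (w + s *\<^sub>R b) \<le> R" and \<tau>: "0 \<le> \<tau>"
  shows "(\<integral>\<^sup>+z\<in>ball 0 \<rho>. (\<integral>\<^sup>+s\<in>{0..\<tau>}. G (x + z + w + s *\<^sub>R b) \<partial>lborel) \<partial>lborel)
          \<le> ennreal \<tau> * (\<integral>\<^sup>+y\<in>ball x R. G y \<partial>lborel)"
proof -
  let ?J = "\<lambda>s. (\<integral>\<^sup>+z. G (x + z + w + s *\<^sub>R b) * indicator {0..\<tau>} s * indicator (ball 0 \<rho>) z \<partial>lborel)"
  have "(\<integral>\<^sup>+z\<in>ball 0 \<rho>. (\<integral>\<^sup>+s\<in>{0..\<tau>}. G (x + z + w + s *\<^sub>R b) \<partial>lborel) \<partial>lborel)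
     = (\<integral>\<^sup>+z. (\<integral>\<^sup>+s. G (x + z + w + s *\<^sub>R b) * indicator {0..\<tau>} s * indicator (ball 0 \<rho>) z \<partial>lborel) \<partial>lborel)"
    by (simp add: nn_integral_multc)
  also have "\<dots> = (\<integral>\<^sup>+s. ?J s \<partial>lborel)"
    by (rule lborel_pair.Fubini') measurable
  also have "\<dots> \<le> (\<integral>\<^sup>+s. (\<integral>\<^sup>+y\<in>ball x R. G y \<partial>lborel) * indicator {0..\<tau>} s \<partial>lborel)"
  proof (intro nn_integral_mono)
    fix s :: real
    show "?J s
        \<le> (\<integral>\<^sup>+y\<in>ball x R. G y \<partial>lborel) * indicator {0..\<tau>} s"
    proof (cases "s \<in> {0..\<tau>}")
      case True
      define c where "c = x + (w + s *\<^sub>R b)"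
      have "?J s
         \<le> (\<integral>\<^sup>+z. G (c + z) * indicator (ball x R) (c + z) \<partial>lborel)"
      proof (intro nn_integral_mono)
        fix z
        have eq: "x + z + w + s *\<^sub>R b = c + z" by (simp add: c_def algebra_simps)
        have "c + z \<in> ball x R" if "norm z < \<rho>"
        proof -
          have "x - (c + z) = - ((w + s *\<^sub>R b) + z)" by (simp add: c_def)
          then have "dist x (c + z) = norm ((w + s *\<^sub>R b) + z)" by (simp only: dist_norm norm_minus_cancel)
          then show ?thesis using R[of s] True that norm_triangle_ineq[of "w + s *\<^sub>R b" z] by simp
        qed
        then show "G (x + z + w + s *\<^sub>R b) * indicator {0..\<tau>} s * indicator (ball 0 \<rho>) z \<le> G (c + z) * indicator (ball x R) (c + z)"
          unfolding eq by (auto simp: indicator_def)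
      qed
      also have "\<dots> = (\<integral>\<^sup>+z. G z * indicator (ball x R) z \<partial>lborel)"
        by (rule nn_integral_lborel_shift) measurable
      finally show ?thesis using True by simp
    qed simp
  qed
  also have "\<dots> = ennreal \<tau> * (\<integral>\<^sup>+y\<in>ball x R. G y \<partial>lborel)"
    using \<tau> by (subst nn_integral_cmult_indicator) (auto simp: mult.commute)
  finally show ?thesis .
qed

text \<open>A step with t < 0 is traversed backwards, from y + t b to y; this is the reason for the
  offset \<open>min t 0\<close>.\<close>

lemma segment_dini_signed:
  fixes u :: "'a::euclidean_space \<Rightarrow> real"
  assumes lip: "L-lipschitz_on UNIV u"
  shows "ennreal \<bar>u (y + t *\<^sub>R b) - u y - c * t\<bar> \<le>
     (\<integral>\<^sup>+s\<in>{0..\<bar>t\<bar>}. ennreal \<bar>dini u b (y + min t 0 *\<^sub>R b + s *\<^sub>R b) - c\<bar> \<partial>lborel)"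
proof (cases "0 \<le> t")
  case True
  then show ?thesis using segment_dini[OF lip, of t y b c] by simp
next
  case False
  then have "\<bar>u (y + t *\<^sub>R b) - u y - c * t\<bar> = \<bar>u (y + t *\<^sub>R b + \<bar>t\<bar> *\<^sub>R b) - u (y + t *\<^sub>R b) - c * \<bar>t\<bar>\<bar>"
    by (simp add: algebra_simps)
  then show ?thesis using False segment_dini[OF lip, of "\<bar>t\<bar>" "y + t *\<^sub>R b" b c] by simp
qed

text \<open>Induction on the coordinates already walked. A new leg is parallel to an axis, so its
  error involves only one directional derivative. Points of the path are displaced by at most (n +
  1) * norm v, so with \<rho> \<le> norm v the radius (n + 3) * norm v is ample.\<close>

lemma nn_integral_coordinate_path_le:
  fixes u :: "'a::euclidean_space \<Rightarrow> real"
  assumes lip: "L-lipschitz_on UNIV u" and \<rho>: "0 \<le> \<rho>" "\<rho> \<le> norm v" and B: "finite B" "B \<subseteq> Basis"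
  shows "(\<integral>\<^sup>+z\<in>ball 0 \<rho>. ennreal \<bar>u (x + z + (\<Sum>b\<in>B. (v \<bullet> b) *\<^sub>R b)) - u (x + z) - (\<Sum>b\<in>B. a b * (v \<bullet> b))\<bar> \<partial>lborel)
     \<le> (\<Sum>b\<in>B. ennreal (norm v) * (\<integral>\<^sup>+y\<in>ball x ((DIM('a) + 3) * norm v). ennreal \<bar>dini u b y - a b\<bar> \<partial>lborel))"
  using B
proof (induction B rule: finite_induct)
  case empty
  then show ?case by simp
next
  case (insert b B)
  define w where "w = (\<Sum>b\<in>B. (v \<bullet> b) *\<^sub>R b)"
  define A where "A = (\<Sum>b\<in>B. a b * (v \<bullet> b))"
  define t where "t = v \<bullet> b"
  let ?Q = "\<lambda>b. (\<integral>\<^sup>+y\<in>ball x ((DIM('a) + 3) * norm v). ennreal \<bar>dini u b y - a b\<bar> \<partial>lborel)"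
  let ?J = "\<lambda>z. (\<integral>\<^sup>+s\<in>{0..\<bar>t\<bar>}. ennreal \<bar>dini u b (x + z + (w + min t 0 *\<^sub>R b) + s *\<^sub>R b) - a b\<bar> \<partial>lborel)"
  let ?P = "\<lambda>z. ennreal \<bar>u (x + z + w) - u (x + z) - A\<bar>"
  let ?N = "\<lambda>z. ennreal \<bar>u (x + z + (w + t *\<^sub>R b)) - u (x + z) - (A + a b * t)\<bar>"
  have b: "b \<in> Basis" "norm b = 1" using insert.prems by auto
  have t: "\<bar>t\<bar> \<le> norm v" unfolding t_def using Basis_le_norm[OF b(1), of v] by simp
  have um[measurable]: "u \<in> borel_measurable borel" by (rule lipschitz_on_borel_measurable[OF lip])
  have [measurable]: "dini u b \<in> borel_measurable borel"
    using lipschitz_on_continuous_on[OF lip] by (rule borel_measurable_dini)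
  have "norm w \<le> (\<Sum>b\<in>B. norm ((v \<bullet> b) *\<^sub>R b))" unfolding w_def by (rule norm_sum)
  also have "\<dots> \<le> (\<Sum>b\<in>B. norm v)"
    using insert.prems Basis_le_norm[of _ v] by (intro sum_mono) auto
  also have "\<dots> \<le> DIM('a) * norm v"
    using insert.prems by (auto intro!: mult_right_mono card_mono)
  finally have w: "norm w \<le> DIM('a) * norm v" .
  have "(\<integral>\<^sup>+z\<in>ball 0 \<rho>. ?N z \<partial>lborel)
     \<le> (\<integral>\<^sup>+z. ?J z * indicator (ball 0 \<rho>) z
            + ?P z * indicator (ball 0 \<rho>) z \<partial>lborel)"
  proof (intro nn_integral_mono)
    fix z
    have "?N z
       \<le> ennreal (\<bar>u (x + z + w + t *\<^sub>R b) - u (x + z + w) - a b * t\<bar> + \<bar>u (x + z + w) - u (x + z) - A\<bar>)"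
      by (intro ennreal_leI) (simp add: add.assoc)
    also have "\<dots> = ennreal \<bar>u (x + z + w + t *\<^sub>R b) - u (x + z + w) - a b * t\<bar> + ?P z"
      by (rule ennreal_plus) auto
    also have "\<dots> \<le> ?J z + ?P z"
      using segment_dini_signed[OF lip, of "x + z + w" t b "a b"] by (intro add_right_mono) (simp add: add.assoc)
    finally show "?N z * indicator (ball 0 \<rho>) z
       \<le> ?J z * indicator (ball 0 \<rho>) z
            + ?P z * indicator (ball 0 \<rho>) z"
      by (auto simp: indicator_def)
  qed
  also have "\<dots> = (\<integral>\<^sup>+z\<in>ball 0 \<rho>. ?J z \<partial>lborel)
      + (\<integral>\<^sup>+z\<in>ball 0 \<rho>. ?P z \<partial>lborel)"
    by (rule nn_integral_add) measurable
  also have "\<dots> \<le> ennreal \<bar>t\<bar> * ?Q b +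
     (\<Sum>b\<in>B. ennreal (norm v) * ?Q b)"
  proof (intro add_mono)
    show "(\<integral>\<^sup>+z\<in>ball 0 \<rho>. ?J z \<partial>lborel)
        \<le> ennreal \<bar>t\<bar> * ?Q b"
    proof (rule nn_integral_ball_segment_le)
      fix s :: real assume s: "0 \<le> s" "s \<le> \<bar>t\<bar>"
      have "norm (w + min t 0 *\<^sub>R b + s *\<^sub>R b) \<le> norm w + norm ((min t 0 + s) *\<^sub>R b)"
        unfolding add.assoc scaleR_add_left[symmetric] by (rule norm_triangle_ineq)
      also have "\<dots> \<le> DIM('a) * norm v + norm v"
        using w b(2) s t by (intro add_mono) auto
      finally show "\<rho> + norm (w + min t 0 *\<^sub>R b + s *\<^sub>R b) \<le> (DIM('a) + 3) * norm v"
        using \<rho> norm_ge_zero[of v] by (simp add: distrib_right)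
    qed simp_all
    show "(\<integral>\<^sup>+z\<in>ball 0 \<rho>. ?P z \<partial>lborel) \<le>
       (\<Sum>b\<in>B. ennreal (norm v) * ?Q b)"
      unfolding w_def A_def using insert by auto
  qed
  also have "\<dots> \<le> ennreal (norm v) * ?Q b +
     (\<Sum>b\<in>B. ennreal (norm v) * ?Q b)"
    using t by (intro add_right_mono mult_right_mono ennreal_leI) auto
  finally show ?case
    using insert.hyps unfolding w_def A_def t_def by (simp add: add.commute)
qed

text \<open>At a common Lebesgue point of the directional derivatives, the increment of the remainder is averaged over coordinate paths starting in a small ball of radius \<open>\<rho> = \<eta> * norm v\<close>; moving the starting point costs at most \<open>2 * L * \<rho>\<close>.\<close>

theorem rademacher:
  fixes u :: "'a::euclidean_space \<Rightarrow> real"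
  assumes lip: "L-lipschitz_on UNIV u"
  shows "AE x in lborel. u differentiable (at x)"
proof -
  let ?n = "real DIM('a)"
  have L: "0 \<le> L" by (rule lipschitz_on_nonneg[OF lip])
  have bound: "\<bar>dini u b x\<bar> \<le> L" if "b \<in> Basis" for b x
    using abs_dini_le_local_lip[OF lip, of b x] local_lip_le_const[OF lip, of x] that by simp
  have "AE x in lborel. \<forall>b\<in>Basis. \<forall>e>0. \<exists>R>0. \<forall>r. 0 < r \<and> r < R \<longrightarrow>
      (\<integral>\<^sup>+y\<in>ball x r. ennreal \<bar>dini u b y - dini u b x\<bar> \<partial>lborel) \<le> ennreal e * emeasure lborel (ball x r)"
  proof (rule AE_finite_allI)
    fix b :: 'a assume b: "b \<in> Basis"
    show "AE x in lborel. \<forall>e>0. \<exists>R>0. \<forall>r. 0 < r \<and> r < R \<longrightarrow>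
      (\<integral>\<^sup>+y\<in>ball x r. ennreal \<bar>dini u b y - dini u b x\<bar> \<partial>lborel) \<le> ennreal e * emeasure lborel (ball x r)"
      by (rule AE_lebesgue_point[where B = L])
        (use bound[OF b] borel_measurable_dini[OF lipschitz_on_continuous_on[OF lip]] in auto)
  qed simp
  then show ?thesis
  proof (rule AE_mp, intro AE_I2 impI)
    fix x
    assume lp: "\<forall>b\<in>Basis. \<forall>e>0. \<exists>R>0. \<forall>r. 0 < r \<and> r < R \<longrightarrow>
      (\<integral>\<^sup>+y\<in>ball x r. ennreal \<bar>dini u b y - dini u b x\<bar> \<partial>lborel) \<le> ennreal e * emeasure lborel (ball x r)"
    define a where "a b = dini u b x" for b
    define A where "A v = (\<Sum>b\<in>Basis. a b * (v \<bullet> b))" for v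
    have blA: "bounded_linear A"
      unfolding A_def[abs_def] by (intro bounded_linear_sum bounded_linear_const_mult bounded_linear_inner_left)
    have "(u has_derivative A) (at x)"
      unfolding has_derivative_at_alt
    proof (intro conjI blA allI impI)
      fix e :: real assume e: "0 < e"
      \<comment> \<open>Chosen so that moving the starting point by \<eta> * norm v costs at most
        half of the permitted error.\<close>
      define \<eta> where "\<eta> = min 1 (e / (4 * L + 4))"
      have \<eta>: "0 < \<eta>" "\<eta> \<le> 1" "2 * L * \<eta> \<le> e / 2"
      proof -
        have "2 * L * \<eta> \<le> 2 * L * (e / (4 * L + 4))" using L by (intro mult_left_mono) (auto simp: \<eta>_def)
        also have "\<dots> \<le> e / 2" using L e by (simp add: field_simps)
        finally show "2 * L * \<eta> \<le> e / 2" .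
      qed (use e L in \<open>auto simp: \<eta>_def\<close>)
      \<comment> \<open>Volume ratio of the ball containing all paths to the ball of starting
        points. It does not depend on v, so the Lebesgue-point accuracy e' can be chosen after
        it.\<close>
      define K where "K = ((?n + 3) / \<eta>) ^ DIM('a)"
      have K: "0 < K" using \<eta> by (simp add: K_def add_nonneg_pos)
      define e' where "e' = e / (2 * ?n * K)"
      have e': "0 < e'" "?n * e' * K = e / 2" using e K DIM_positive[where 'a='a] by (simp_all add: e'_def)
      have "\<exists>R. \<forall>b\<in>Basis. 0 < R b \<and> (\<forall>r. 0 < r \<and> r < R b \<longrightarrow>
        (\<integral>\<^sup>+y\<in>ball x r. ennreal \<bar>dini u b y - a b\<bar> \<partial>lborel) \<le> ennreal e' * emeasure lborel (ball x r))"
        using lp e' unfolding a_def by (intro bchoice) blast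
      then obtain R where R: "\<And>b. b \<in> Basis \<Longrightarrow> 0 < R b"
        "\<And>b r. b \<in> Basis \<Longrightarrow> 0 < r \<Longrightarrow> r < R b \<Longrightarrow>
        (\<integral>\<^sup>+y\<in>ball x r. ennreal \<bar>dini u b y - a b\<bar> \<partial>lborel) \<le> ennreal e' * emeasure lborel (ball x r)"
        by blast
      define d where "d = Min (R ` Basis) / (?n + 3)"
      have d: "0 < d" using R(1) by (auto simp: d_def)
      show "\<exists>d>0. \<forall>y. norm (y - x) < d \<longrightarrow> norm (u y - u x - A (y - x)) \<le> e * norm (y - x)"
      proof (intro exI[of _ d] conjI d allI impI)
        fix y assume y: "norm (y - x) < d"
        define v where "v = y - x"
        show "norm (u y - u x - A (y - x)) \<le> e * norm (y - x)"
        proof (cases "v = 0")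
          case True
          then show ?thesis using linear_0[OF bounded_linear.linear[OF blA]] by (simp add: v_def)
        next
          case False
          then have v: "0 < norm v" by simp
          define \<rho> where "\<rho> = \<eta> * norm v"
          have \<rho>: "0 < \<rho>" "\<rho> \<le> norm v" using \<eta> v by (auto simp: \<rho>_def mult_left_le_one_le)
          let ?r = "(DIM('a) + 3) * norm v"
          have r: "0 < ?r" "?r < R b" if "b \<in> Basis" for b
          proof -
            have "norm v * (?n + 3) < Min (R ` Basis)" 
              using y by (simp add: v_def d_def pos_less_divide_eq)
            also have "\<dots> \<le> R b" using that by simp
            finally show "?r < R b" by (simp add: mult.commute)
            show "0 < ?r" using v by (simp add: add_nonneg_pos)
          qed
          let ?m = "measure lborel (ball (0::'a) \<rho>)"
          have m: "0 < ?m" by (rule content_ball_pos[OF \<rho>(1)])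
          have emr: "emeasure lborel (ball x ?r) = ennreal (K * ?m)"
          proof -
            have "?r = (?n + 3) / \<eta> * \<rho>" using \<eta> by (simp add: \<rho>_def)
            then have "emeasure lborel (ball x ?r) = ennreal K * emeasure lborel (ball (0::'a) \<rho>)"
              unfolding K_def using emeasure_lborel_ball_scale[of "(?n + 3) / \<eta>" \<rho> x 0] \<eta> \<rho> by simp
            then show ?thesis using K m by (simp add: emeasure_lborel_ball_eq ennreal_mult)
          qed
          define X where "X = \<bar>u (x + v) - u x - A v\<bar>"
          have um[measurable]: "u \<in> borel_measurable borel" by (rule lipschitz_on_borel_measurable[OF lip])
          have "ennreal (X * ?m) = (\<integral>\<^sup>+z\<in>ball (0::'a) \<rho>. ennreal X \<partial>lborel)"
            using m by (simp add: nn_integral_cmult_indicator emeasure_lborel_ball_eq ennreal_mult X_def)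
          also have "\<dots> \<le> (\<integral>\<^sup>+z. ennreal \<bar>u (x + z + v) - u (x + z) - A v\<bar> * indicator (ball 0 \<rho>) z + ennreal (2 * L * \<rho>) * indicator (ball 0 \<rho>) z \<partial>lborel)"
          proof (intro nn_integral_mono)
            fix z :: 'a
            show "ennreal X * indicator (ball 0 \<rho>) z \<le> ennreal \<bar>u (x + z + v) - u (x + z) - A v\<bar> * indicator (ball 0 \<rho>) z + ennreal (2 * L * \<rho>) * indicator (ball 0 \<rho>) z"
            proof (cases "norm z < \<rho>")
              case True
              have "\<bar>u (x + z + v) - u (x + v)\<bar> \<le> L * norm z" "\<bar>u (x + z) - u x\<bar> \<le> L * norm z"
                using lipschitz_UNIV_absD[OF lip, of "x + z + v" "x + v"] lipschitz_UNIV_absD[OF lip, of "x + z" x] by (auto simp: dist_norm)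
              moreover have "L * norm z \<le> L * \<rho>" using True L by (intro mult_left_mono) auto
              ultimately have "X \<le> \<bar>u (x + z + v) - u (x + z) - A v\<bar> + 2 * L * \<rho>"
                unfolding X_def by linarith
              then have "ennreal X \<le> ennreal \<bar>u (x + z + v) - u (x + z) - A v\<bar> + ennreal (2 * L * \<rho>)"
                using L \<rho> by (simp flip: ennreal_plus)
              then show ?thesis using True by simp
            qed simp
          qed
          also have "\<dots> = (\<integral>\<^sup>+z\<in>ball 0 \<rho>. ennreal \<bar>u (x + z + v) - u (x + z) - A v\<bar> \<partial>lborel) + (\<integral>\<^sup>+z\<in>ball (0::'a) \<rho>. ennreal (2 * L * \<rho>) \<partial>lborel)"
            by (rule nn_integral_add) measurable
          also have "(\<integral>\<^sup>+z\<in>ball (0::'a) \<rho>. ennreal (2 * L * \<rho>) \<partial>lborel) = ennreal (2 * L * \<rho> * ?m)"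
            using L \<rho> by (simp add: nn_integral_cmult_indicator emeasure_lborel_ball_eq ennreal_mult)
          also have "(\<integral>\<^sup>+z\<in>ball 0 \<rho>. ennreal \<bar>u (x + z + v) - u (x + z) - A v\<bar> \<partial>lborel) \<le>
              (\<Sum>b\<in>Basis. ennreal (norm v) * (\<integral>\<^sup>+y\<in>ball x ?r. ennreal \<bar>dini u b y - a b\<bar> \<partial>lborel))"
            using nn_integral_coordinate_path_le[OF lip, of \<rho> v Basis x a] \<rho>
            by (simp add: euclidean_representation A_def)
          also have "\<dots> \<le> (\<Sum>b\<in>(Basis::'a set). ennreal (norm v) * ennreal (e' * (K * ?m)))"
          proof (intro sum_mono mult_left_mono)
            fix b :: 'a assume b: "b \<in> Basis"
            show "(\<integral>\<^sup>+y\<in>ball x ?r. ennreal \<bar>dini u b y - a b\<bar> \<partial>lborel) \<le> ennreal (e' * (K * ?m))"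
              using R(2)[OF b r[OF b]] e' K m unfolding emr by (simp add: ennreal_mult)
          qed simp
          also have "\<dots> = ennreal (?n * (norm v * (e' * (K * ?m))))"
            using e' K m by (simp add: ennreal_mult ennreal_of_nat_eq_real_of_nat)
          finally have "ennreal (X * ?m) \<le> ennreal (?n * (norm v * (e' * (K * ?m)))) + ennreal (2 * L * \<rho> * ?m)"
            by (simp add: add_right_mono)
          also have "\<dots> = ennreal ((?n * e' * K * norm v + 2 * L * \<rho>) * ?m)"
            using e' K m L \<rho> by (subst ennreal_plus[symmetric]) (auto simp: algebra_simps)
          finally have "X * ?m \<le> (?n * e' * K * norm v + 2 * L * \<rho>) * ?m"
            using e' K m L \<rho> by (subst (asm) ennreal_le_iff) auto
          then have "X \<le> e / 2 * norm v + 2 * L * \<rho>" using m e' by simp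
          also have "2 * L * \<rho> = (2 * L * \<eta>) * norm v" by (simp add: \<rho>_def)
          also have "\<dots> \<le> e / 2 * norm v" using \<eta> by (intro mult_right_mono) auto
          finally show ?thesis by (simp add: X_def v_def)
        qed
      qed
    qed
    then show "u differentiable (at x)" by (auto simp: differentiable_def)
  qed
qed

lemma AE_local_lip_eq_grad_norm:
  fixes u :: "'a::euclidean_space \<Rightarrow> real"
  assumes "L-lipschitz_on UNIV u"
  shows "AE x in lborel. local_lip u x = grad_norm u x"
  using rademacher[OF assms]
  by (rule AE_mp) (auto intro!: AE_I2 antisym local_lip_le_grad_norm grad_norm_le_local_lip[OF assms])

section \<open>Mean oscillation\<close>

text \<open>The convex function a^p lies above its tangent at A; Young's inequality with conjugate
  exponents is a direct proof.\<close>

lemma tangent_powr_le: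
  fixes a A p :: real
  assumes "1 \<le> p" "0 \<le> a" "0 < A"
  shows "p * A powr (p - 1) * a \<le> a powr p + (p - 1) * A powr p"
proof (cases "p = 1")
  case False
  then have p: "1 < p" using assms by simp
  define q where "q = p / (p - 1)"
  have q: "1 < q" "1 / p + 1 / q = 1" using p by (auto simp: q_def field_simps)
  have "a * A powr (p - 1) \<le> a powr p / p + (A powr (p - 1)) powr q / q"
    by (rule Youngs_inequality) (use p q assms in auto)
  also have "(A powr (p - 1)) powr q = A powr p" using p by (simp add: powr_powr q_def)
  finally have "p * (a * A powr (p - 1)) \<le> p * (a powr p / p + A powr p / q)"
    using p by (intro mult_left_mono) auto
  also have "\<dots> = a powr p + (p - 1) * A powr p" using p by (simp add: q_def field_simps)
  finally show ?thesis by (simp add: mult_ac)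
qed (use assms in auto)

text \<open>Jensen's inequality, by integrating the tangent line of the p-th power at A; this works
  for every A up to the mean.\<close>

lemma powr_nn_integral_unit_interval_le:
  fixes l :: "real \<Rightarrow> real"
  assumes [measurable]: "l \<in> borel_measurable borel" and l: "\<And>s. 0 \<le> l s" "\<And>s. l s \<le> L"
    and p: "1 \<le> p" and A: "0 \<le> A" "ennreal A \<le> (\<integral>\<^sup>+s\<in>{0..1}. ennreal (l s) \<partial>lborel)"
  shows "ennreal (A powr p) \<le> (\<integral>\<^sup>+s\<in>{0..1}. ennreal (l s powr p) \<partial>lborel)"
proof (cases "A = 0")
  case False
  then have A0: "0 < A" using A by simp
  let ?I = "\<integral>\<^sup>+s\<in>{0..1}. ennreal (l s powr p) \<partial>lborel"
  have "ennreal (p * A powr p) = ennreal (p * A powr (p - 1)) * ennreal A"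
    using A0 p by (simp add: powr_diff flip: ennreal_mult)
  also have "\<dots> \<le> ennreal (p * A powr (p - 1)) * (\<integral>\<^sup>+s\<in>{0..1}. ennreal (l s) \<partial>lborel)"
    by (intro mult_left_mono A(2)) simp
  also have "\<dots> = (\<integral>\<^sup>+s. ennreal (p * A powr (p - 1)) * (ennreal (l s) * indicator {0..1} s) \<partial>lborel)"
    by (rule nn_integral_cmult[symmetric]) measurable
  also have "\<dots> \<le> (\<integral>\<^sup>+s. ennreal (l s powr p) * indicator {0..1} s + ennreal ((p - 1) * A powr p) * indicator {0..1} s \<partial>lborel)"
  proof (intro nn_integral_mono)
    fix s
    have "ennreal (p * A powr (p - 1)) * ennreal (l s) = ennreal (p * A powr (p - 1) * l s)"
      using p l(1)[of s] by (simp add: ennreal_mult)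
    also have "\<dots> \<le> ennreal (l s powr p + (p - 1) * A powr p)"
      by (intro ennreal_leI tangent_powr_le p l A0)
    also have "\<dots> = ennreal (l s powr p) + ennreal ((p - 1) * A powr p)"
      using p by simp
    finally show "ennreal (p * A powr (p - 1)) * (ennreal (l s) * indicator {0..1} s)
        \<le> ennreal (l s powr p) * indicator {0..1} s + ennreal ((p - 1) * A powr p) * indicator {0..1} s"
      by (auto simp: indicator_def)
  qed
  also have "\<dots> = ?I + (\<integral>\<^sup>+s. ennreal ((p - 1) * A powr p) * indicator {0..1::real} s \<partial>lborel)"
    by (rule nn_integral_add) measurable
  also have "(\<integral>\<^sup>+s. ennreal ((p - 1) * A powr p) * indicator {0..1::real} s \<partial>lborel) = ennreal ((p - 1) * A powr p)"
    by (subst nn_integral_cmult_indicator) auto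
  finally have le: "ennreal (p * A powr p) \<le> ?I + ennreal ((p - 1) * A powr p)" .
  show ?thesis
  \<comment> \<open>The term (p - 1) * A powr p may be cancelled only when the integral is finite;
    otherwise there is nothing to show.\<close>
  proof (cases ?I)
    case (real i)
    then have "p * A powr p \<le> i + (p - 1) * A powr p"
      using le p by (simp flip: ennreal_plus)
    then have "A powr p \<le> i" by (simp add: algebra_simps)
    then show ?thesis unfolding real(2) by (rule ennreal_leI)
  qed simp
qed simp

text \<open>\<open>local_lip\<close> acts as an upper gradient: it bounds the directional
  derivatives, so an increment is at most norm v times its mean along the segment, and Jensen moves
  the power inside.\<close>

lemma segment_local_lip_powr:
  fixes h :: "'a::euclidean_space \<Rightarrow> real"
  assumes lip: "L-lipschitz_on UNIV h" and p: "1 \<le> p"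
  shows "ennreal (\<bar>h (x + v) - h x\<bar> powr p) \<le>
     ennreal (norm v powr p) * (\<integral>\<^sup>+s\<in>{0..1}. ennreal (local_lip h (x + s *\<^sub>R v) powr p) \<partial>lborel)"
proof (cases "v = 0")
  case False
  then have v: "0 < norm v" by simp
  let ?I = "(\<integral>\<^sup>+s\<in>{0..1}. ennreal (local_lip h (x + s *\<^sub>R v)) \<partial>lborel)"
  let ?Ip = "(\<integral>\<^sup>+s\<in>{0..1}. ennreal (local_lip h (x + s *\<^sub>R v) powr p) \<partial>lborel)"
  have [measurable]: "local_lip h \<in> borel_measurable borel" by (rule borel_measurable_local_lip[OF lip])
  have "ennreal \<bar>h (x + v) - h x\<bar> \<le> (\<integral>\<^sup>+s\<in>{0..1}. ennreal \<bar>dini h v (x + s *\<^sub>R v)\<bar> \<partial>lborel)"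
    using segment_dini[OF lip, of 1 x v 0] by simp
  also have "\<dots> \<le> (\<integral>\<^sup>+s. ennreal (norm v) * (ennreal (local_lip h (x + s *\<^sub>R v)) * indicator {0..1} s) \<partial>lborel)"
  proof (intro nn_integral_mono)
    fix s
    have "ennreal \<bar>dini h v (x + s *\<^sub>R v)\<bar> \<le> ennreal (norm v * local_lip h (x + s *\<^sub>R v))"
      using abs_dini_le_local_lip[OF lip, of v "x + s *\<^sub>R v"] by (intro ennreal_leI) (simp add: mult.commute)
    also have "\<dots> = ennreal (norm v) * ennreal (local_lip h (x + s *\<^sub>R v))"
      by (rule ennreal_mult) (simp_all add: local_lip_nonneg[OF lip])
    finally show "ennreal \<bar>dini h v (x + s *\<^sub>R v)\<bar> * indicator {0..1} s \<le> ennreal (norm v) * (ennreal (local_lip h (x + s *\<^sub>R v)) * indicator {0..1} s)"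
      by (auto simp: indicator_def)
  qed
  also have "\<dots> = ennreal (norm v) * ?I"
    by (rule nn_integral_cmult) measurable
  finally have le: "ennreal \<bar>h (x + v) - h x\<bar> \<le> ennreal (norm v) * ?I" .
  define A where "A = \<bar>h (x + v) - h x\<bar> / norm v"
  have A: "0 \<le> A" "\<bar>h (x + v) - h x\<bar> = norm v * A" using v by (auto simp: A_def)
  have "ennreal A = ennreal (1 / norm v) * ennreal \<bar>h (x + v) - h x\<bar>"
    using v by (simp add: A_def flip: ennreal_mult)
  also have "\<dots> \<le> ennreal (1 / norm v) * (ennreal (norm v) * ?I)"
    by (intro mult_left_mono le) simp
  also have "\<dots> = ?I"
    using v by (simp add: mult.assoc[symmetric] flip: ennreal_mult)
  finally have "ennreal (A powr p) \<le> ?Ip"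
    by (intro powr_nn_integral_unit_interval_le[where L = L] local_lip_nonneg[OF lip] local_lip_le_const[OF lip] p A) measurable
  then have "ennreal (norm v powr p) * ennreal (A powr p) \<le> ennreal (norm v powr p) * ?Ip"
    by (rule mult_left_mono) simp
  also have "ennreal (norm v powr p) * ennreal (A powr p) = ennreal (\<bar>h (x + v) - h x\<bar> powr p)"
    using A(1) v unfolding A(2) by (simp add: powr_mult flip: ennreal_mult)
  finally show ?thesis .
qed simp

lemma nn_integral_ball_scale:
  fixes G :: "'a::euclidean_space \<Rightarrow> ennreal"
  assumes [measurable]: "G \<in> borel_measurable borel" and s: "0 < s"
  shows "ennreal (s ^ DIM('a)) * (\<integral>\<^sup>+z\<in>ball 0 r. G (x + s *\<^sub>R z) \<partial>lborel) = (\<integral>\<^sup>+y\<in>ball x (s * r). G y \<partial>lborel)"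
proof -
  have "(\<integral>\<^sup>+y\<in>ball x (s * r). G y \<partial>lborel) =
    (\<integral>\<^sup>+y\<in>ball x (s * r). G y \<partial>density (distr lborel borel (\<lambda>z. x + s *\<^sub>R z)) (\<lambda>_. \<bar>s\<bar>^DIM('a)))"
    using s by (subst lborel_affine[of s x, symmetric]) auto
  also have "\<dots> = (\<integral>\<^sup>+z. ennreal (s ^ DIM('a)) * (G (x + s *\<^sub>R z) * indicator (ball x (s * r)) (x + s *\<^sub>R z)) \<partial>lborel)"
  proof -
    have "(\<integral>\<^sup>+y\<in>ball x (s * r). G y \<partial>density (distr lborel borel (\<lambda>z. x + s *\<^sub>R z)) (\<lambda>_. \<bar>s\<bar>^DIM('a)))
      = (\<integral>\<^sup>+y. ennreal (s ^ DIM('a)) * (G y * indicator (ball x (s * r)) y) \<partial>distr lborel borel (\<lambda>z. x + s *\<^sub>R z))"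
      using s by (subst nn_integral_density) auto
    also have "\<dots> = (\<integral>\<^sup>+z. ennreal (s ^ DIM('a)) * (G (x + s *\<^sub>R z) * indicator (ball x (s * r)) (x + s *\<^sub>R z)) \<partial>lborel)"
      by (rule nn_integral_distr) measurable
    finally show ?thesis .
  qed
  also have "\<dots> = ennreal (s ^ DIM('a)) * (\<integral>\<^sup>+z. G (x + s *\<^sub>R z) * indicator (ball x (s * r)) (x + s *\<^sub>R z) \<partial>lborel)"
    by (rule nn_integral_cmult) measurable
  also have "(\<integral>\<^sup>+z. G (x + s *\<^sub>R z) * indicator (ball x (s * r)) (x + s *\<^sub>R z) \<partial>lborel) = (\<integral>\<^sup>+z\<in>ball 0 r. G (x + s *\<^sub>R z) \<partial>lborel)"
    using s by (intro nn_integral_cong) (auto simp: indicator_def dist_norm)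
  finally show ?thesis ..
qed

text \<open>After integrating the segment bound over the ball and exchanging the integrals, the
  slice at parameter s is a rescaled integral over \<open>ball x (s * r)\<close>, still centred at
  x, so the maximal function controls every slice. Comparing with the value at x itself avoids a
  chain of balls.\<close>

lemma ball_average_powr_le:
  fixes h :: "'a::euclidean_space \<Rightarrow> real"
  assumes lip: "L-lipschitz_on UNIV h" and p: "1 \<le> p" and r: "0 < r"
    and x: "x \<notin> maxset (\<lambda>y. ennreal (local_lip h y powr p)) t"
  shows "(\<integral>\<^sup>+y\<in>ball x r. ennreal (\<bar>h y - h x\<bar> powr p) \<partial>lborel) \<le> ennreal (r powr p) * (ennreal t * emeasure lborel (ball x r))"
proof -
  have [measurable]: "local_lip h \<in> borel_measurable borel" by (rule borel_measurable_local_lip[OF lip])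
  have [measurable]: "h \<in> borel_measurable borel" by (rule lipschitz_on_borel_measurable[OF lip])
  define G where "G y = ennreal (local_lip h y powr p)" for y
  have [measurable]: "G \<in> borel_measurable borel" unfolding G_def by measurable
  let ?J = "\<lambda>z. (\<integral>\<^sup>+s. G (x + s *\<^sub>R z) * indicator {0..1} s * indicator (ball 0 r) z \<partial>lborel)"
  have "(\<integral>\<^sup>+y\<in>ball x r. ennreal (\<bar>h y - h x\<bar> powr p) \<partial>lborel) = (\<integral>\<^sup>+z\<in>ball 0 r. ennreal (\<bar>h (x + z) - h x\<bar> powr p) \<partial>lborel)"
    using nn_integral_ball_scale[of "\<lambda>y. ennreal (\<bar>h y - h x\<bar> powr p)" 1 x r] by simp
  also have "\<dots> \<le> (\<integral>\<^sup>+z. ennreal (r powr p) * ?J z \<partial>lborel)"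
  proof (intro nn_integral_mono)
    fix z :: 'a
    show "ennreal (\<bar>h (x + z) - h x\<bar> powr p) * indicator (ball 0 r) z \<le> ennreal (r powr p) * ?J z"
    proof (cases "norm z < r")
      case True
      have "ennreal (\<bar>h (x + z) - h x\<bar> powr p) \<le> ennreal (norm z powr p) * (\<integral>\<^sup>+s\<in>{0..1}. G (x + s *\<^sub>R z) \<partial>lborel)"
        unfolding G_def by (rule segment_local_lip_powr[OF lip p])
      also have "\<dots> \<le> ennreal (r powr p) * (\<integral>\<^sup>+s\<in>{0..1}. G (x + s *\<^sub>R z) \<partial>lborel)"
        using True p by (intro mult_right_mono ennreal_leI powr_mono2) auto
      finally show ?thesis using True by simp
    qed simp
  qed
  also have "\<dots> = ennreal (r powr p) * (\<integral>\<^sup>+z. ?J z \<partial>lborel)"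
    by (rule nn_integral_cmult) measurable
  also have "(\<integral>\<^sup>+z. ?J z \<partial>lborel)
     = (\<integral>\<^sup>+s. (\<integral>\<^sup>+z. G (x + s *\<^sub>R z) * indicator {0..1} s * indicator (ball 0 r) z \<partial>lborel) \<partial>lborel)"
    by (rule lborel_pair.Fubini') measurable
  also have "\<dots> \<le> (\<integral>\<^sup>+s. ennreal t * emeasure lborel (ball x r) * indicator {0..1::real} s \<partial>lborel)"
  \<comment> \<open>The slice s = 0 is discarded because the rescaling degenerates there.\<close>
  proof (rule nn_integral_mono_AE, rule AE_mp[OF AE_lborel_singleton[of 0]], rule AE_I2, rule impI)
    fix s :: real assume "s \<noteq> 0"
    show "(\<integral>\<^sup>+z. G (x + s *\<^sub>R z) * indicator {0..1} s * indicator (ball 0 r) z \<partial>lborel) \<le> ennreal t * emeasure lborel (ball x r) * indicator {0..1} s"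
    proof (cases "s \<in> {0..1}")
      case True
      then have s: "0 < s" "s \<le> 1" using \<open>s \<noteq> 0\<close> by auto
      define I where "I = (\<integral>\<^sup>+z\<in>ball 0 r. G (x + s *\<^sub>R z) \<partial>lborel)"
      have "ennreal (s ^ DIM('a)) * I = (\<integral>\<^sup>+y\<in>ball x (s * r). G y \<partial>lborel)"
        unfolding I_def by (rule nn_integral_ball_scale) (use s in auto)
      also have "\<dots> \<le> ennreal t * emeasure lborel (ball x (s * r))"
        unfolding G_def by (rule not_in_maxset[OF x]) (use s r in auto)
      also have "\<dots> = ennreal (s ^ DIM('a)) * (ennreal t * emeasure lborel (ball x r))"
        using emeasure_lborel_ball_scale[of s r x x] s r by (simp add: mult.left_commute)
      finally have "ennreal (1 / s ^ DIM('a)) * (ennreal (s ^ DIM('a)) * I) \<le> ennreal (1 / s ^ DIM('a)) * (ennreal (s ^ DIM('a)) * (ennreal t * emeasure lborel (ball x r)))"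
        by (rule mult_left_mono) simp
      then have "I \<le> ennreal t * emeasure lborel (ball x r)"
        using s by (simp add: mult.assoc[symmetric] flip: ennreal_mult)
      then show ?thesis using True by (simp add: I_def)
    qed simp
  qed
  also have "\<dots> = ennreal t * emeasure lborel (ball x r)"
    by (subst nn_integral_cmult_indicator) auto
  finally show ?thesis by (simp add: mult_left_mono)
qed

text \<open>Both w x and w y are compared with w on \<open>ball x r\<close>, which lies in
  \<open>ball y (2 * r)\<close>. The oscillation about x contributes 1, that about y contributes 2
  for the radius times 2^n for the volume.\<close>

lemma lipschitz_pair_maxset:
  fixes w :: "'a::euclidean_space \<Rightarrow> real"
  assumes lip: "L-lipschitz_on UNIV w" and t: "0 \<le> t"
    and x: "x \<notin> maxset (\<lambda>y. ennreal (local_lip w y)) t" and y: "y \<notin> maxset (\<lambda>y. ennreal (local_lip w y)) t"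
  shows "\<bar>w x - w y\<bar> \<le> (1 + 2 ^ (DIM('a) + 1)) * t * dist x y"
proof (cases "x = y")
  case False
  define r where "r = dist x y"
  have r: "0 < r" using False by (simp add: r_def)
  have [measurable]: "w \<in> borel_measurable borel" by (rule lipschitz_on_borel_measurable[OF lip])
  have pw: "\<bar>local_lip w z\<bar> = local_lip w z" for z using local_lip_nonneg[OF lip] by simp
  define m where "m = measure lborel (ball x r)"
  have m: "0 < m" unfolding m_def by (rule content_ball_pos[OF r])
  have em: "emeasure lborel (ball x r) = ennreal m" by (simp add: m_def emeasure_lborel_ball_eq)
  have em2: "emeasure lborel (ball y (2 * r)) = ennreal (2 ^ DIM('a) * m)"
    using emeasure_lborel_ball_scale[of 2 r y x] r m by (simp add: em ennreal_mult)
  have "ennreal (\<bar>w x - w y\<bar> * m) = (\<integral>\<^sup>+z\<in>ball x r. ennreal \<bar>w x - w y\<bar> \<partial>lborel)"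
    using m by (subst nn_integral_cmult_indicator) (auto simp: em ennreal_mult)
  also have "\<dots> \<le> (\<integral>\<^sup>+z. ennreal (\<bar>w z - w x\<bar>) * indicator (ball x r) z + ennreal \<bar>w z - w y\<bar> * indicator (ball y (2 * r)) z \<partial>lborel)"
  proof (intro nn_integral_mono)
    fix z
    have "z \<in> ball y (2 * r)" if "z \<in> ball x r"
      using that dist_triangle[of y z x] by (simp add: r_def dist_commute)
    moreover have "ennreal \<bar>w x - w y\<bar> \<le> ennreal \<bar>w z - w x\<bar> + ennreal \<bar>w z - w y\<bar>"
      by (subst ennreal_plus[symmetric]) (auto intro!: ennreal_leI simp del: ennreal_plus)
    ultimately show "ennreal \<bar>w x - w y\<bar> * indicator (ball x r) z \<le> ennreal \<bar>w z - w x\<bar> * indicator (ball x r) z + ennreal \<bar>w z - w y\<bar> * indicator (ball y (2 * r)) z"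
      by (cases "z \<in> ball x r") auto
  qed
  also have "\<dots> = (\<integral>\<^sup>+z\<in>ball x r. ennreal (\<bar>w z - w x\<bar>) \<partial>lborel) + (\<integral>\<^sup>+z\<in>ball y (2 * r). ennreal (\<bar>w z - w y\<bar>) \<partial>lborel)"
    by (rule nn_integral_add) measurable
  also have "\<dots> \<le> ennreal r * (ennreal t * ennreal m) + ennreal (2 * r) * (ennreal t * ennreal (2 ^ DIM('a) * m))"
    using ball_average_powr_le[OF lip, of 1 r x t] ball_average_powr_le[OF lip, of 1 "2 * r" y t] x y r
    unfolding em em2 by (intro add_mono) (auto simp: pw)
  also have "\<dots> = ennreal (((1 + 2 ^ (DIM('a) + 1)) * t * r) * m)"
    using r t m by (simp add: algebra_simps flip: ennreal_mult ennreal_plus)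
  finally have "\<bar>w x - w y\<bar> * m \<le> ((1 + 2 ^ (DIM('a) + 1)) * t * r) * m"
    using r t m by (subst (asm) ennreal_le_iff) auto
  then show ?thesis using m by (simp add: r_def)
qed simp

section \<open>The pointwise Hardy inequality on fat sets\<close>

lemma add_powr_le:
  fixes a b p :: real
  assumes "0 \<le> a" "0 \<le> b" "0 \<le> p"
  shows "(a + b) powr p \<le> 2 powr p * (a powr p + b powr p)"
proof -
  have "(a + b) powr p \<le> (2 * max a b) powr p" using assms by (intro powr_mono2) auto
  also have "\<dots> = 2 powr p * max a b powr p" using assms by (simp add: powr_mult)
  also have "max a b powr p \<le> a powr p + b powr p" by (simp add: max_def)
  finally show ?thesis by simp
qed

section \<open>Pointwise Lipschitz constants under cutting off, truncating and rescaling\<close>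

lemma local_lip_cutoff_mult:
  fixes f \<eta> :: "'a::metric_space \<Rightarrow> real"
  assumes \<eta>: "K-lipschitz_on UNIV \<eta>" "\<And>y. 0 \<le> \<eta> y" "\<And>y. \<eta> y \<le> 1" and f: "Lf-lipschitz_on UNIV f"
  shows "local_lip (\<lambda>y. \<eta> y * f y) y \<le> K * \<bar>f y\<bar> + local_lip f y"
proof (rule local_lip_le_eps)
  show "0 \<le> K * \<bar>f y\<bar> + local_lip f y"
    using lipschitz_on_nonneg[OF \<eta>(1)] local_lip_nonneg[OF f] by simp
  fix e :: real assume "0 < e"
  then obtain r where r: "0 < r" "\<And>y'. dist y' y < r \<Longrightarrow> \<bar>f y' - f y\<bar> \<le> (local_lip f y + e) * dist y' y"
    using local_lip_eps[OF f] by blast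
  show "\<exists>r>0. \<forall>y'. dist y' y < r \<longrightarrow> \<bar>\<eta> y' * f y' - \<eta> y * f y\<bar> \<le> (K * \<bar>f y\<bar> + local_lip f y + e) * dist y' y"
  proof (intro exI[of _ r] conjI r(1) allI impI)
    fix y' assume y': "dist y' y < r"
    have "\<eta> y' * f y' - \<eta> y * f y = \<eta> y' * (f y' - f y) + f y * (\<eta> y' - \<eta> y)" by (simp add: algebra_simps)
    then have "\<bar>\<eta> y' * f y' - \<eta> y * f y\<bar> \<le> \<eta> y' * \<bar>f y' - f y\<bar> + \<bar>f y\<bar> * \<bar>\<eta> y' - \<eta> y\<bar>"
      using abs_triangle_ineq[of "\<eta> y' * (f y' - f y)" "f y * (\<eta> y' - \<eta> y)"] \<eta>(2)[of y'] by (simp add: abs_mult)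
    also have "\<eta> y' * \<bar>f y' - f y\<bar> \<le> 1 * \<bar>f y' - f y\<bar>" using \<eta>(3) by (rule mult_right_mono) simp
    also have "1 * \<bar>f y' - f y\<bar> \<le> (local_lip f y + e) * dist y' y" using r(2)[OF y'] by simp
    also have "\<bar>f y\<bar> * \<bar>\<eta> y' - \<eta> y\<bar> \<le> \<bar>f y\<bar> * (K * dist y' y)"
      using lipschitz_UNIV_absD[OF \<eta>(1)] by (rule mult_left_mono) simp
    finally show "\<bar>\<eta> y' * f y' - \<eta> y * f y\<bar> \<le> (K * \<bar>f y\<bar> + local_lip f y + e) * dist y' y"
      by (simp add: algebra_simps)
  qed
qed

lemma lipschitz_on_cutoff_mult:
  fixes f \<eta> :: "'a::metric_space \<Rightarrow> real"
  assumes \<eta>: "K-lipschitz_on UNIV \<eta>" "\<And>y. 0 \<le> \<eta> y" "\<And>y. \<eta> y \<le> 1" and f: "Lf-lipschitz_on UNIV f" "\<And>y. \<bar>f y\<bar> \<le> 1"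
  shows "(K + Lf)-lipschitz_on UNIV (\<lambda>y. \<eta> y * f y)"
proof (rule lipschitz_onI)
  fix y y' :: 'a
  have "\<eta> y * f y - \<eta> y' * f y' = \<eta> y * (f y - f y') + f y' * (\<eta> y - \<eta> y')" by (simp add: algebra_simps)
  then have "\<bar>\<eta> y * f y - \<eta> y' * f y'\<bar> \<le> \<eta> y * \<bar>f y - f y'\<bar> + \<bar>f y'\<bar> * \<bar>\<eta> y - \<eta> y'\<bar>"
    using abs_triangle_ineq[of "\<eta> y * (f y - f y')" "f y' * (\<eta> y - \<eta> y')"] \<eta>(2)[of y] by (simp add: abs_mult)
  also have "\<dots> \<le> 1 * \<bar>f y - f y'\<bar> + 1 * \<bar>\<eta> y - \<eta> y'\<bar>"
    using \<eta>(3)[of y] f(2)[of y'] by (intro add_mono mult_right_mono) auto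
  also have "\<dots> \<le> Lf * dist y y' + K * dist y y'"
    using lipschitz_UNIV_absD[OF f(1), of y y'] lipschitz_UNIV_absD[OF \<eta>(1), of y y'] by simp
  finally show "dist (\<eta> y * f y) (\<eta> y' * f y') \<le> (K + Lf) * dist y y'"
    by (simp add: dist_real_def algebra_simps)
qed (use lipschitz_on_nonneg[OF \<eta>(1)] lipschitz_on_nonneg[OF f(1)] in simp)

text \<open>Only increments of f are compared with those of h, so that the same rule covers
  rescalings, truncations such as max 0 (1 - h / m), and, with z = 0 and r = 1, scalar
  multiples.\<close>

lemma local_lip_comp_affine_le:
  fixes h :: "'a::real_normed_vector \<Rightarrow> real"
  assumes h: "L-lipschitz_on UNIV h" and C: "0 \<le> C" and r: "0 < r"
    and f: "\<And>y y'. \<bar>f y' - f y\<bar> \<le> C * \<bar>h (z + r *\<^sub>R y') - h (z + r *\<^sub>R y)\<bar>"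
  shows "local_lip f y \<le> C * r * local_lip h (z + r *\<^sub>R y)"
    and "(C * r * L)-lipschitz_on UNIV f"
proof -
  have d: "dist (z + r *\<^sub>R y') (z + r *\<^sub>R y) = r * dist y' y" for y y'
    using r by (simp add: dist_norm flip: scaleR_diff_right)
  show "(C * r * L)-lipschitz_on UNIV f"
  proof (rule lipschitz_onI)
    fix y y'
    have "\<bar>f y - f y'\<bar> \<le> C * (L * (r * dist y y'))"
      using f[of y y'] mult_left_mono[OF lipschitz_UNIV_absD[OF h, of "z + r *\<^sub>R y" "z + r *\<^sub>R y'"] C] unfolding d by linarith
    then show "dist (f y) (f y') \<le> C * r * L * dist y y'" by (simp add: dist_real_def mult_ac)
  qed (use lipschitz_on_nonneg[OF h] C r in simp)
  show "local_lip f y \<le> C * r * local_lip h (z + r *\<^sub>R y)"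
  proof (rule local_lip_le_eps)
    show "0 \<le> C * r * local_lip h (z + r *\<^sub>R y)" using local_lip_nonneg[OF h] C r by simp
    fix e :: real assume e: "0 < e"
    define e' where "e' = e / (C * r + 1)"
    have Cr: "0 < C * r + 1" using C r by (simp add: add_nonneg_pos)
    have e': "0 < e'" "C * r * e' \<le> e" using e Cr C r by (auto simp: e'_def field_simps)
    obtain \<rho> where \<rho>: "0 < \<rho>" "\<And>y'. dist y' (z + r *\<^sub>R y) < \<rho> \<Longrightarrow> \<bar>h y' - h (z + r *\<^sub>R y)\<bar> \<le> (local_lip h (z + r *\<^sub>R y) + e') * dist y' (z + r *\<^sub>R y)"
      using local_lip_eps[OF h e'(1)] by blast
    show "\<exists>\<rho>>0. \<forall>y'. dist y' y < \<rho> \<longrightarrow> \<bar>f y' - f y\<bar> \<le> (C * r * local_lip h (z + r *\<^sub>R y) + e) * dist y' y"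
    proof (intro exI[of _ "\<rho> / r"] conjI allI impI)
      fix y' assume "dist y' y < \<rho> / r"
      then have "r * dist y' y < \<rho>" using r by (simp add: field_simps)
      then have "dist (z + r *\<^sub>R y') (z + r *\<^sub>R y) < \<rho>" unfolding d .
      from \<rho>(2)[OF this] have "\<bar>h (z + r *\<^sub>R y') - h (z + r *\<^sub>R y)\<bar> \<le> (local_lip h (z + r *\<^sub>R y) + e') * (r * dist y' y)"
        unfolding d .
      then have "\<bar>f y' - f y\<bar> \<le> C * ((local_lip h (z + r *\<^sub>R y) + e') * (r * dist y' y))"
        using f[of y' y] C by (meson mult_left_mono order_trans)
      also have "\<dots> = (C * r * local_lip h (z + r *\<^sub>R y) + C * r * e') * dist y' y" by (simp add: algebra_simps)
      also have "\<dots> \<le> (C * r * local_lip h (z + r *\<^sub>R y) + e) * dist y' y"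
        using e'(2) by (intro mult_right_mono) auto
      finally show "\<bar>f y' - f y\<bar> \<le> (C * r * local_lip h (z + r *\<^sub>R y) + e) * dist y' y" .
    qed (use \<rho> r in auto)
  qed
qed

definition cutoff :: "real \<Rightarrow> 'a::real_normed_vector \<Rightarrow> real" where
  "cutoff k y = max 0 (min 1 (2 - k * norm y))"

lemma cutoff_nonneg: "0 \<le> cutoff k y" and cutoff_le_1: "cutoff k y \<le> 1"
  by (auto simp: cutoff_def)

lemma cutoff_eq_1: "k * norm y \<le> 1 \<Longrightarrow> cutoff k y = 1"
  and cutoff_eq_0: "2 \<le> k * norm y \<Longrightarrow> cutoff k y = 0"
  by (auto simp: cutoff_def)

lemma lipschitz_on_cutoff:
  assumes "0 \<le> k"
  shows "k-lipschitz_on UNIV (cutoff k)"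
proof (rule lipschitz_onI)
  fix x y :: 'a
  have "\<bar>cutoff k x - cutoff k y\<bar> \<le> \<bar>k * norm x - k * norm y\<bar>" by (auto simp: cutoff_def max_def min_def)
  also have "\<dots> = k * \<bar>norm x - norm y\<bar>" using assms by (simp add: abs_mult flip: right_diff_distrib)
  also have "\<dots> \<le> k * dist x y" using assms by (simp add: mult_left_mono dist_norm norm_triangle_ineq3)
  finally show "dist (cutoff k x) (cutoff k y) \<le> k * dist x y" by (simp add: dist_real_def)
qed (rule assms)

lemma cap_le_nn_integral_local_lip:
  fixes \<phi> :: "'a::euclidean_space \<Rightarrow> real"
  assumes lip: "L-lipschitz_on UNIV \<phi>" and adm: "\<And>y. 0 \<le> \<phi> y" "\<And>y. y \<in> K \<Longrightarrow> 1 \<le> \<phi> y" "\<And>y. norm y = 1 \<Longrightarrow> \<phi> y = 0"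
    and s: "0 \<le> s"
  shows "cap s K (ball 0 1) \<le> (\<integral>\<^sup>+y\<in>ball 0 1. ennreal (local_lip \<phi> y powr s) \<partial>lborel)"
proof -
  have "cap_admissible K (ball 0 1) \<phi>"
    unfolding cap_admissible_def using adm lipschitz_on_subset[OF lip, of "closure (ball 0 1)"]
    by (auto simp: frontier_ball)
  then have "cap s K (ball 0 1) \<le> (\<integral>\<^sup>+ y. indicator (ball 0 1) y * ennreal (grad_norm \<phi> y powr s) \<partial>lebesgue)"
    unfolding cap_def by (intro INF_lower) simp
  also have "\<dots> = (\<integral>\<^sup>+ y. indicator (ball 0 1) y * ennreal (grad_norm \<phi> y powr s) \<partial>lborel)"
    by (rule nn_integral_completion)
  also have "\<dots> \<le> (\<integral>\<^sup>+y\<in>ball 0 1. ennreal (local_lip \<phi> y powr s) \<partial>lborel)"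
    using grad_norm_le_local_lip[OF lip] grad_norm_nonneg s
    by (intro nn_integral_mono) (auto simp: indicator_def intro!: ennreal_leI powr_mono2)
  finally show ?thesis .
qed

text \<open>With \<open>z\<close> a nearest point of \<open>E\<close> and \<open>r = 2 * infdist x E\<close>, the function \<open>max 0 (1 - h / h x)\<close>, cut off and rescaled to the ball of radius \<open>r\<close> about \<open>z\<close>, competes for the capacity of \<open>E\<close>.\<close>

lemma fat_pointwise_hardy:
  fixes h :: "'a::euclidean_space \<Rightarrow> real"
  assumes fat: "unif_fat p E (E \<inter> cball 0 1) c 2" and p: "1 \<le> p" and c: "0 < c"
    and E: "closed E" "0 \<in> E"
    and h: "L-lipschitz_on UNIV h" "\<And>y. 0 \<le> h y" "\<And>y. y \<in> E \<Longrightarrow> h y = 0"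
    and x: "norm x < 1/4" "0 < h x" and t: "0 \<le> t"
    and xm: "x \<notin> maxset (\<lambda>y. ennreal (local_lip h y powr p)) t"
  shows "c * h x powr p \<le> 4 powr p * (4 powr p + 1) * 2 ^ DIM('a) * measure lborel (ball (0::'a) 1) * t * infdist x E powr p"
proof -
  define m where "m = h x"
  have m: "0 < m" using x by (simp add: m_def)
  obtain z where z: "z \<in> E" "infdist x E = dist x z" using infdist_attains_inf[OF E(1)] E(2) by blast
  define d where "d = infdist x E"
  have "x \<noteq> z" using h(3)[OF z(1)] x(2) by auto
  then have d: "0 < d" "dist x z = d" using z by (auto simp: d_def)
  have d4: "d < 1/4" using infdist_le[OF E(2), of x] x(1) by (simp add: d_def)
  have "norm z \<le> norm x + dist x z" unfolding dist_norm by norm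
  then have zn: "z \<in> E \<inter> cball 0 1" using z(1) d d4 x(1) by auto
  \<comment> \<open>Since d = r / 2, the ball of radius r about z lies in the ball of radius 2 * r
    about x, where the maximal function at x gives control.\<close>
  define r where "r = 2 * d"
  have r: "0 < r" "r < 2" using d d4 by (auto simp: r_def)
  define K where "K = {y \<in> cball (0::'a) (1/2). z + r *\<^sub>R y \<in> E}"
  have capc: "ennreal c \<le> cap p K (ball 0 1)" using fat zn r unfolding unif_fat_def K_def by blast
  define f where "f y = max 0 (1 - h (z + r *\<^sub>R y) / m)" for y
  \<comment> \<open>Bounding f by the oscillation of h about h x, not merely by 1, makes the
    zero-order term created by the cutoff controllable through
    \<open>ball_average_powr_le\<close>.\<close>
  have f: "0 \<le> f y" "f y \<le> 1" "\<bar>f y\<bar> \<le> \<bar>h (z + r *\<^sub>R y) - h x\<bar> / m" for y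
  proof -
    show "0 \<le> f y" "f y \<le> 1" using h(2) m by (auto simp: f_def)
    have "\<bar>f y\<bar> \<le> \<bar>1 - h (z + r *\<^sub>R y) / m\<bar>" by (auto simp: f_def)
    also have "1 - h (z + r *\<^sub>R y) / m = (h x - h (z + r *\<^sub>R y)) / m" using m by (simp add: m_def field_simps)
    finally show "\<bar>f y\<bar> \<le> \<bar>h (z + r *\<^sub>R y) - h x\<bar> / m" using m by (simp add: abs_minus_commute)
  qed
  have fd: "\<bar>f y' - f y\<bar> \<le> (1 / m) * \<bar>h (z + r *\<^sub>R y') - h (z + r *\<^sub>R y)\<bar>" for y y'
  proof -
    have "\<bar>f y' - f y\<bar> \<le> \<bar>h (z + r *\<^sub>R y') / m - h (z + r *\<^sub>R y) / m\<bar>" by (auto simp: f_def max_def)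
    also have "\<dots> = (1 / m) * \<bar>h (z + r *\<^sub>R y') - h (z + r *\<^sub>R y)\<bar>"
      using m by (simp add: abs_divide flip: diff_divide_distrib)
    finally show ?thesis .
  qed
  note flip = local_lip_comp_affine_le[OF h(1) _ r(1) fd]
  have m1: "0 \<le> 1 / m" using m by simp
  \<comment> \<open>\<open>cutoff 2\<close> equals 1 on the closed ball of radius 1/2, which
    contains K, and vanishes on the unit sphere.\<close>
  define \<phi> where "\<phi> y = cutoff 2 y * f y" for y
  have lip\<phi>: "(2 + 1 / m * r * L)-lipschitz_on UNIV \<phi>" unfolding \<phi>_def[abs_def]
    by (rule lipschitz_on_cutoff_mult[OF lipschitz_on_cutoff cutoff_nonneg cutoff_le_1 flip(2)[OF m1]]) (use f in auto)
  have ll: "local_lip \<phi> y \<le> 2 * (\<bar>h (z + r *\<^sub>R y) - h x\<bar> / m) + r / m * local_lip h (z + r *\<^sub>R y)" for y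
  proof -
    have "local_lip \<phi> y \<le> 2 * \<bar>f y\<bar> + local_lip f y" unfolding \<phi>_def[abs_def]
      by (rule local_lip_cutoff_mult[OF lipschitz_on_cutoff cutoff_nonneg cutoff_le_1 flip(2)[OF m1]]) simp
    then show ?thesis using f(3)[of y] flip(1)[OF m1, of y] by simp
  qed
  define G where "G y = ennreal (2 powr p * \<bar>h y - h x\<bar> powr p) + ennreal (r powr p * local_lip h y powr p)" for y
  have [measurable]: "local_lip h \<in> borel_measurable borel" by (rule borel_measurable_local_lip[OF h(1)])
  have [measurable]: "h \<in> borel_measurable borel" by (rule lipschitz_on_borel_measurable[OF h(1)])
  have [measurable]: "G \<in> borel_measurable borel" unfolding G_def by measurable
  let ?I = "(\<integral>\<^sup>+y\<in>ball 0 1. G (z + r *\<^sub>R y) \<partial>lborel)"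
  have "ennreal c \<le> (\<integral>\<^sup>+y\<in>ball 0 1. ennreal (local_lip \<phi> y powr p) \<partial>lborel)"
    using capc
  proof (rule order_trans, intro cap_le_nn_integral_local_lip[OF lip\<phi>])
    show "0 \<le> \<phi> y" for y using f(1)[of y] cutoff_nonneg[of 2 y] by (simp add: \<phi>_def)
    show "1 \<le> \<phi> y" if "y \<in> K" for y
      using that h(3)[of "z + r *\<^sub>R y"] by (simp add: \<phi>_def K_def cutoff_eq_1 f_def)
    show "\<phi> y = 0" if "norm y = 1" for y using that by (simp add: \<phi>_def cutoff_eq_0)
  qed (use p in simp)
  also have "\<dots> \<le> (\<integral>\<^sup>+y. ennreal ((2 / m) powr p) * (G (z + r *\<^sub>R y) * indicator (ball 0 1) y) \<partial>lborel)"
  proof (intro nn_integral_mono)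
    fix y
    let ?H = "\<bar>h (z + r *\<^sub>R y) - h x\<bar>" and ?l = "local_lip h (z + r *\<^sub>R y)"
    have l: "0 \<le> ?l" by (rule local_lip_nonneg[OF h(1)])
    have "local_lip \<phi> y powr p \<le> (2 * (?H / m) + r / m * ?l) powr p"
      using ll local_lip_nonneg[OF lip\<phi>] p by (intro powr_mono2) auto
    also have "\<dots> \<le> 2 powr p * ((2 * (?H / m)) powr p + (r / m * ?l) powr p)"
      using l r m p by (intro add_powr_le) auto
    also have "\<dots> = (2 / m) powr p * (2 powr p * ?H powr p + r powr p * ?l powr p)"
      using l r m by (simp add: powr_mult powr_divide algebra_simps add_divide_distrib)
    finally have "ennreal (local_lip \<phi> y powr p) \<le> ennreal ((2 / m) powr p * (2 powr p * ?H powr p + r powr p * ?l powr p))"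
      by (rule ennreal_leI)
    also have "\<dots> = ennreal ((2 / m) powr p) * G (z + r *\<^sub>R y)"
      by (simp add: G_def ennreal_mult)
    finally show "ennreal (local_lip \<phi> y powr p) * indicator (ball 0 1) y \<le> ennreal ((2 / m) powr p) * (G (z + r *\<^sub>R y) * indicator (ball 0 1) y)"
      by (auto simp: indicator_def)
  qed
  also have "\<dots> = ennreal ((2 / m) powr p) * ?I"
    by (rule nn_integral_cmult) measurable
  finally have c1: "ennreal c \<le> ennreal ((2 / m) powr p) * ?I" .
  define \<omega> where "\<omega> = measure lborel (ball (0::'a) 1)"
  have \<omega>: "0 < \<omega>" unfolding \<omega>_def by (rule content_ball_pos) simp
  let ?b = "r powr p * (4 powr p + 1) * 2 ^ DIM('a) * \<omega> * t"
  have em: "emeasure lborel (ball x (2 * r)) = ennreal ((2 * r) ^ DIM('a) * \<omega>)"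
    using emeasure_lborel_ball_scale[of "2 * r" 1 x 0] r \<omega> by (simp add: \<omega>_def emeasure_lborel_ball_eq ennreal_mult)
  have "ennreal (r ^ DIM('a)) * ?I = (\<integral>\<^sup>+y\<in>ball z (r * 1). G y \<partial>lborel)"
    by (rule nn_integral_ball_scale) (use r in auto)
  also have "\<dots> \<le> (\<integral>\<^sup>+y\<in>ball x (2 * r). G y \<partial>lborel)"
  proof (rule nn_set_integral_set_mono)
    show "ball z (r * 1) \<subseteq> ball x (2 * r)"
    proof
      fix y assume "y \<in> ball z (r * 1)"
      then show "y \<in> ball x (2 * r)" using dist_triangle[of x y z] d r by (simp add: r_def)
    qed
  qed
  also have "\<dots> = (\<integral>\<^sup>+y. ennreal (2 powr p) * (ennreal (\<bar>h y - h x\<bar> powr p) * indicator (ball x (2 * r)) y)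
        + ennreal (r powr p) * (ennreal (local_lip h y powr p) * indicator (ball x (2 * r)) y) \<partial>lborel)"
    unfolding G_def by (intro nn_integral_cong) (auto simp: indicator_def ennreal_mult)
  also have "\<dots> = ennreal (2 powr p) * (\<integral>\<^sup>+y\<in>ball x (2 * r). ennreal (\<bar>h y - h x\<bar> powr p) \<partial>lborel)
        + ennreal (r powr p) * (\<integral>\<^sup>+y\<in>ball x (2 * r). ennreal (local_lip h y powr p) \<partial>lborel)"
    by (subst nn_integral_add, measurable) (simp add: nn_integral_cmult)
  also have "\<dots> \<le> ennreal (2 powr p) * (ennreal ((2 * r) powr p) * (ennreal t * ennreal ((2 * r) ^ DIM('a) * \<omega>)))
       + ennreal (r powr p) * (ennreal t * ennreal ((2 * r) ^ DIM('a) * \<omega>))"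
    using ball_average_powr_le[OF h(1) p _ xm, of "2 * r"] not_in_maxset[OF xm, of "2 * r"] r
    unfolding em by (intro add_mono mult_left_mono) auto
  also have "\<dots> = ennreal (r ^ DIM('a) * ?b)"
  proof -
    have "2 powr p * ((2 * r) powr p) = 4 powr p * r powr p"
      using r by (simp add: powr_mult mult.assoc[symmetric] flip: powr_mult)
    then have "2 powr p * ((2 * r) powr p * (t * ((2 * r) ^ DIM('a) * \<omega>))) + r powr p * (t * ((2 * r) ^ DIM('a) * \<omega>))
       = r ^ DIM('a) * ?b"
      by (simp add: mult.assoc[symmetric] power_mult_distrib) (simp add: algebra_simps)
    then show ?thesis using r t \<omega> by (simp flip: ennreal_mult ennreal_plus)
  qed
  finally have "ennreal (1 / r ^ DIM('a)) * (ennreal (r ^ DIM('a)) * ?I)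
      \<le> ennreal (1 / r ^ DIM('a)) * ennreal (r ^ DIM('a) * ?b)"
    by (rule mult_left_mono) simp
  then have c2: "?I \<le> ennreal ?b"
    using r t \<omega> by (simp add: mult.assoc[symmetric] flip: ennreal_mult)
  have "ennreal c \<le> ennreal ((2 / m) powr p * ?b)"
    using c1 mult_left_mono[OF c2, of "ennreal ((2 / m) powr p)"] t \<omega> by (simp add: ennreal_mult)
  then have "c \<le> (2 / m) powr p * ?b"
    using t \<omega> by (subst (asm) ennreal_le_iff) auto
  also have "(2 / m) powr p = 2 powr p / m powr p" using m by (simp add: powr_divide)
  finally have "c * m powr p \<le> 2 powr p * ?b"
    using m by (simp add: field_simps)
  also have "\<dots> = 4 powr p * (4 powr p + 1) * 2 ^ DIM('a) * \<omega> * t * d powr p"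
  proof -
    have "2 powr p * r powr p = 4 powr p * d powr p" using d by (simp add: r_def flip: powr_mult)
    then show ?thesis by (simp add: mult.assoc[symmetric])
  qed
  finally show ?thesis by (simp add: m_def \<omega>_def d_def)
qed

section \<open>Lipschitz truncation\<close>

text \<open>At a density point x of S, every nearby y has a point y' of S within \<delta> * dist y
  x, since otherwise S would miss too large a ball. The increment of v from x to y' is one of w, and
  the rest costs only the Lipschitz constant of v times a small distance.\<close>

lemma AE_local_lip_le_of_eq_on:
  fixes v w :: "'a::euclidean_space \<Rightarrow> real"
  assumes S: "S \<in> sets borel" and v: "Lv-lipschitz_on UNIV v" and w: "Lw-lipschitz_on UNIV w"
    and eq: "\<And>x. x \<in> S \<Longrightarrow> v x = w x"
  shows "AE x in lborel. x \<in> S \<longrightarrow> local_lip v x \<le> local_lip w x"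
  using AE_density_point[OF S]
proof (rule AE_mp, intro AE_I2 impI)
  fix x
  assume "x \<in> S \<longrightarrow> (\<forall>e>0. \<exists>R>0. \<forall>r. 0 < r \<and> r < R \<longrightarrow>
           emeasure lborel (ball x r - S) \<le> ennreal e * emeasure lborel (ball x r))" and xS: "x \<in> S"
  then have dens: "\<And>e. 0 < e \<Longrightarrow> \<exists>R>0. \<forall>r. 0 < r \<and> r < R \<longrightarrow>
           emeasure lborel (ball x r - S) \<le> ennreal e * emeasure lborel (ball x r)" by blast
  define l where "l = local_lip w x"
  have l: "0 \<le> l" unfolding l_def by (rule local_lip_nonneg[OF w])
  have Lv: "0 \<le> Lv" by (rule lipschitz_on_nonneg[OF v])
  show "local_lip v x \<le> local_lip w x"
    unfolding l_def[symmetric]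
  proof (rule local_lip_le_eps[OF l])
    fix e :: real assume e: "0 < e"
    define \<delta> where "\<delta> = min 1 (e / 2 / (l + e + Lv))"
    have den: "0 < l + e + Lv" using l e Lv by simp
    have \<delta>: "0 < \<delta>" "\<delta> \<le> 1" "\<delta> * (l + e + Lv) \<le> e / 2"
    proof -
      have "\<delta> * (l + e + Lv) \<le> e / 2 / (l + e + Lv) * (l + e + Lv)"
        using den by (intro mult_right_mono) (auto simp: \<delta>_def)
      also have "\<dots> = e / 2" by (rule nonzero_eq_divide_eq[THEN iffD1, OF _ refl]) (use den in simp)
      finally show "\<delta> * (l + e + Lv) \<le> e / 2" .
    qed (use e den in \<open>auto simp: \<delta>_def\<close>)
    \<comment> \<open>A ball of radius \<delta> * \<rho> fills the proportion (\<delta> / 2)^n of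
      one of radius 2 * \<rho>; half of that rules out a hole of this size.\<close>
    define e' where "e' = (\<delta> / 2) ^ DIM('a) / 2"
    have e': "0 < e'" "e' < (\<delta> / 2) ^ DIM('a)" using \<delta> by (auto simp: e'_def)
    obtain R where R: "0 < R" "\<And>r. 0 < r \<Longrightarrow> r < R \<Longrightarrow> emeasure lborel (ball x r - S) \<le> ennreal e' * emeasure lborel (ball x r)"
      using dens[OF e'(1)] by blast
    have e2: "0 < e / 2" using e by simp
    obtain r where r: "0 < r" "\<And>y. dist y x < r \<Longrightarrow> \<bar>w y - w x\<bar> \<le> (l + e / 2) * dist y x"
      using local_lip_eps[OF w e2] unfolding l_def by blast
    show "\<exists>r>0. \<forall>y. dist y x < r \<longrightarrow> \<bar>v y - v x\<bar> \<le> (l + e) * dist y x"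
    proof (intro exI[of _ "min (R / 2) (r / 2)"] conjI allI impI)
      fix y assume y: "dist y x < min (R / 2) (r / 2)"
      define \<rho> where "\<rho> = dist y x"
      show "\<bar>v y - v x\<bar> \<le> (l + e) * dist y x"
      proof (cases "y = x")
        case False
        then have \<rho>: "0 < \<rho>" by (simp add: \<rho>_def)
        have "\<exists>y'\<in>S. dist y y' < \<delta> * \<rho>"
        proof (rule ccontr)
          assume no: "\<not> (\<exists>y'\<in>S. dist y y' < \<delta> * \<rho>)"
          have "\<delta> * \<rho> \<le> \<rho>" using \<delta> \<rho> by (simp add: mult_left_le_one_le)
          have sub: "ball y (\<delta> * \<rho>) \<subseteq> ball x (2 * \<rho>) - S"
          proof
            fix y' assume y': "y' \<in> ball y (\<delta> * \<rho>)"
            then have "dist x y' < 2 * \<rho>"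
              using dist_triangle[of x y' y] \<open>\<delta> * \<rho> \<le> \<rho>\<close> by (simp add: \<rho>_def dist_commute)
            then show "y' \<in> ball x (2 * \<rho>) - S" using no y' by auto
          qed
          have em: "emeasure lborel (ball y (\<delta> * \<rho>)) = ennreal ((\<delta> / 2) ^ DIM('a)) * emeasure lborel (ball x (2 * \<rho>))"
            using emeasure_lborel_ball_scale[of "\<delta> / 2" "2 * \<rho>" y x] \<delta> \<rho> by simp
          have "emeasure lborel (ball y (\<delta> * \<rho>)) \<le> emeasure lborel (ball x (2 * \<rho>) - S)"
            using sub S by (intro emeasure_mono) auto
          also have "\<dots> \<le> ennreal e' * emeasure lborel (ball x (2 * \<rho>))"
            using R(2)[of "2 * \<rho>"] \<rho> y by (simp add: \<rho>_def)
          finally have "ennreal ((\<delta> / 2) ^ DIM('a) * measure lborel (ball x (2 * \<rho>))) \<le> ennreal (e' * measure lborel (ball x (2 * \<rho>)))"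
            unfolding em using e' \<delta> by (simp add: emeasure_lborel_ball_eq ennreal_mult)
          moreover have m: "0 < measure lborel (ball x (2 * \<rho>))" by (rule content_ball_pos) (use \<rho> in simp)
          ultimately show False using e' by (subst (asm) ennreal_le_iff) auto
        qed
        then obtain y' where y': "y' \<in> S" "dist y y' < \<delta> * \<rho>" by blast
        have dy': "dist y' x \<le> (1 + \<delta>) * \<rho>"
          using dist_triangle[of y' x y] y'(2) by (simp add: \<rho>_def dist_commute algebra_simps)
        also have "\<dots> \<le> 2 * \<rho>" using \<delta> \<rho> by (intro mult_right_mono) auto
        finally have "dist y' x < r" using y by (simp add: \<rho>_def)
        from r(2)[OF this] have "\<bar>w y' - w x\<bar> \<le> (l + e / 2) * dist y' x" .
        also have "\<dots> \<le> (l + e / 2) * ((1 + \<delta>) * \<rho>)" using dy' l e by (intro mult_left_mono) auto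
        finally have 1: "\<bar>v y' - v x\<bar> \<le> (l + e / 2) * ((1 + \<delta>) * \<rho>)" using eq y' xS by simp
        have "\<bar>v y - v y'\<bar> \<le> Lv * dist y y'" by (rule lipschitz_UNIV_absD[OF v])
        also have "\<dots> \<le> Lv * (\<delta> * \<rho>)" using y' Lv by (intro mult_left_mono) auto
        finally have "\<bar>v y - v x\<bar> \<le> (l + e / 2) * ((1 + \<delta>) * \<rho>) + Lv * (\<delta> * \<rho>)" using 1 by linarith
        also have "\<dots> = (l + e / 2 + \<delta> * (l + e / 2 + Lv)) * \<rho>" by (simp add: algebra_simps)
        also have "\<dots> \<le> (l + e) * \<rho>"
        proof (rule mult_right_mono)
          have "\<delta> * (l + e / 2 + Lv) \<le> \<delta> * (l + e + Lv)" using \<delta> e by (intro mult_left_mono) auto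
          then show "l + e / 2 + \<delta> * (l + e / 2 + Lv) \<le> l + e" using \<delta> by linarith
        qed (use \<rho> in simp)
        finally show ?thesis by (simp add: \<rho>_def)
      qed simp
    qed (use R r in auto)
  qed
qed

text \<open>At a Lebesgue point the value is a limit of averages, each at most t off the superlevel
  set. Keeping the quantifier over t inside gives one null set for all heights.\<close>

lemma AE_le_of_notin_maxset:
  fixes g :: "'a::euclidean_space \<Rightarrow> real"
  assumes [measurable]: "g \<in> borel_measurable borel" and g: "\<And>x. 0 \<le> g x" "\<And>x. g x \<le> B"
  shows "AE x in lborel. \<forall>t\<ge>0. x \<notin> maxset (\<lambda>y. ennreal (g y)) t \<longrightarrow> g x \<le> t"
proof -
  have "\<bar>g x\<bar> \<le> B" for x using g[of x] by simp
  from AE_lebesgue_point[OF assms(1) this] show ?thesis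
  proof (rule AE_mp, intro AE_I2 impI allI)
    fix x and t :: real
    assume lp: "\<forall>e>0. \<exists>R>0. \<forall>r. 0 < r \<and> r < R \<longrightarrow>
           (\<integral>\<^sup>+y\<in>ball x r. ennreal \<bar>g y - g x\<bar> \<partial>lborel) \<le> ennreal e * emeasure lborel (ball x r)"
    assume t: "0 \<le> t" and x: "x \<notin> maxset (\<lambda>y. ennreal (g y)) t"
    show "g x \<le> t"
    proof (rule field_le_epsilon)
      fix e :: real assume e: "0 < e"
      then obtain R where R: "0 < R" "\<And>r. 0 < r \<Longrightarrow> r < R \<Longrightarrow>
           (\<integral>\<^sup>+y\<in>ball x r. ennreal \<bar>g y - g x\<bar> \<partial>lborel) \<le> ennreal e * emeasure lborel (ball x r)"
        using lp by blast
      define r where "r = R / 2"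
      have r: "0 < r" "r < R" using R(1) by (auto simp: r_def)
      define m where "m = measure lborel (ball x r)"
      have m: "0 < m" unfolding m_def by (rule content_ball_pos[OF r(1)])
      have em: "emeasure lborel (ball x r) = ennreal m" by (simp add: m_def emeasure_lborel_ball_eq)
      have "ennreal (g x * m) = (\<integral>\<^sup>+y\<in>ball x r. ennreal (g x) \<partial>lborel)"
        using g m by (subst nn_integral_cmult_indicator) (auto simp: em ennreal_mult)
      also have "\<dots> \<le> (\<integral>\<^sup>+y. ennreal (g y) * indicator (ball x r) y + ennreal \<bar>g y - g x\<bar> * indicator (ball x r) y \<partial>lborel)"
      proof (intro nn_integral_mono)
        fix y
        have "ennreal (g x) \<le> ennreal (g y) + ennreal \<bar>g y - g x\<bar>"
          using g by (subst ennreal_plus[symmetric]) (auto intro!: ennreal_leI simp del: ennreal_plus)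
        then show "ennreal (g x) * indicator (ball x r) y \<le> ennreal (g y) * indicator (ball x r) y + ennreal \<bar>g y - g x\<bar> * indicator (ball x r) y"
          by (auto simp: indicator_def)
      qed
      also have "\<dots> = (\<integral>\<^sup>+y\<in>ball x r. ennreal (g y) \<partial>lborel) + (\<integral>\<^sup>+y\<in>ball x r. ennreal \<bar>g y - g x\<bar> \<partial>lborel)"
        by (rule nn_integral_add) measurable
      also have "\<dots> \<le> ennreal t * ennreal m + ennreal e * ennreal m"
        using not_in_maxset[OF x r(1)] R(2)[OF r] unfolding em by (rule add_mono)
      also have "\<dots> = ennreal ((t + e) * m)"
        using t e m by (simp add: distrib_right flip: ennreal_mult ennreal_plus)
      finally show "g x \<le> t + e" using m t e by (subst (asm) ennreal_le_iff) auto
    qed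
  qed
qed

text \<open>McShane's infimum formula; as an infimum of nonnegative terms it also keeps the
  extension nonnegative.\<close>

lemma mcshane_extension:
  fixes w :: "'a::metric_space \<Rightarrow> real"
  assumes S: "S \<noteq> {}" and K: "0 \<le> K" and w: "\<And>x. x \<in> S \<Longrightarrow> 0 \<le> w x"
    and lip: "\<And>x y. x \<in> S \<Longrightarrow> y \<in> S \<Longrightarrow> w x \<le> w y + K * dist x y"
  obtains v where "K-lipschitz_on UNIV v" "\<And>x. 0 \<le> v x" "\<And>x. x \<in> S \<Longrightarrow> v x = w x"
proof -
  define v where "v x = (INF s\<in>S. w s + K * dist x s)" for x
  have bdd: "bdd_below ((\<lambda>s. w s + K * dist x s) ` S)" for x
    using w K by (intro bdd_belowI[of _ 0]) auto
  have le: "v x \<le> v y + K * dist x y" for x y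
  proof -
    have "v x - K * dist x y \<le> w s + K * dist y s" if "s \<in> S" for s
    proof -
      have "v x \<le> w s + K * dist x s" unfolding v_def by (rule cINF_lower[OF bdd that])
      also have "K * dist x s \<le> K * (dist x y + dist y s)" using K by (intro mult_left_mono dist_triangle) auto
      finally show ?thesis by (simp add: algebra_simps)
    qed
    then have "v x - K * dist x y \<le> v y" unfolding v_def[of y] by (rule cINF_greatest[OF S])
    then show ?thesis by simp
  qed
  show thesis
  proof (rule that[of v])
    show "K-lipschitz_on UNIV v"
    proof (rule lipschitz_onI)
      fix x y
      show "dist (v x) (v y) \<le> K * dist x y"
        using le[of x y] le[of y x] by (simp add: dist_real_def dist_commute abs_le_iff)
    qed (rule K)
    show "0 \<le> v x" for x unfolding v_def using w K by (intro cINF_greatest[OF S]) auto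
    show "v x = w x" if x: "x \<in> S" for x
    proof (rule antisym)
      show "v x \<le> w x" using cINF_lower[OF bdd x, of x] by (simp add: v_def)
      show "w x \<le> v x" unfolding v_def by (rule cINF_greatest[OF S]) (use lip x in auto)
    qed
  qed
qed

lemma maxset_antimono: "t \<le> t' \<Longrightarrow> maxset F t' \<subseteq> maxset F t"
proof
  fix x assume "t \<le> t'" "x \<in> maxset F t'"
  then obtain r where r: "0 < r" "ennreal t' * emeasure lborel (ball x r) < (\<integral>\<^sup>+y\<in>ball x r. F y \<partial>lborel)"
    by (auto simp: maxset_def)
  have "ennreal t * emeasure lborel (ball x r) \<le> ennreal t' * emeasure lborel (ball x r)"
    using \<open>t \<le> t'\<close> by (intro mult_right_mono ennreal_leI) auto
  then show "x \<in> maxset F t" using r by (auto simp: maxset_def intro: order.strict_trans1)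
qed

text \<open>Adding a constant raises every average by that constant. This is how the errors 8 and 8
  powr p caused by the cutoff are traded for a change of height.\<close>

lemma maxset_comparison:
  fixes F G :: "'a::euclidean_space \<Rightarrow> ennreal"
  assumes x: "x \<in> maxset F t" and [measurable]: "G \<in> borel_measurable borel"
    and le: "AE y in lborel. F y \<le> ennreal C * (G y + ennreal e)"
    and t: "C * (t' + e) \<le> t" "0 \<le> C" "0 \<le> t'" "0 \<le> e"
  shows "x \<in> maxset G t'"
proof (rule ccontr)
  assume nx: "x \<notin> maxset G t'"
  obtain r where r: "0 < r" "ennreal t * emeasure lborel (ball x r) < (\<integral>\<^sup>+y\<in>ball x r. F y \<partial>lborel)"
    using x by (auto simp: maxset_def)
  have "(\<integral>\<^sup>+y\<in>ball x r. F y \<partial>lborel) \<le> (\<integral>\<^sup>+y. ennreal C * (G y * indicator (ball x r) y + ennreal e * indicator (ball x r) y) \<partial>lborel)"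
    by (rule nn_integral_mono_AE, rule AE_mp[OF le], rule AE_I2) (auto simp: indicator_def)
  also have "\<dots> = ennreal C * (\<integral>\<^sup>+y. G y * indicator (ball x r) y + ennreal e * indicator (ball x r) y \<partial>lborel)"
    by (rule nn_integral_cmult) measurable
  also have "(\<integral>\<^sup>+y. G y * indicator (ball x r) y + ennreal e * indicator (ball x r) y \<partial>lborel)
      = (\<integral>\<^sup>+y\<in>ball x r. G y \<partial>lborel) + (\<integral>\<^sup>+y\<in>ball x r. ennreal e \<partial>lborel)"
    by (rule nn_integral_add) measurable
  also have "\<dots> \<le> ennreal t' * emeasure lborel (ball x r) + ennreal e * emeasure lborel (ball x r)"
    using not_in_maxset[OF nx r(1)] by (intro add_mono) (auto simp: nn_integral_cmult_indicator)
  also have "\<dots> = ennreal (t' + e) * emeasure lborel (ball x r)"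
    using t by (simp add: distrib_right)
  finally have "(\<integral>\<^sup>+y\<in>ball x r. F y \<partial>lborel) \<le> ennreal C * (ennreal (t' + e) * emeasure lborel (ball x r))"
    by (simp add: mult_left_mono)
  also have "\<dots> = ennreal (C * (t' + e)) * emeasure lborel (ball x r)"
    using t by (simp add: ennreal_mult mult.assoc del: ennreal_plus)
  also have "\<dots> \<le> ennreal t * emeasure lborel (ball x r)"
    using t(1) by (intro mult_right_mono ennreal_leI) auto
  finally show False using r(2) by simp
qed

lemma local_lip_add_le:
  fixes f g :: "'a::metric_space \<Rightarrow> real"
  assumes f: "Lf-lipschitz_on UNIV f" and g: "Lg-lipschitz_on UNIV g"
  shows "local_lip (\<lambda>y. f y + g y) x \<le> local_lip f x + local_lip g x"
proof (rule local_lip_le_eps)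
  show "0 \<le> local_lip f x + local_lip g x" using local_lip_nonneg[OF f] local_lip_nonneg[OF g] by simp
  fix e :: real assume "0 < e"
  then have e: "0 < e / 2" by simp
  obtain r where r: "0 < r" "\<And>y. dist y x < r \<Longrightarrow> \<bar>f y - f x\<bar> \<le> (local_lip f x + e / 2) * dist y x"
    using local_lip_eps[OF f e] by blast
  obtain s where s: "0 < s" "\<And>y. dist y x < s \<Longrightarrow> \<bar>g y - g x\<bar> \<le> (local_lip g x + e / 2) * dist y x"
    using local_lip_eps[OF g e] by blast
  show "\<exists>r>0. \<forall>y. dist y x < r \<longrightarrow> \<bar>f y + g y - (f x + g x)\<bar> \<le> (local_lip f x + local_lip g x + e) * dist y x"
  proof (intro exI[of _ "min r s"] conjI allI impI)
    fix y assume "dist y x < min r s"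
    then have "\<bar>f y - f x\<bar> \<le> (local_lip f x + e / 2) * dist y x" "\<bar>g y - g x\<bar> \<le> (local_lip g x + e / 2) * dist y x"
      using r(2) s(2) by auto
    then show "\<bar>f y + g y - (f x + g x)\<bar> \<le> (local_lip f x + local_lip g x + e) * dist y x"
      by (simp add: algebra_simps)
  qed (use r s in auto)
qed

lemma local_lip_sum_le:
  fixes f :: "'i \<Rightarrow> 'a::metric_space \<Rightarrow> real"
  assumes "finite I" and f: "\<And>i. i \<in> I \<Longrightarrow> (K i)-lipschitz_on UNIV (f i)"
  shows "(\<Sum>i\<in>I. K i)-lipschitz_on UNIV (\<lambda>y. \<Sum>i\<in>I. f i y) \<and> local_lip (\<lambda>y. \<Sum>i\<in>I. f i y) x \<le> (\<Sum>i\<in>I. local_lip (f i) x)"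
  using assms
proof (induction I rule: finite_induct)
  case empty
  have "0-lipschitz_on UNIV (\<lambda>y::'a. 0 :: real)" by (rule lipschitz_on_constant)
  then show ?case using local_lip_le_const[of 0 "\<lambda>y::'a. 0" x] by simp
next
  case (insert i I)
  then have IH: "(\<Sum>i\<in>I. K i)-lipschitz_on UNIV (\<lambda>y. \<Sum>i\<in>I. f i y)" "local_lip (\<lambda>y. \<Sum>i\<in>I. f i y) x \<le> (\<Sum>i\<in>I. local_lip (f i) x)"
    and i: "(K i)-lipschitz_on UNIV (f i)" by auto
  show ?case using insert.hyps lipschitz_on_add[OF i IH(1)] local_lip_add_le[OF i IH(1), of x] IH(2) by simp
qed

section \<open>Averaged truncations and level sets\<close>

text \<open>A sum of distinct powers of 4 is at most twice its largest term, so the constant does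
  not depend on the number of terms; convexity would instead lose the power of k that averaging
  gains.\<close>

lemma sum_powers_four_powr_le:
  fixes p :: real
  assumes T: "finite T" and p: "0 \<le> p"
  shows "(\<Sum>i\<in>T. (4::real) ^ i) powr p \<le> 2 powr p * (\<Sum>i\<in>T. (4 ^ i) powr p)"
proof (cases "T = {}")
  case False
  define m where "m = Max T"
  have m: "m \<in> T" using T False by (simp add: m_def)
  have "(\<Sum>i\<in>T. (4::real) ^ i) \<le> (\<Sum>i\<le>m. 4 ^ i)"
    using T by (intro sum_mono2) (auto simp: m_def)
  also have "\<dots> \<le> 2 * 4 ^ m"
  proof (induction m)
    case (Suc m)
    have "(0::real) \<le> 4 ^ m" by simp
    with Suc show ?case unfolding sum.atMost_Suc power_Suc by linarith
  qed simp
  finally have "(\<Sum>i\<in>T. (4::real) ^ i) powr p \<le> (2 * 4 ^ m) powr p"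
    using p by (intro powr_mono2) (auto intro: sum_nonneg)
  also have "\<dots> = 2 powr p * (4 ^ m) powr p" by (simp add: powr_mult)
  also have "\<dots> \<le> 2 powr p * (\<Sum>i\<in>T. (4 ^ i) powr p)"
    using T m by (intro mult_left_mono member_le_sum) auto
  finally show ?thesis .
qed simp

text \<open>The factor of \<open>lipschitz_pair_maxset\<close>, doubled because the height there is
  \<tau> + 8 \<le> 2 * \<tau>.\<close>

definition trunc_const :: "nat \<Rightarrow> real" where
  "trunc_const n = 2 * (1 + 2 ^ (n + 1))"

lemma trunc_const_ge_1: "1 \<le> trunc_const n"
  by (simp add: trunc_const_def)

text \<open>The factor in \<open>fat_pointwise_hardy\<close>; the type argument supplies the
  dimension and the unit ball.\<close>

definition hardy_const :: "real \<Rightarrow> 'a::euclidean_space itself \<Rightarrow> real" where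
  "hardy_const p _ = 4 powr p * (4 powr p + 1) * 2 ^ DIM('a) * measure lborel (ball (0::'a) 1)"

lemma hardy_const_pos: "0 < hardy_const p TYPE('a::euclidean_space)"
  using content_ball_pos[of 1 "0::'a"] by (simp add: hardy_const_def add_nonneg_pos)

text \<open>In the application \<open>w = cutoff 8 * max 0 (1 - u)\<close> for a competitor \<open>u\<close> of the capacity, and \<open>g\<close> is the pointwise Lipschitz constant of \<open>u\<close>.\<close>

locale truncation =
  fixes E :: "'a::euclidean_space set" and w g :: "'a \<Rightarrow> real" and L B p c :: real
  assumes p: "1 < p" and c: "0 < c"
    and fat: "unif_fat p E (E \<inter> cball 0 1) c 2"
    and closed_E: "closed E" and zero_E: "0 \<in> E"
    and lip_w: "L-lipschitz_on UNIV w" and w_nonneg: "0 \<le> w y"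
    and w_E: "y \<in> E \<Longrightarrow> w y = 0" and w_far: "1/4 \<le> norm y \<Longrightarrow> w y = 0"
    and g_borel[measurable]: "g \<in> borel_measurable borel"
    and g_nonneg: "0 \<le> g y" and g_le: "g y \<le> B" and w_g: "local_lip w y \<le> g y + 8"
begin

definition steep :: "real \<Rightarrow> 'a set" where
  "steep \<tau> = {x. \<tau> * infdist x E < w x}"

definition gmax :: "real \<Rightarrow> 'a set" where
  "gmax \<tau> = maxset (\<lambda>y. ennreal (g y)) \<tau>"

text \<open>The points where w cannot be kept when it is made Lipschitz at scale \<tau>: leaving out
  \<open>steep\<close> controls w against its zero values on E, leaving out \<open>gmax\<close>
  controls pairs of points.\<close>

definition bad :: "real \<Rightarrow> 'a set" where
  "bad \<tau> = steep \<tau> \<union> gmax \<tau>"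

lemma open_steep: "open (steep \<tau>)"
  unfolding steep_def
  by (intro open_Collect_less continuous_intros lipschitz_on_continuous_on[OF lip_w])

lemma open_gmax: "open (gmax \<tau>)"
  unfolding gmax_def by (rule open_maxset) measurable

lemma steep_borel[measurable]: "steep \<tau> \<in> sets borel"
  and gmax_borel[measurable]: "gmax \<tau> \<in> sets borel"
  and bad_borel[measurable]: "bad \<tau> \<in> sets borel"
  using open_steep open_gmax by (auto simp: bad_def)

lemma bad_antimono: "\<tau> \<le> \<tau>' \<Longrightarrow> bad \<tau>' \<subseteq> bad \<tau>"
proof
  fix x assume le: "\<tau> \<le> \<tau>'" and x: "x \<in> bad \<tau>'"
  have "\<tau> * infdist x E \<le> \<tau>' * infdist x E" using le by (intro mult_right_mono infdist_nonneg)
  then show "x \<in> bad \<tau>"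
    using x maxset_antimono[OF le, of "\<lambda>y. ennreal (g y)"] by (auto simp: bad_def steep_def gmax_def)
qed

text \<open>McShane extension of w from E and the complement of \<open>bad \<tau>\<close>. A pair
  with one point in E is handled by \<open>steep\<close>, a pair off \<open>bad \<tau>\<close> by
  the maximal function. Including E in the domain preserves the zero values that the Hardy
  inequality needs.\<close>

lemma truncation_exists:
  assumes \<tau>: "8 \<le> \<tau>"
  obtains v where "(trunc_const DIM('a) * \<tau>)-lipschitz_on UNIV v" "\<And>x. 0 \<le> v x" "\<And>x. x \<in> E \<Longrightarrow> v x = 0"
    "\<And>x. x \<notin> bad \<tau> \<Longrightarrow> v x = w x"
    "AE x in lborel. x \<notin> bad \<tau> \<longrightarrow> local_lip v x \<le> local_lip w x"
proof -
  let ?K = "trunc_const DIM('a) * \<tau>"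
  have K: "0 \<le> ?K" "\<tau> \<le> ?K" using trunc_const_ge_1[of "DIM('a)"] \<tau> by (auto simp: mult_le_cancel_right1)
  define S where "S = E \<union> - bad \<tau>"
  \<comment> \<open>\<open>gmax\<close> is built from g, not from the slope of w; the two differ by
    the 8 that the cutoff contributes.\<close>
  have gw: "x \<notin> maxset (\<lambda>y. ennreal (local_lip w y)) (\<tau> + 8)" if "x \<notin> gmax \<tau>" for x
  proof
    assume "x \<in> maxset (\<lambda>y. ennreal (local_lip w y)) (\<tau> + 8)"
    then have "x \<in> maxset (\<lambda>y. ennreal (g y)) \<tau>"
    proof (rule maxset_comparison[where C = 1 and e = 8])
      show "AE y in lborel. ennreal (local_lip w y) \<le> ennreal 1 * (ennreal (g y) + ennreal 8)"
        using w_g g_nonneg by (auto intro!: AE_I2 ennreal_leI simp flip: ennreal_plus simp del: ennreal_numeral)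
    qed (use \<tau> in auto)
    then show False using that by (simp add: gmax_def)
  qed
  have pair: "w x \<le> w y + ?K * dist x y" if "x \<in> S" "y \<in> S" for x y
  proof (cases "x \<in> E")
    case True
    then show ?thesis using w_E[of x] w_nonneg[of y] K by simp
  next
    case False
    then have x: "x \<notin> bad \<tau>" using that by (simp add: S_def)
    show ?thesis
    proof (cases "y \<in> E")
      case True
      have "w x \<le> \<tau> * infdist x E" using x by (simp add: bad_def steep_def)
      also have "\<dots> \<le> ?K * dist x y" using K \<tau> infdist_le[OF True, of x] infdist_nonneg by (intro mult_mono) auto
      finally show ?thesis using w_nonneg[of y] by simp
    next
      case False
      then have y: "y \<notin> bad \<tau>" using that by (simp add: S_def)
      have "\<bar>w x - w y\<bar> \<le> (1 + 2 ^ (DIM('a) + 1)) * (\<tau> + 8) * dist x y"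
        by (rule lipschitz_pair_maxset[OF lip_w]) (use x y \<tau> gw in \<open>auto simp: bad_def\<close>)
      also have "\<dots> \<le> (1 + 2 ^ (DIM('a) + 1)) * (2 * \<tau>) * dist x y"
        using \<tau> by (intro mult_right_mono mult_left_mono) auto
      also have "\<dots> = ?K * dist x y" by (simp add: trunc_const_def)
      finally show ?thesis by linarith
    qed
  qed
  obtain v where v: "?K-lipschitz_on UNIV v" "\<And>x. 0 \<le> v x" "\<And>x. x \<in> S \<Longrightarrow> v x = w x"
    using mcshane_extension[of S ?K w] pair K(1) w_nonneg zero_E by (auto simp: S_def)
  show thesis
  proof (rule that[OF v(1,2)])
    show "v x = 0" if "x \<in> E" for x using that v(3)[of x] w_E by (simp add: S_def)
    show eq: "v x = w x" if "x \<notin> bad \<tau>" for x using that v(3)[of x] by (simp add: S_def)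
    have "AE x in lborel. x \<in> - bad \<tau> \<longrightarrow> local_lip v x \<le> local_lip w x"
      by (rule AE_local_lip_le_of_eq_on[OF _ v(1) lip_w]) (use eq in auto)
    then show "AE x in lborel. x \<notin> bad \<tau> \<longrightarrow> local_lip v x \<le> local_lip w x" by simp
  qed
qed

text \<open>Averaging over \<open>k\<close> heights: the bad heights at a point contribute a geometric sum, dominated by its largest term, and this sum carries the factor \<open>1 / k\<close>.\<close>

lemma averaged_truncation:
  assumes \<tau>: "8 \<le> \<tau>" and k: "1 \<le> k"
  obtains h K where "K-lipschitz_on UNIV h" "\<And>x. 0 \<le> h x" "\<And>x. x \<in> E \<Longrightarrow> h x = 0"
    "\<And>x. x \<notin> bad (4 * \<tau>) \<Longrightarrow> h x = w x"
    "AE x in lborel. local_lip h x powr p \<le> 4 powr p * ((g x powr p * indicator {x. g x \<le> 4 ^ k * \<tau>} x +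
       (2 * trunc_const DIM('a) / real k * \<tau>) powr p * (\<Sum>i=1..k. (4 ^ i) powr p * indicator (bad (4 ^ i * \<tau>)) x)) + 8 powr p)"
proof -
  let ?K = "trunc_const DIM('a)"
  have K: "1 \<le> ?K" by (rule trunc_const_ge_1)
  have l8: "8 \<le> 4 ^ i * \<tau>" for i
    using \<tau> mult_mono[of 1 "4 ^ i" 8 \<tau>] by simp
  have "\<exists>v. \<forall>i. (?K * (4 ^ i * \<tau>))-lipschitz_on UNIV (v i) \<and> (\<forall>x. 0 \<le> v i x) \<and> (\<forall>x\<in>E. v i x = 0) \<and>
    (\<forall>x. x \<notin> bad (4 ^ i * \<tau>) \<longrightarrow> v i x = w x) \<and>
    (AE x in lborel. x \<notin> bad (4 ^ i * \<tau>) \<longrightarrow> local_lip (v i) x \<le> local_lip w x)"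
    by (rule choice, rule allI, rule truncation_exists[OF l8]) blast
  then obtain v where v: "\<And>i. (?K * (4 ^ i * \<tau>))-lipschitz_on UNIV (v i)" "\<And>i x. 0 \<le> v i x" "\<And>i x. x \<in> E \<Longrightarrow> v i x = 0"
    "\<And>i x. x \<notin> bad (4 ^ i * \<tau>) \<Longrightarrow> v i x = w x"
    "\<And>i. AE x in lborel. x \<notin> bad (4 ^ i * \<tau>) \<longrightarrow> local_lip (v i) x \<le> local_lip w x"
    by blast
  define s where "s x = (\<Sum>i=1..k. v i x)" for x
  define h where "h x = (1 / real k) * s x" for x
  have s: "(\<Sum>i=1..k. ?K * (4 ^ i * \<tau>))-lipschitz_on UNIV s" "local_lip s x \<le> (\<Sum>i=1..k. local_lip (v i) x)" for x
    using local_lip_sum_le[of "{1..k}" "\<lambda>i. ?K * (4 ^ i * \<tau>)" v x] v(1) unfolding s_def[abs_def] by auto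
  have hs: "\<bar>h y' - h y\<bar> \<le> (1 / real k) * \<bar>s (0 + 1 *\<^sub>R y') - s (0 + 1 *\<^sub>R y)\<bar>" for y y'
    by (simp add: h_def abs_mult flip: diff_divide_distrib)
  note hl = local_lip_comp_affine_le[OF s(1) _ zero_less_one hs]
  have inter: "x \<notin> bad (4 * \<tau>) \<Longrightarrow> 1 \<le> i \<Longrightarrow> x \<notin> bad (4 ^ i * \<tau>)" for x i
  proof -
    assume x: "x \<notin> bad (4 * \<tau>)" and i: "1 \<le> i"
    have "(4::real) ^ 1 \<le> 4 ^ i" using i by (intro power_increasing) auto
    then have "4 * \<tau> \<le> 4 ^ i * \<tau>" using \<tau> by (intro mult_right_mono) auto
    then show "x \<notin> bad (4 ^ i * \<tau>)" using bad_antimono x by blast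
  qed
  show thesis
  proof (rule that[of "1 / real k * 1 * (\<Sum>i=1..k. ?K * (4 ^ i * \<tau>))" h])
    show "(1 / real k * 1 * (\<Sum>i=1..k. ?K * (4 ^ i * \<tau>)))-lipschitz_on UNIV h"
      by (rule hl(2)) simp
    show "0 \<le> h x" for x unfolding h_def s_def using v(2) by (simp add: sum_nonneg)
    show "h x = 0" if "x \<in> E" for x unfolding h_def s_def using v(3) that by simp
    show "h x = w x" if "x \<notin> bad (4 * \<tau>)" for x
    proof -
      have "s x = (\<Sum>i=1..k. w x)" unfolding s_def using inter[OF that] v(4) by (intro sum.cong) auto
      then show ?thesis using k by (simp add: h_def)
    qed
    have AE1: "AE x in lborel. \<forall>i. x \<notin> bad (4 ^ i * \<tau>) \<longrightarrow> local_lip (v i) x \<le> local_lip w x"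
      unfolding AE_all_countable using v(5) by blast
    have AE2: "AE x in lborel. \<forall>t\<ge>0. x \<notin> gmax t \<longrightarrow> g x \<le> t"
      unfolding gmax_def by (rule AE_le_of_notin_maxset[OF g_borel g_nonneg g_le])
    show "AE x in lborel. local_lip h x powr p \<le> 4 powr p * ((g x powr p * indicator {x. g x \<le> 4 ^ k * \<tau>} x +
       (2 * ?K / real k * \<tau>) powr p * (\<Sum>i=1..k. (4 ^ i) powr p * indicator (bad (4 ^ i * \<tau>)) x)) + 8 powr p)"
      using AE1 AE2
    proof eventually_elim
      case (elim x)
      define T where "T = {i\<in>{1..k}. x \<in> bad (4 ^ i * \<tau>)}"
      define b where "b = ?K / real k * \<tau> * (\<Sum>i\<in>T. 4 ^ i)"
      define a where "a = g x * indicator {x. g x \<le> 4 ^ k * \<tau>} x"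
      have T: "finite T" "T \<subseteq> {1..k}" by (auto simp: T_def)
      have b0: "0 \<le> b" unfolding b_def 
        by (intro mult_nonneg_nonneg sum_nonneg divide_nonneg_nonneg) (use K \<tau> in auto)
      have a0: "0 \<le> a" using g_nonneg by (simp add: a_def)
      \<comment> \<open>One good height already forces g x \<le> 4 ^ k * \<tau>, so the truncated
        value a is g x itself. If no height is good, nothing is claimed; hence the energy may be
        truncated.\<close>
      have good: "local_lip (v i) x \<le> a + 8" if i: "i \<in> {1..k} - T" for i
      proof -
        have nb: "x \<notin> bad (4 ^ i * \<tau>)" using i by (auto simp: T_def)
        then have "g x \<le> 4 ^ i * \<tau>" using elim(2) l8[of i] by (auto simp: bad_def)
        also have "\<dots> \<le> 4 ^ k * \<tau>" using i \<tau> by (intro mult_right_mono power_increasing) auto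
        finally have "a = g x" by (simp add: a_def)
        then show ?thesis using elim(1) nb w_g[of x] by force
      qed
      have sums: "(\<Sum>i=1..k. local_lip (v i) x) = (\<Sum>i\<in>T. local_lip (v i) x) + (\<Sum>i\<in>{1..k} - T. local_lip (v i) x)"
        using T by (subst sum.subset_diff[of T "{1..k}"]) auto
      have "(\<Sum>i\<in>T. local_lip (v i) x) \<le> (\<Sum>i\<in>T. ?K * (4 ^ i * \<tau>))"
        by (intro sum_mono local_lip_le_const v(1))
      also have "\<dots> = ?K * \<tau> * (\<Sum>i\<in>T. 4 ^ i)" by (simp add: sum_distrib_left mult_ac)
      finally have 1: "(\<Sum>i\<in>T. local_lip (v i) x) \<le> ?K * \<tau> * (\<Sum>i\<in>T. 4 ^ i)" .
      have "(\<Sum>i\<in>{1..k} - T. local_lip (v i) x) \<le> real (card ({1..k} - T)) * (a + 8)"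
        by (rule sum_bounded_above) (use good in auto)
      also have "\<dots> \<le> real k * (a + 8)"
      proof (rule mult_right_mono)
        have "card ({1..k} - T) \<le> card {1..k}" by (intro card_mono) auto
        then show "real (card ({1..k} - T)) \<le> real k" by simp
      qed (use a0 in simp)
      finally have 2: "(\<Sum>i\<in>{1..k} - T. local_lip (v i) x) \<le> real k * (a + 8)" .
      have k1: "0 \<le> 1 / real k" by simp
      have "local_lip h x \<le> (1 / real k) * local_lip s x" using hl(1)[OF k1, of x] by simp
      also have "\<dots> \<le> (1 / real k) * (?K * \<tau> * (\<Sum>i\<in>T. 4 ^ i) + real k * (a + 8))"
        using s(2)[of x] sums 1 2 by (intro mult_left_mono) auto
      also have "\<dots> = b + (a + 8)" using k by (simp add: b_def field_simps)
      finally have hle: "local_lip h x \<le> b + (a + 8)" .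
      have "0 \<le> local_lip h x" by (rule local_lip_nonneg[OF hl(2)]) simp
      then have "local_lip h x powr p \<le> (b + (a + 8)) powr p" using hle p by (intro powr_mono2) auto
      also have "\<dots> \<le> 2 powr p * (b powr p + (a + 8) powr p)"
        using a0 b0 p by (intro add_powr_le) auto
      also have "\<dots> \<le> 2 powr p * (b powr p + 2 powr p * (a powr p + 8 powr p))"
        using a0 p by (intro mult_left_mono add_left_mono add_powr_le) auto
      also have "\<dots> \<le> 2 powr p * (2 powr p * b powr p + 2 powr p * (a powr p + 8 powr p))"
      proof (intro mult_left_mono add_right_mono)
        have "1 \<le> 2 powr p" using p by (simp add: ge_one_powr_ge_zero)
        then show "b powr p \<le> 2 powr p * b powr p" by (simp add: mult_le_cancel_right1)
      qed simp
      also have "\<dots> = 4 powr p * ((a powr p + b powr p) + 8 powr p)"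
        using powr_mult[of 2 2 p] by (simp add: algebra_simps)
      also have "a powr p = g x powr p * indicator {x. g x \<le> 4 ^ k * \<tau>} x"
        using p by (simp add: a_def indicator_def)
      also have "b powr p \<le> (2 * ?K / real k * \<tau>) powr p * (\<Sum>i=1..k. (4 ^ i) powr p * indicator (bad (4 ^ i * \<tau>)) x)"
      proof -
        define X where "X = ?K / real k * \<tau>"
        have X: "0 \<le> X" using K \<tau> by (simp add: X_def)
        have "b powr p = X powr p * (\<Sum>i\<in>T. 4 ^ i) powr p"
          unfolding b_def X_def[symmetric] using X by (subst powr_mult) (auto intro: sum_nonneg)
        also have "\<dots> \<le> X powr p * (2 powr p * (\<Sum>i\<in>T. (4 ^ i) powr p))"
          using T p by (intro mult_left_mono sum_powers_four_powr_le) auto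
        also have "\<dots> = (2 * X) powr p * (\<Sum>i\<in>T. (4 ^ i) powr p)"
          using X by (simp add: powr_mult)
        also have "2 * X = 2 * ?K / real k * \<tau>" by (simp add: X_def)
        also have "(\<Sum>i\<in>T. (4 ^ i) powr p) = (\<Sum>i=1..k. (4 ^ i) powr p * indicator (bad (4 ^ i * \<tau>)) x)"
          by (rule sum.mono_neutral_cong_left) (auto simp: T_def)
        finally show ?thesis by (simp add: mult.assoc)
      qed
      finally show ?case by simp
    qed
  qed
qed

text \<open>At a point of \<open>steep \<tau>\<close> that is not bad at 4 * \<tau>, the average h
  agrees with w and exceeds \<tau> times the distance to E. By the Hardy inequality its p-energy
  must then have a large average about the point, and the weak-type bound measures such points.
  \<open>\<kappa>1\<close> calibrates the Hardy inequality for this contradiction;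
  \<open>\<kappa>2\<close> lets the additive 8 powr p be absorbed.\<close>

lemma level_estimate:
  assumes \<tau>: "8 \<le> \<tau>" and k: "1 \<le> k" and \<kappa>: "0 < \<kappa>"
    and \<kappa>1: "hardy_const p TYPE('a) * (4 powr p * (2 * \<kappa>)) \<le> c" and \<kappa>2: "8 powr p \<le> \<kappa> * \<tau> powr p"
  shows "emeasure lborel (steep \<tau>) \<le> emeasure lborel (bad (4 * \<tau>)) +
    ennreal (5 ^ DIM('a) / (\<kappa> * \<tau> powr p)) * ((\<integral>\<^sup>+x. ennreal (g x powr p) * indicator {x. g x \<le> 4 ^ k * \<tau>} x \<partial>lborel) +
     (\<Sum>i=1..k. ennreal ((2 * trunc_const DIM('a) / real k * \<tau>) powr p * (4 ^ i) powr p) * emeasure lborel (bad (4 ^ i * \<tau>))))"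
proof -
  let ?D = "(2 * trunc_const DIM('a) / real k * \<tau>) powr p"
  obtain K h where h: "K-lipschitz_on UNIV h" "\<And>x. 0 \<le> h x" "\<And>x. x \<in> E \<Longrightarrow> h x = 0"
    "\<And>x. x \<notin> bad (4 * \<tau>) \<Longrightarrow> h x = w x"
    "AE x in lborel. local_lip h x powr p \<le> 4 powr p * ((g x powr p * indicator {x. g x \<le> 4 ^ k * \<tau>} x +
       ?D * (\<Sum>i=1..k. (4 ^ i) powr p * indicator (bad (4 ^ i * \<tau>)) x)) + 8 powr p)"
    by (rule averaged_truncation[OF \<tau> k], rule that)
  define H where "H x = ennreal (g x powr p * indicator {x. g x \<le> 4 ^ k * \<tau>} x +
       ?D * (\<Sum>i=1..k. (4 ^ i) powr p * indicator (bad (4 ^ i * \<tau>)) x))" for x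
  have Hm[measurable]: "H \<in> borel_measurable borel" unfolding H_def by measurable
  have \<tau>p: "0 < \<tau> powr p" using \<tau> by simp
  have tt: "0 < \<kappa> * \<tau> powr p" using \<kappa> \<tau>p by simp
  have sub: "steep \<tau> \<subseteq> bad (4 * \<tau>) \<union> maxset H (\<kappa> * \<tau> powr p)"
  proof
    fix x assume x: "x \<in> steep \<tau>"
    show "x \<in> bad (4 * \<tau>) \<union> maxset H (\<kappa> * \<tau> powr p)"
    proof (cases "x \<in> bad (4 * \<tau>)")
      case False
      then have hx: "h x = w x" by (rule h(4))
      have d: "0 \<le> infdist x E" by (rule infdist_nonneg)
      have lw: "\<tau> * infdist x E < h x" using x by (simp add: steep_def hx)
      then have hpos: "0 < h x" using d \<tau> by (smt (verit) mult_nonneg_nonneg)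
      have nx: "norm x < 1/4" using w_far[of x] hpos hx by force
      \<comment> \<open>Half of the factor 2 * \<kappa> remains as the height for H, the other half
        pays for 8 powr p.\<close>
      let ?t = "4 powr p * (2 * \<kappa> * \<tau> powr p)"
      have "x \<in> maxset (\<lambda>y. ennreal (local_lip h y powr p)) ?t"
      proof (rule ccontr)
        assume nm: "x \<notin> maxset (\<lambda>y. ennreal (local_lip h y powr p)) ?t"
        have "c * h x powr p \<le> 4 powr p * (4 powr p + 1) * 2 ^ DIM('a) * measure lborel (ball (0::'a) 1) * ?t * infdist x E powr p"
          by (rule fat_pointwise_hardy[OF fat _ c closed_E zero_E h(1-3) nx hpos _ nm]) (use p \<kappa> in auto)
        also have "\<dots> = hardy_const p TYPE('a) * (4 powr p * (2 * \<kappa>)) * (\<tau> powr p * infdist x E powr p)"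
          by (simp add: hardy_const_def mult_ac)
        also have "\<dots> \<le> c * (\<tau> powr p * infdist x E powr p)"
          using \<kappa>1 by (rule mult_right_mono) simp
        also have "\<tau> powr p * infdist x E powr p = (\<tau> * infdist x E) powr p"
          using d \<tau> by (simp add: powr_mult)
        also have "c * (\<tau> * infdist x E) powr p < c * h x powr p"
          using lw d \<tau> c p by (intro mult_strict_left_mono powr_less_mono2) auto
        finally show False by simp
      qed
      then have "x \<in> maxset H (\<kappa> * \<tau> powr p)"
      proof (rule maxset_comparison[where C = "4 powr p" and e = "8 powr p"])
        show "AE y in lborel. ennreal (local_lip h y powr p) \<le> ennreal (4 powr p) * (H y + ennreal (8 powr p))"
          using h(5)
        proof eventually_elim
          case (elim y)
          let ?b = "g y powr p * indicator {x. g x \<le> 4 ^ k * \<tau>} y + ?D * (\<Sum>i=1..k. (4 ^ i) powr p * indicator (bad (4 ^ i * \<tau>)) y)"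
          have b: "0 \<le> ?b" by (intro add_nonneg_nonneg mult_nonneg_nonneg sum_nonneg) auto
          have "ennreal (local_lip h y powr p) \<le> ennreal (4 powr p * (?b + 8 powr p))"
            using elim by (rule ennreal_leI)
          also have "\<dots> = ennreal (4 powr p) * ennreal (?b + 8 powr p)" using b by (intro ennreal_mult) auto
          also have "ennreal (?b + 8 powr p) = H y + ennreal (8 powr p)" unfolding H_def using b by (intro ennreal_plus) auto
          finally show ?case .
        qed
        show "4 powr p * (\<kappa> * \<tau> powr p + 8 powr p) \<le> ?t" using \<kappa>2 by (intro mult_left_mono) auto
      qed (use tt Hm in auto)
      then show ?thesis by simp
    qed simp
  qed
  have Mm: "maxset H (\<kappa> * \<tau> powr p) \<in> sets borel" by (intro borel_open open_maxset Hm)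
  have intH: "(\<integral>\<^sup>+x. H x \<partial>lborel) = (\<integral>\<^sup>+x. ennreal (g x powr p) * indicator {x. g x \<le> 4 ^ k * \<tau>} x \<partial>lborel) +
     (\<Sum>i=1..k. ennreal (?D * (4 ^ i) powr p) * emeasure lborel (bad (4 ^ i * \<tau>)))"
  proof -
    have "H x = ennreal (g x powr p) * indicator {x. g x \<le> 4 ^ k * \<tau>} x +
       (\<Sum>i=1..k. ennreal (?D * (4 ^ i) powr p) * indicator (bad (4 ^ i * \<tau>)) x)" for x
    proof -
      have "H x = ennreal (g x powr p * indicator {x. g x \<le> 4 ^ k * \<tau>} x) +
         ennreal (\<Sum>i=1..k. ?D * (4 ^ i) powr p * indicator (bad (4 ^ i * \<tau>)) x)"
      proof -
        have eq: "?D * (\<Sum>i=1..k. (4 ^ i) powr p * indicator (bad (4 ^ i * \<tau>)) x) = (\<Sum>i=1..k. ?D * (4 ^ i) powr p * indicator (bad (4 ^ i * \<tau>)) x)"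
          by (simp only: sum_distrib_left mult.assoc)
        show ?thesis unfolding H_def eq by (intro ennreal_plus sum_nonneg mult_nonneg_nonneg) auto
      qed
      also have "ennreal (\<Sum>i=1..k. ?D * (4 ^ i) powr p * indicator (bad (4 ^ i * \<tau>)) x) =
         (\<Sum>i=1..k. ennreal (?D * (4 ^ i) powr p * indicator (bad (4 ^ i * \<tau>)) x))"
        by (rule sum_ennreal[symmetric]) simp
      finally show ?thesis by (simp add: ennreal_mult' ennreal_indicator)
    qed
    then have "(\<integral>\<^sup>+x. H x \<partial>lborel) = (\<integral>\<^sup>+x. ennreal (g x powr p) * indicator {x. g x \<le> 4 ^ k * \<tau>} x +
       (\<Sum>i=1..k. ennreal (?D * (4 ^ i) powr p) * indicator (bad (4 ^ i * \<tau>)) x) \<partial>lborel)" by simp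
    also have "\<dots> = (\<integral>\<^sup>+x. ennreal (g x powr p) * indicator {x. g x \<le> 4 ^ k * \<tau>} x \<partial>lborel) +
       (\<integral>\<^sup>+x. (\<Sum>i=1..k. ennreal (?D * (4 ^ i) powr p) * indicator (bad (4 ^ i * \<tau>)) x) \<partial>lborel)"
      by (rule nn_integral_add) measurable
    also have "(\<integral>\<^sup>+x. (\<Sum>i=1..k. ennreal (?D * (4 ^ i) powr p) * indicator (bad (4 ^ i * \<tau>)) x) \<partial>lborel) =
       (\<Sum>i=1..k. ennreal (?D * (4 ^ i) powr p) * emeasure lborel (bad (4 ^ i * \<tau>)))"
      by (subst nn_integral_sum) (auto simp: nn_integral_cmult_indicator)
    finally show ?thesis .
  qed
  have "ennreal (\<kappa> * \<tau> powr p) * emeasure lborel (maxset H (\<kappa> * \<tau> powr p)) \<le> ennreal (5 ^ DIM('a)) * (\<integral>\<^sup>+x. H x \<partial>lborel)"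
    by (rule emeasure_maxset_le[OF Hm tt])
  then have "ennreal (1 / (\<kappa> * \<tau> powr p)) * (ennreal (\<kappa> * \<tau> powr p) * emeasure lborel (maxset H (\<kappa> * \<tau> powr p)))
      \<le> ennreal (1 / (\<kappa> * \<tau> powr p)) * (ennreal (5 ^ DIM('a)) * (\<integral>\<^sup>+x. H x \<partial>lborel))"
    by (rule mult_left_mono) simp
  then have mH: "emeasure lborel (maxset H (\<kappa> * \<tau> powr p)) \<le> ennreal (5 ^ DIM('a) / (\<kappa> * \<tau> powr p)) * (\<integral>\<^sup>+x. H x \<partial>lborel)"
    using tt \<kappa> \<tau>p by (simp add: mult.assoc[symmetric] flip: ennreal_mult)
  have "emeasure lborel (steep \<tau>) \<le> emeasure lborel (bad (4 * \<tau>) \<union> maxset H (\<kappa> * \<tau> powr p))"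
    using sub Mm by (intro emeasure_mono) auto
  also have "\<dots> \<le> emeasure lborel (bad (4 * \<tau>)) + emeasure lborel (maxset H (\<kappa> * \<tau> powr p))"
    using Mm by (intro emeasure_subadditive) auto
  also have "\<dots> \<le> emeasure lborel (bad (4 * \<tau>)) + ennreal (5 ^ DIM('a) / (\<kappa> * \<tau> powr p)) * (\<integral>\<^sup>+x. H x \<partial>lborel)"
    using mH by (rule add_left_mono)
  finally show ?thesis unfolding intH .
qed

end

section \<open>Summation over the levels\<close>

lemma four_powr_less_1: "s < 0 \<Longrightarrow> (4::real) powr s < 1"
  using powr_less_mono[of s 0 4] by simp

text \<open>Discrete form of the integral of t^(s-1) over 0 < t < y: the ratio exceeds 1, so the
  last term dominates.\<close>

lemma suminf_powers_below:
  fixes s y :: real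
  assumes s: "0 < s"
  shows "(\<Sum>j. ennreal ((4 powr s) ^ j) * indicator {j. 4 ^ j < y} j) \<le> ennreal (y powr s / (1 - 4 powr - s))"
proof -
  define x where "x = 4 powr s"
  have x: "1 < x" using s by (simp add: x_def)
  have x': "4 powr - s = 1 / x" by (simp add: x_def powr_minus_divide)
  have geo: "(\<Sum>j\<le>J. x ^ j) \<le> x ^ J / (1 - 1 / x)" for J
  proof (induction J)
    case 0
    show ?case using x by (simp add: field_simps)
  next
    case (Suc J)
    have "(\<Sum>j\<le>Suc J. x ^ j) \<le> x ^ J / (1 - 1 / x) + x ^ Suc J" using Suc by simp
    also have "\<dots> = x ^ Suc J / (1 - 1 / x)" using x by (simp add: field_simps)
    finally show ?case .
  qed
  obtain N where N: "y < 4 ^ N" using real_arch_pow[of 4 y] by auto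
  have lt: "j < N" if "4 ^ j < y" for j
  proof (rule ccontr)
    assume "\<not> j < N"
    then have "(4::real) ^ N \<le> 4 ^ j" by (intro power_increasing) auto
    then show False using N that by linarith
  qed
  define T where "T = {j::nat. 4 ^ j < y}"
  have T: "finite T" by (rule finite_subset[of _ "{..<N}"]) (use lt in \<open>auto simp: T_def\<close>)
  have "(\<Sum>j. ennreal (x ^ j) * indicator T j) = (\<Sum>j\<in>T. ennreal (x ^ j) * indicator T j)"
    by (rule suminf_finite[OF T]) simp
  also have "\<dots> = (\<Sum>j\<in>T. ennreal (x ^ j))" by (rule sum.cong) auto
  also have "\<dots> = ennreal (\<Sum>j\<in>T. x ^ j)" using x by (intro sum_ennreal) auto
  also have "\<dots> \<le> ennreal (y powr s / (1 - 1 / x))"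
  proof (rule ennreal_leI)
    show "(\<Sum>j\<in>T. x ^ j) \<le> y powr s / (1 - 1 / x)"
    proof (cases "T = {}")
      case False
      define J where "J = Max T"
      have J: "J \<in> T" using T False by (simp add: J_def)
      have "(\<Sum>j\<in>T. x ^ j) \<le> (\<Sum>j\<le>J. x ^ j)"
        using T x by (intro sum_mono2) (auto simp: J_def)
      also have "\<dots> \<le> x ^ J / (1 - 1 / x)" by (rule geo)
      also have "\<dots> \<le> y powr s / (1 - 1 / x)"
      proof (rule divide_right_mono)
        have "x ^ J = (4 ^ J) powr s" by (simp add: x_def powr_realpow[symmetric] powr_powr mult.commute)
        also have "\<dots> \<le> y powr s" using J s by (intro powr_mono2) (auto simp: T_def)
        finally show "x ^ J \<le> y powr s" .
      qed (use x in simp)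
      finally show ?thesis .
    qed (use x in simp)
  qed
  finally show ?thesis by (simp add: x_def[symmetric] x' T_def)
qed

text \<open>The matching tail, of t^(-s-1) over t > y: the ratio is below 1, so the first term
  dominates.\<close>

lemma suminf_powers_above:
  fixes s y :: real
  assumes s: "0 < s" and y: "0 < y"
  shows "(\<Sum>j. ennreal ((4 powr - s) ^ j) * indicator {j. y \<le> 4 ^ j} j) \<le> ennreal (y powr - s / (1 - 4 powr - s))"
proof -
  define x where "x = 4 powr - s"
  have x: "0 < x" "x < 1" using s by (simp_all add: x_def four_powr_less_1)
  define J where "J = (LEAST j::nat. y \<le> 4 ^ j)"
  have "\<exists>j::nat. y \<le> 4 ^ j" using real_arch_pow[of 4 y] by (auto intro: less_imp_le)
  then have J: "y \<le> 4 ^ J" unfolding J_def by (rule LeastI_ex)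
  have least: "J \<le> j" if "y \<le> 4 ^ j" for j using that unfolding J_def by (rule Least_le)
  have "(\<lambda>j. x ^ J * x ^ j) sums (x ^ J * (1 / (1 - x)))"
    by (intro sums_mult geometric_sums) (use x in auto)
  then have sh: "(\<lambda>j. if j + J < J then 0 else x ^ (j + J)) sums (x ^ J / (1 - x))"
    by (simp add: power_add mult.commute)
  have "(\<lambda>j. if j < J then 0 else x ^ j) sums (x ^ J / (1 - x) + (\<Sum>j<J. if j < J then 0 else x ^ j))"
    using sh by (subst (asm) sums_iff_shift)
  then have sums: "(\<lambda>j. if j < J then 0 else x ^ j) sums (x ^ J / (1 - x))" by simp
  have "(\<Sum>j. ennreal (x ^ j) * indicator {j. y \<le> 4 ^ j} j) \<le> (\<Sum>j. ennreal (if j < J then 0 else x ^ j))"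
    using least by (intro suminf_le) (auto simp: indicator_def dest: leD)
  also have "\<dots> = ennreal (x ^ J / (1 - x))"
    by (rule suminf_ennreal_eq[OF _ sums]) (use x in auto)
  also have "\<dots> \<le> ennreal (y powr - s / (1 - x))"
  proof (intro ennreal_leI divide_right_mono)
    have "x ^ J = (4 ^ J) powr - s" by (simp add: x_def powr_realpow[symmetric] powr_powr mult.commute)
    also have "\<dots> \<le> y powr - s" using J s y by (intro powr_mono2') auto
    finally show "x ^ J \<le> y powr - s" .
  qed (use x in simp)
  finally show ?thesis by (simp add: x_def)
qed

text \<open>Shifting by i loses the first i terms. For W = 4 powr q the factor 1 / W ^ i offsets the
  growth (4 powr p) ^ i of the truncation slopes up to (4 powr (p - q)) ^ i.\<close>

lemma suminf_weighted_shift_le: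
  fixes f :: "nat \<Rightarrow> ennreal"
  assumes W: "0 < W"
  shows "(\<Sum>j. ennreal (W ^ j) * f (j + i)) \<le> ennreal (1 / W ^ i) * (\<Sum>j. ennreal (W ^ j) * f j)"
proof -
  have "ennreal (W ^ i) * (\<Sum>j. ennreal (W ^ j) * f (j + i)) = (\<Sum>j. ennreal (W ^ i) * (ennreal (W ^ j) * f (j + i)))"
    by (rule ennreal_suminf_cmult[symmetric])
  also have "\<dots> = (\<Sum>j. ennreal (W ^ (j + i)) * f (j + i))"
    using W by (intro suminf_cong) (simp add: power_add mult.assoc[symmetric] mult.commute flip: ennreal_mult)
  also have "\<dots> \<le> (\<Sum>j<i. ennreal (W ^ j) * f j) + (\<Sum>j. ennreal (W ^ (j + i)) * f (j + i))" by (rule add_increasing) auto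
  also have "\<dots> = (\<Sum>j. ennreal (W ^ j) * f j)"
    using suminf_offset[of "\<lambda>j. ennreal (W ^ j) * f j" i] by (simp add: add.commute)
  finally have "ennreal (1 / W ^ i) * (ennreal (W ^ i) * (\<Sum>j. ennreal (W ^ j) * f (j + i))) \<le> ennreal (1 / W ^ i) * (\<Sum>j. ennreal (W ^ j) * f j)"
    by (rule mult_left_mono) simp
  then show ?thesis using W by (simp add: mult.assoc[symmetric] flip: ennreal_mult)
qed

text \<open>Cancelling half of x on both sides is sound only for finite x.\<close>

lemma ennreal_absorb_half:
  fixes x y z :: ennreal
  assumes "x \<le> ennreal (1/2) * (x + y) + z" "x < \<infinity>"
  shows "x \<le> y + 2 * z"
proof (cases "y = \<infinity> \<or> z = \<infinity>")
  case True
  then show ?thesis by (auto simp: ennreal_mult_top)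
next
  case False
  then obtain y' z' where yz: "y = ennreal y'" "0 \<le> y'" "z = ennreal z'" "0 \<le> z'" by (metis ennreal_cases infinity_ennreal_def)
  obtain x' where x: "x = ennreal x'" "0 \<le> x'" using assms(2) by (metis ennreal_cases infinity_ennreal_def less_irrefl)
  have "ennreal (1/2) * (ennreal x' + ennreal y') + ennreal z' = ennreal (1/2 * (x' + y') + z')"
    using x yz by (simp only: ennreal_plus[symmetric] ennreal_mult[symmetric] mult_nonneg_nonneg add_nonneg_nonneg divide_nonneg_nonneg zero_le_one zero_le_numeral)
  then have "x' \<le> 1/2 * (x' + y') + z'"
    using assms(1) x yz by (simp only: ennreal_le_iff mult_nonneg_nonneg add_nonneg_nonneg divide_nonneg_nonneg zero_le_one zero_le_numeral)
  then have "x' \<le> y' + 2 * z'" by (simp add: field_simps)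
  then have "ennreal x' \<le> ennreal (y' + 2 * z')" by (rule ennreal_leI)
  also have "\<dots> = ennreal y' + 2 * ennreal z'" using yz by (simp add: ennreal_mult)
  finally show ?thesis using x yz by simp
qed

section \<open>A priori finiteness and the energies of g summed over the levels\<close>

context truncation
begin

lemma steep_subset: "0 \<le> \<tau> \<Longrightarrow> steep \<tau> \<subseteq> ball 0 1"
proof
  fix x assume "0 \<le> \<tau>" "x \<in> steep \<tau>"
  then have "0 \<le> \<tau> * infdist x E" "\<tau> * infdist x E < w x"
    by (auto simp: steep_def intro: mult_nonneg_nonneg infdist_nonneg)
  then have "w x \<noteq> 0" by linarith
  then have "norm x < 1/4" using w_far[of x] by force
  then show "x \<in> ball 0 1" by simp
qed

text \<open>Comparison with a nearest point of E, where w = 0, gives w \<le> L * infdist x E. Only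
  the finiteness needed for absorption rests on this, so L does not reach the final
  constant.\<close>

lemma steep_empty:
  assumes "L \<le> \<tau>"
  shows "steep \<tau> = {}"
proof -
  have "w x \<le> \<tau> * infdist x E" for x
  proof -
    obtain z where z: "z \<in> E" "infdist x E = dist x z" using infdist_attains_inf[OF closed_E] zero_E by blast
    have "w x \<le> L * dist x z" using lipschitz_UNIV_absD[OF lip_w, of x z] w_E[OF z(1)] by simp
    also have "\<dots> \<le> \<tau> * dist x z" using assms by (intro mult_right_mono) auto
    finally show ?thesis by (simp add: z)
  qed
  then show ?thesis by (auto simp: steep_def not_less)
qed

text \<open>Strong-type bound for the maximal function in discrete layer-cake form. Cutting g at
  half the height before the weak-type bound leaves, after exchanging sum and integral, a geometric
  sum over 4 ^ j < 2 / \<tau> * g x of order g^(q-1); q > 1 keeps its last term dominant.\<close>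

lemma suminf_gmax_le:
  assumes q: "1 < q" and \<tau>: "0 < \<tau>"
  shows "(\<Sum>j. ennreal ((4 powr q) ^ j) * emeasure lborel (gmax (4 ^ j * \<tau>)))
     \<le> ennreal (2 * 5 ^ DIM('a) / \<tau> * (2 / \<tau>) powr (q - 1) / (1 - 4 powr - (q - 1))) * (\<integral>\<^sup>+x. ennreal (g x powr q) \<partial>lborel)"
proof -
  let ?C = "2 * 5 ^ DIM('a) / \<tau>"
  let ?f = "\<lambda>x j. (ennreal ((4 powr (q - 1)) ^ j) * indicator {j. 4 ^ j < 2 / \<tau> * g x} j)"
  let ?c = "?C * (2 / \<tau>) powr (q - 1) / (1 - 4 powr - (q - 1))"
  have C: "0 \<le> ?C" using \<tau> by simp
  have q1: "0 < q - 1" using q by simp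
  have den: "0 < 1 - 4 powr - (q - 1)" using four_powr_less_1[of "- (q - 1)"] q by simp
  have each: "ennreal ((4 powr q) ^ j) * emeasure lborel (gmax (4 ^ j * \<tau>)) \<le>
     (\<integral>\<^sup>+x. ennreal (?C * g x) * ?f x j \<partial>lborel)" for j
  proof -
    define \<sigma> where "\<sigma> = 4 ^ j * \<tau>"
    have \<sigma>: "0 < \<sigma>" using \<tau> by (simp add: \<sigma>_def)
    define F where "F y = ennreal (g y) * indicator {y. ennreal (\<sigma> / 2) < ennreal (g y)} y" for y
    have [measurable]: "F \<in> borel_measurable borel" unfolding F_def by measurable
    have "gmax \<sigma> \<subseteq> maxset F (\<sigma> / 2)"
      unfolding gmax_def F_def by (rule maxset_subset_cut) (use \<sigma> in auto)
    then have "ennreal (\<sigma> / 2) * emeasure lborel (gmax \<sigma>) \<le> ennreal (\<sigma> / 2) * emeasure lborel (maxset F (\<sigma> / 2))"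
      by (intro mult_left_mono emeasure_mono) (auto intro!: borel_open open_maxset)
    also have "\<dots> \<le> ennreal (5 ^ DIM('a)) * (\<integral>\<^sup>+x. F x \<partial>lborel)"
      by (rule emeasure_maxset_le) (use \<sigma> in auto)
    finally have "ennreal (2 / \<sigma>) * (ennreal (\<sigma> / 2) * emeasure lborel (gmax \<sigma>)) \<le> ennreal (2 / \<sigma>) * (ennreal (5 ^ DIM('a)) * (\<integral>\<^sup>+x. F x \<partial>lborel))"
      by (rule mult_left_mono) simp
    then have le: "emeasure lborel (gmax \<sigma>) \<le> ennreal (2 * 5 ^ DIM('a) / \<sigma>) * (\<integral>\<^sup>+x. F x \<partial>lborel)"
      using \<sigma> by (simp add: mult.assoc[symmetric] flip: ennreal_mult)
    have "ennreal ((4 powr q) ^ j) * emeasure lborel (gmax \<sigma>) \<le> ennreal ((4 powr q) ^ j) * (ennreal (2 * 5 ^ DIM('a) / \<sigma>) * (\<integral>\<^sup>+x. F x \<partial>lborel))"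
      using le by (rule mult_left_mono) simp
    also have "\<dots> = ennreal (?C * (4 powr (q - 1)) ^ j) * (\<integral>\<^sup>+x. F x \<partial>lborel)"
    proof -
      have "(4 powr q) ^ j * (2 * 5 ^ DIM('a) / \<sigma>) = ?C * (4 powr (q - 1)) ^ j"
        using \<tau> by (simp add: \<sigma>_def powr_diff power_divide field_simps)
      then show ?thesis using \<sigma> by (simp add: mult.assoc[symmetric] flip: ennreal_mult)
    qed
    also have "\<dots> = (\<integral>\<^sup>+x. ennreal (?C * (4 powr (q - 1)) ^ j) * F x \<partial>lborel)"
      by (rule nn_integral_cmult[symmetric]) measurable
    also have "\<dots> = (\<integral>\<^sup>+x. ennreal (?C * g x) * ?f x j \<partial>lborel)"
    proof (intro nn_integral_cong)
      fix x
      have "ennreal (\<sigma> / 2) < ennreal (g x) \<longleftrightarrow> 4 ^ j < 2 / \<tau> * g x"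
        using \<sigma> \<tau> by (subst ennreal_less_iff) (auto simp: \<sigma>_def field_simps)
      then have "F x = ennreal (g x) * indicator {j. 4 ^ j < 2 / \<tau> * g x} j" by (simp add: F_def indicator_def)
      moreover have "ennreal (?C * (4 powr (q - 1)) ^ j) = ennreal ?C * ennreal ((4 powr (q - 1)) ^ j)"
        using C by (intro ennreal_mult) auto
      moreover have "ennreal (?C * g x) = ennreal ?C * ennreal (g x)"
        using C g_nonneg by (intro ennreal_mult) auto
      ultimately show "ennreal (?C * (4 powr (q - 1)) ^ j) * F x = ennreal (?C * g x) * ?f x j"
        by (simp only: mult_ac)
    qed
    finally show ?thesis by (simp add: \<sigma>_def)
  qed
  have "(\<Sum>j. ennreal ((4 powr q) ^ j) * emeasure lborel (gmax (4 ^ j * \<tau>))) \<le>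
     (\<Sum>j. \<integral>\<^sup>+x. ennreal (?C * g x) * ?f x j \<partial>lborel)"
    using each by (rule suminf_le) auto
  also have "\<dots> = (\<integral>\<^sup>+x. (\<Sum>j. ennreal (?C * g x) * ?f x j) \<partial>lborel)"
  proof (rule nn_integral_suminf[symmetric])
    fix j :: nat
    have "indicator {j. 4 ^ j < 2 / \<tau> * g x} j = (indicator {x. 4 ^ j < 2 / \<tau> * g x} x :: ennreal)" for x
      by (simp add: indicator_def)
    then show "(\<lambda>x. ennreal (?C * g x) * ?f x j) \<in> borel_measurable lborel"
      by simp
  qed
  also have "\<dots> \<le> (\<integral>\<^sup>+x. ennreal ?c * ennreal (g x powr q) \<partial>lborel)"
  proof (intro nn_integral_mono)
    fix x
    have "(\<Sum>j. ennreal (?C * g x) * ?f x j)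
       = ennreal (?C * g x) * (\<Sum>j. ennreal ((4 powr (q - 1)) ^ j) * indicator {j. 4 ^ j < 2 / \<tau> * g x} j)"
      by (rule ennreal_suminf_cmult)
    also have "\<dots> \<le> ennreal (?C * g x) * ennreal ((2 / \<tau> * g x) powr (q - 1) / (1 - 4 powr - (q - 1)))"
      by (intro mult_left_mono suminf_powers_below q1) simp
    also have "\<dots> = ennreal (?c * g x powr q)"
    proof (cases "g x = 0")
      case False
      then have gx: "0 < g x" using g_nonneg[of x] by simp
      have "(2 / \<tau> * g x) powr (q - 1) = (2 / \<tau>) powr (q - 1) * g x powr (q - 1)"
        by (rule powr_mult)
      moreover have "g x * g x powr (q - 1) = g x powr q" using gx by (simp add: powr_diff)
      ultimately have "?C * g x * ((2 / \<tau> * g x) powr (q - 1) / (1 - 4 powr - (q - 1))) = ?c * g x powr q"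
        by (simp add: mult_ac)
      moreover have "ennreal (?C * g x) * ennreal ((2 / \<tau> * g x) powr (q - 1) / (1 - 4 powr - (q - 1)))
          = ennreal (?C * g x * ((2 / \<tau> * g x) powr (q - 1) / (1 - 4 powr - (q - 1))))"
        by (rule ennreal_mult[symmetric]) (intro mult_nonneg_nonneg divide_nonneg_pos C den g_nonneg powr_ge_zero)+
      ultimately show ?thesis by (simp only:)
    qed simp
    also have "\<dots> = ennreal ?c * ennreal (g x powr q)"
      by (intro ennreal_mult divide_nonneg_pos mult_nonneg_nonneg C den powr_ge_zero)
    finally show "(\<Sum>j. ennreal (?C * g x) * ?f x j) \<le> ennreal ?c * ennreal (g x powr q)" .
  qed
  also have "\<dots> = ennreal ?c * (\<integral>\<^sup>+x. ennreal (g x powr q) \<partial>lborel)"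
    by (rule nn_integral_cmult) measurable
  finally show ?thesis .
qed

text \<open>Exchanging sum and integral leaves, at each x, the geometric tail over 4 ^ j at least g
  x / (4 ^ k * \<tau>). Its size is of order g^(q-p), which converts the p-energy into a
  q-energy.\<close>

lemma suminf_truncated_energy_le:
  assumes q: "q < p" and \<tau>: "0 < \<tau>"
  shows "(\<Sum>j. ennreal ((4 powr - (p - q)) ^ j) * (\<integral>\<^sup>+x. ennreal (g x powr p) * indicator {x. g x \<le> 4 ^ k * (4 ^ j * \<tau>)} x \<partial>lborel))
     \<le> ennreal ((1 / (4 ^ k * \<tau>)) powr - (p - q) / (1 - 4 powr - (p - q))) * (\<integral>\<^sup>+x. ennreal (g x powr q) \<partial>lborel)"
proof -
  let ?e = "p - q"
  let ?f = "\<lambda>x j. (ennreal ((4 powr - ?e) ^ j) * indicator {x. g x \<le> 4 ^ k * (4 ^ j * \<tau>)} x)"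
  let ?c = "(1 / (4 ^ k * \<tau>)) powr - ?e / (1 - 4 powr - ?e)"
  have e: "0 < ?e" using q by simp
  have den: "0 < 1 - 4 powr - ?e" using four_powr_less_1[of "- ?e"] q by simp
  have ind: "indicator {j. 1 / (4 ^ k * \<tau>) * g x \<le> 4 ^ j} j = (indicator {x. g x \<le> 4 ^ k * (4 ^ j * \<tau>)} x :: ennreal)" for x j
    using \<tau> by (simp add: indicator_def field_simps)
  have "(\<Sum>j. ennreal ((4 powr - ?e) ^ j) * (\<integral>\<^sup>+x. ennreal (g x powr p) * indicator {x. g x \<le> 4 ^ k * (4 ^ j * \<tau>)} x \<partial>lborel))
    = (\<Sum>j. \<integral>\<^sup>+x. ennreal (g x powr p) * ?f x j \<partial>lborel)"
    by (intro suminf_cong, subst nn_integral_cmult[symmetric]) (auto intro!: nn_integral_cong simp: mult.left_commute)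
  also have "\<dots> = (\<integral>\<^sup>+x. (\<Sum>j. ennreal (g x powr p) * ?f x j) \<partial>lborel)"
    by (rule nn_integral_suminf[symmetric]) measurable
  also have "\<dots> \<le> (\<integral>\<^sup>+x. ennreal ?c * ennreal (g x powr q) \<partial>lborel)"
  proof (intro nn_integral_mono)
    fix x
    show "(\<Sum>j. ennreal (g x powr p) * ?f x j) \<le> ennreal ?c * ennreal (g x powr q)"
    proof (cases "g x = 0")
      case False
      then have gx: "0 < g x" using g_nonneg[of x] by simp
      have "(\<Sum>j. ennreal (g x powr p) * ?f x j)
         = ennreal (g x powr p) * (\<Sum>j. ennreal ((4 powr - ?e) ^ j) * indicator {j. 1 / (4 ^ k * \<tau>) * g x \<le> 4 ^ j} j)"
        unfolding ind by (rule ennreal_suminf_cmult)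
      also have "\<dots> \<le> ennreal (g x powr p) * ennreal ((1 / (4 ^ k * \<tau>) * g x) powr - ?e / (1 - 4 powr - ?e))"
        by (intro mult_left_mono suminf_powers_above e) (use gx \<tau> in auto)
      also have "\<dots> = ennreal (?c * g x powr q)"
      proof -
        have "(1 / (4 ^ k * \<tau>) * g x) powr - ?e = (1 / (4 ^ k * \<tau>)) powr - ?e * g x powr - ?e"
          by (rule powr_mult)
        moreover have "g x powr p * g x powr - ?e = g x powr q" by (simp flip: powr_add)
        ultimately have "g x powr p * ((1 / (4 ^ k * \<tau>) * g x) powr - ?e / (1 - 4 powr - ?e)) = ?c * g x powr q"
          by (simp add: mult_ac)
        then show ?thesis using den by (subst ennreal_mult[symmetric]) auto
      qed
      also have "\<dots> = ennreal ?c * ennreal (g x powr q)" using den by (intro ennreal_mult) auto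
      finally show ?thesis .
    qed simp
  qed
  also have "\<dots> = ennreal ?c * (\<integral>\<^sup>+x. ennreal (g x powr q) \<partial>lborel)"
    by (rule nn_integral_cmult) measurable
  finally show ?thesis .
qed

end

text \<open>The first summand is the bound for the maximal function; the second is the truncated
  energy times the weak-type prefactor, doubled by the absorption.\<close>

definition energy_const :: "nat \<Rightarrow> real \<Rightarrow> real \<Rightarrow> nat \<Rightarrow> real \<Rightarrow> real \<Rightarrow> real" where
  "energy_const n p q k \<kappa> \<tau> = 2 * 5 ^ n / \<tau> * (2 / \<tau>) powr (q - 1) / (1 - 4 powr - (q - 1)) +
     2 * (5 ^ n / (\<kappa> * \<tau> powr p) * ((1 / (4 ^ k * \<tau>)) powr - (p - q) / (1 - 4 powr - (p - q))))"

lemma energy_const_nonneg: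
  assumes "1 < q" "q < p" "0 < \<kappa>" "0 < \<tau>"
  shows "0 \<le> energy_const n p q k \<kappa> \<tau>"
  using assms four_powr_less_1[of "- (q - 1)"] four_powr_less_1[of "- (p - q)"]
  unfolding energy_const_def by (intro add_nonneg_nonneg mult_nonneg_nonneg divide_nonneg_nonneg) auto

context truncation
begin

text \<open>The p-th power of the height in the denominator cancels the same power in the slopes of
  the truncations, so C does not depend on j; only the energy term keeps the decay 1 / (4 powr p) ^
  j.\<close>

lemma level_estimate_power:
  fixes j k :: nat
  assumes \<tau>: "8 \<le> \<tau>" and k: "1 \<le> k" and \<kappa>: "0 < \<kappa>"
    and \<kappa>1: "hardy_const p TYPE('a) * (4 powr p * (2 * \<kappa>)) \<le> c" and \<kappa>2: "8 powr p \<le> \<kappa> * \<tau> powr p"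
    and C: "C = 5 ^ DIM('a) / \<kappa> * (2 * trunc_const DIM('a)) powr p / real k powr p"
  shows "emeasure lborel (steep (4 ^ j * \<tau>)) \<le> emeasure lborel (bad (4 ^ (j + 1) * \<tau>)) +
     (ennreal (5 ^ DIM('a) / (\<kappa> * \<tau> powr p) / (4 powr p) ^ j) * (\<integral>\<^sup>+x. ennreal (g x powr p) * indicator {x. g x \<le> 4 ^ k * (4 ^ j * \<tau>)} x \<partial>lborel) +
     (\<Sum>i=1..k. ennreal (C * (4 powr p) ^ i) * emeasure lborel (bad (4 ^ (j + i) * \<tau>))))"
proof -
  let ?t = "4 ^ j * \<tau>"
  have t: "\<tau> \<le> ?t" using \<tau> by (simp add: mult_le_cancel_right1)
  have tp: "?t powr p = (4 powr p) ^ j * \<tau> powr p"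
    by (simp add: powr_mult powr_realpow[symmetric] powr_powr mult.commute)
  have "\<tau> powr p \<le> ?t powr p" using t \<tau> p by (intro powr_mono2) auto
  then have "8 powr p \<le> \<kappa> * ?t powr p" using \<kappa>2 \<kappa> mult_left_mono[of "\<tau> powr p" "?t powr p" \<kappa>] by linarith
  then have "emeasure lborel (steep ?t) \<le> emeasure lborel (bad (4 * ?t)) +
    ennreal (5 ^ DIM('a) / (\<kappa> * ?t powr p)) * ((\<integral>\<^sup>+x. ennreal (g x powr p) * indicator {x. g x \<le> 4 ^ k * ?t} x \<partial>lborel) +
     (\<Sum>i=1..k. ennreal ((2 * trunc_const DIM('a) / real k * ?t) powr p * (4 ^ i) powr p) * emeasure lborel (bad (4 ^ i * ?t))))"
    by (rule level_estimate[OF order_trans[OF \<tau> t] k \<kappa> \<kappa>1])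
  also have "bad (4 * ?t) = bad (4 ^ (j + 1) * \<tau>)" by (simp add: mult.assoc)
  also have "ennreal (5 ^ DIM('a) / (\<kappa> * ?t powr p)) * ((\<integral>\<^sup>+x. ennreal (g x powr p) * indicator {x. g x \<le> 4 ^ k * ?t} x \<partial>lborel) +
     (\<Sum>i=1..k. ennreal ((2 * trunc_const DIM('a) / real k * ?t) powr p * (4 ^ i) powr p) * emeasure lborel (bad (4 ^ i * ?t))))
    = ennreal (5 ^ DIM('a) / (\<kappa> * \<tau> powr p) / (4 powr p) ^ j) * (\<integral>\<^sup>+x. ennreal (g x powr p) * indicator {x. g x \<le> 4 ^ k * ?t} x \<partial>lborel) +
     (\<Sum>i=1..k. ennreal (C * (4 powr p) ^ i) * emeasure lborel (bad (4 ^ (j + i) * \<tau>)))"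
  proof -
    have 1: "5 ^ DIM('a) / (\<kappa> * ?t powr p) = 5 ^ DIM('a) / (\<kappa> * \<tau> powr p) / (4 powr p) ^ j"
      unfolding tp by (simp add: mult_ac)
    have 2: "ennreal (5 ^ DIM('a) / (\<kappa> * ?t powr p)) * (ennreal ((2 * trunc_const DIM('a) / real k * ?t) powr p * (4 ^ i) powr p) * emeasure lborel (bad (4 ^ i * ?t)))
       = ennreal (C * (4 powr p) ^ i) * emeasure lborel (bad (4 ^ (j + i) * \<tau>))" for i
    proof -
      have "?t powr p \<noteq> 0" using \<tau> by simp
      moreover have "(2 * trunc_const DIM('a) / real k * ?t) powr p = (2 * trunc_const DIM('a)) powr p / real k powr p * ?t powr p"
        using trunc_const_ge_1[of "DIM('a)"] \<tau> by (simp only: powr_mult powr_divide)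
      moreover have "((4::real) ^ i) powr p = (4 powr p) ^ i"
        by (simp add: powr_realpow[symmetric] powr_powr mult.commute)
      ultimately have "5 ^ DIM('a) / (\<kappa> * ?t powr p) * ((2 * trunc_const DIM('a) / real k * ?t) powr p * (4 ^ i) powr p) = C * (4 powr p) ^ i"
        using \<kappa> by (simp add: C)
      then have "ennreal (5 ^ DIM('a) / (\<kappa> * ?t powr p)) * ennreal ((2 * trunc_const DIM('a) / real k * ?t) powr p * (4 ^ i) powr p) = ennreal (C * (4 powr p) ^ i)"
        using \<kappa> by (subst ennreal_mult[symmetric]) auto
      moreover have "bad (4 ^ i * ?t) = bad (4 ^ (j + i) * \<tau>)" by (simp add: power_add mult_ac)
      ultimately show ?thesis by (simp only: mult.assoc[symmetric])
    qed
    show ?thesis unfolding distrib_left sum_distrib_left 2 by (simp only: 1)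
  qed
  finally show ?thesis .
qed

text \<open>The level sets reappear on the right-hand side with a factor of order \<open>k powr (1 - p) * (4 powr (p - q)) ^ k\<close>, which \<open>k1\<close> and \<open>k2\<close> make small enough to absorb; this is where \<open>p > 1\<close> enters.\<close>

lemma energy_estimate:
  fixes k :: nat
  assumes \<tau>: "8 \<le> \<tau>" and k: "1 \<le> k" and \<kappa>: "0 < \<kappa>"
    and \<kappa>1: "hardy_const p TYPE('a) * (4 powr p * (2 * \<kappa>)) \<le> c" and \<kappa>2: "8 powr p \<le> \<kappa> * \<tau> powr p"
    and q: "1 < q" "q < p"
    and k1: "5 ^ DIM('a) / \<kappa> * (2 * trunc_const DIM('a)) powr p * real k powr (1 - p) \<le> 1 / 8"
    and k2: "(4 powr (p - q)) ^ k \<le> 2"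
  shows "emeasure lborel (steep \<tau>) \<le> ennreal (energy_const DIM('a) p q k \<kappa> \<tau>) * (\<integral>\<^sup>+x. ennreal (g x powr q) \<partial>lborel)"
proof -
  define W where "W = 4 powr q"
  have W: "4 \<le> W" using q powr_mono[of 1 q "4::real"] by (simp add: W_def)
  define S where "S f = (\<Sum>j. ennreal (W ^ j) * f j)" for f :: "nat \<Rightarrow> ennreal"
  define a where "a j = emeasure lborel (steep (4 ^ j * \<tau>))" for j :: nat
  define m where "m j = emeasure lborel (gmax (4 ^ j * \<tau>))" for j :: nat
  define b where "b j = emeasure lborel (bad (4 ^ j * \<tau>))" for j :: nat
  define I where "I j = (\<integral>\<^sup>+x. ennreal (g x powr p) * indicator {x. g x \<le> 4 ^ k * (4 ^ j * \<tau>)} x \<partial>lborel)" for j :: nat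
  define C where "C = 5 ^ DIM('a) / \<kappa> * (2 * trunc_const DIM('a)) powr p / real k powr p"
  define D where "D = 5 ^ DIM('a) / (\<kappa> * \<tau> powr p)"
  define \<Theta> where "\<Theta> = S (\<lambda>j. ennreal (D / (4 powr p) ^ j) * I j)"
  have C0: "0 \<le> C" using \<kappa> by (simp add: C_def)
  have D0: "0 \<le> D" using \<kappa> by (simp add: D_def)
  have S_add: "S (\<lambda>j. f j + h j) = S f + S h" for f h
    unfolding S_def distrib_left by (rule suminf_add[symmetric]) auto
  have S_mono: "S f \<le> S h" if "\<And>j. f j \<le> h j" for f h
    unfolding S_def using that by (intro suminf_le mult_left_mono) auto
  have S_cmult: "S (\<lambda>j. r * f j) = r * S f" for r f
    unfolding S_def by (subst ennreal_suminf_cmult[symmetric]) (simp only: mult.left_commute)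
  have S_sum: "S (\<lambda>j. \<Sum>i\<in>T. f i j) = (\<Sum>i\<in>T. S (f i))" if "finite T" for T :: "nat set" and f
    using that
  proof (induction T rule: finite_induct)
    case empty
    show ?case by (simp add: S_def)
  next
    case (insert i T)
    then show ?case by (simp add: S_add)
  qed
  have S_shift: "S (\<lambda>j. f (j + i)) \<le> ennreal (1 / W ^ i) * S f" for f i
    unfolding S_def by (rule suminf_weighted_shift_le) (use W in simp)
  have b_le: "b j \<le> a j + m j" for j
    unfolding b_def a_def m_def bad_def by (rule emeasure_subadditive) auto
  have Sb: "S b \<le> S a + S m" using S_mono[of b "\<lambda>j. a j + m j"] b_le by (simp add: S_add)
  have each: "a j \<le> b (j + 1) + (ennreal (D / (4 powr p) ^ j) * I j + (\<Sum>i=1..k. ennreal (C * (4 powr p) ^ i) * b (j + i)))" for j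
    unfolding a_def b_def I_def D_def by (rule level_estimate_power[OF \<tau> k \<kappa> \<kappa>1 \<kappa>2 C_def])
  have "S a \<le> S (\<lambda>j. b (j + 1) + (ennreal (D / (4 powr p) ^ j) * I j + (\<Sum>i=1..k. ennreal (C * (4 powr p) ^ i) * b (j + i))))"
    using each by (rule S_mono)
  also have "\<dots> = S (\<lambda>j. b (j + 1)) + (\<Theta> + (\<Sum>i=1..k. ennreal (C * (4 powr p) ^ i) * S (\<lambda>j. b (j + i))))"
    by (simp only: S_add S_sum finite_atLeastAtMost S_cmult \<Theta>_def)
  also have "\<dots> \<le> ennreal (1/4) * S b + (\<Theta> + ennreal (1/4) * S b)"
  proof (intro add_mono order_refl)
    \<comment> \<open>One shift gains 1 / W \<le> 1/4 because q > 1. Together with the quarter from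
      the averaged truncations this leaves the factor 1/2 to be absorbed.\<close>
    have "S (\<lambda>j. b (j + 1)) \<le> ennreal (1 / W ^ 1) * S b" by (rule S_shift)
    also have "\<dots> \<le> ennreal (1/4) * S b" using W by (intro mult_right_mono ennreal_leI) (auto simp: field_simps)
    finally show "S (\<lambda>j. b (j + 1)) \<le> ennreal (1/4) * S b" .
    have "(\<Sum>i=1..k. ennreal (C * (4 powr p) ^ i) * S (\<lambda>j. b (j + i))) \<le> (\<Sum>i=1..k. ennreal (2 * C) * S b)"
    proof (rule sum_mono)
      fix i assume i: "i \<in> {1..k}"
      have "ennreal (C * (4 powr p) ^ i) * S (\<lambda>j. b (j + i)) \<le> ennreal (C * (4 powr p) ^ i) * (ennreal (1 / W ^ i) * S b)"
        by (intro mult_left_mono S_shift) simp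
      also have "\<dots> = ennreal (C * (4 powr (p - q)) ^ i) * S b"
      proof -
        have "C * (4 powr p) ^ i * (1 / W ^ i) = C * (4 powr (p - q)) ^ i"
          by (simp add: W_def powr_diff power_divide)
        then show ?thesis using C0 W by (simp add: mult.assoc[symmetric] flip: ennreal_mult)
      qed
      also have "\<dots> \<le> ennreal (2 * C) * S b"
      proof (intro mult_right_mono ennreal_leI)
        have "(4 powr (p - q)) ^ i \<le> (4 powr (p - q)) ^ k"
          using i q by (intro power_increasing ge_one_powr_ge_zero) auto
        then have "(4 powr (p - q)) ^ i \<le> 2" using k2 by linarith
        then show "C * (4 powr (p - q)) ^ i \<le> 2 * C" using mult_left_mono[OF _ C0] by (metis mult.commute)
      qed simp
      finally show "ennreal (C * (4 powr p) ^ i) * S (\<lambda>j. b (j + i)) \<le> ennreal (2 * C) * S b" .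
    qed
    also have "\<dots> = ennreal (real k * (2 * C)) * S b"
      using C0 by (simp add: ennreal_of_nat_eq_real_of_nat ennreal_mult mult.assoc)
    also have "\<dots> \<le> ennreal (1/4) * S b"
    proof (intro mult_right_mono ennreal_leI)
      have "real k * (1 / real k powr p) = real k powr (1 - p)" using k by (simp add: powr_diff)
      then have "real k * C = 5 ^ DIM('a) / \<kappa> * (2 * trunc_const DIM('a)) powr p * real k powr (1 - p)"
        unfolding C_def by (metis (no_types, opaque_lifting) mult.left_commute mult.right_neutral times_divide_eq_right)
      then have "real k * C \<le> 1 / 8" using k1 by (simp only:)
      then show "real k * (2 * C) \<le> 1/4" by simp
    qed simp
    finally show "(\<Sum>i=1..k. ennreal (C * (4 powr p) ^ i) * S (\<lambda>j. b (j + i))) \<le> ennreal (1/4) * S b" .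
  qed
  also have "\<dots> = ennreal (1/2) * S b + \<Theta>"
  proof -
    have "ennreal (1/4) * S b + ennreal (1/4) * S b = ennreal (1/4 + 1/4) * S b"
      by (subst ennreal_plus) (auto simp: distrib_right)
    then show ?thesis by (simp add: add.left_commute add.commute)
  qed
  also have "\<dots> \<le> ennreal (1/2) * (S a + S m) + \<Theta>" using Sb by (intro add_right_mono mult_left_mono) auto
  finally have ineq: "S a \<le> ennreal (1/2) * (S a + S m) + \<Theta>" .
  \<comment> \<open>Only finitely many steep sets are nonempty, and each lies in the unit
    ball.\<close>
  have fin: "S a < \<infinity>"
  proof -
    obtain N where N: "L / \<tau> < 4 ^ N" using real_arch_pow[of 4 "L / \<tau>"] by auto
    have zero: "a j = 0" if "N \<le> j" for j
    proof -
      have "(4::real) ^ N \<le> 4 ^ j" using that by (intro power_increasing) auto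
      then have "4 ^ N * \<tau> \<le> 4 ^ j * \<tau>" using \<tau> by (intro mult_right_mono) auto
      moreover have "L < 4 ^ N * \<tau>" using N \<tau> by (simp add: pos_divide_less_eq)
      ultimately have "L \<le> 4 ^ j * \<tau>" by linarith
      then show ?thesis unfolding a_def by (simp add: steep_empty)
    qed
    have "S a = (\<Sum>j<N. ennreal (W ^ j) * a j)"
      unfolding S_def by (rule suminf_finite) (use zero in auto)
    also have "\<dots> < \<infinity>"
    proof -
      have "a j < \<infinity>" for j
      proof -
        have "a j \<le> emeasure lborel (ball (0::'a) 1)"
          unfolding a_def using \<tau> by (intro emeasure_mono steep_subset) auto
        then show ?thesis using emeasure_lborel_ball_finite[of "0::'a" 1] by (rule order_le_less_trans)
      qed
      then show ?thesis by (simp add: ennreal_mult_less_top less_top)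
    qed
    finally show ?thesis .
  qed
  have "emeasure lborel (steep \<tau>) = ennreal (W ^ 0) * a 0" by (simp add: a_def)
  also have "\<dots> \<le> S a" unfolding S_def using sum_le_suminf[of "\<lambda>j. ennreal (W ^ j) * a j" "{0}"] by simp
  also have "S a \<le> S m + 2 * \<Theta>" by (rule ennreal_absorb_half[OF ineq fin])
  also have "\<dots> \<le> ennreal (energy_const DIM('a) p q k \<kappa> \<tau>) * (\<integral>\<^sup>+x. ennreal (g x powr q) \<partial>lborel)"
  proof -
    let ?G = "\<integral>\<^sup>+x. ennreal (g x powr q) \<partial>lborel"
    let ?c1 = "2 * 5 ^ DIM('a) / \<tau> * (2 / \<tau>) powr (q - 1) / (1 - 4 powr - (q - 1))"
    let ?c2 = "(1 / (4 ^ k * \<tau>)) powr - (p - q) / (1 - 4 powr - (p - q))"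
    have c1: "0 \<le> ?c1" using four_powr_less_1[of "- (q - 1)"] q \<tau> by auto
    have c2: "0 \<le> ?c2" using four_powr_less_1[of "- (p - q)"] q by auto
    have Sm: "S m \<le> ennreal ?c1 * ?G"
      unfolding S_def m_def W_def by (rule suminf_gmax_le) (use q \<tau> in auto)
    have "\<Theta> = (\<Sum>j. ennreal D * (ennreal ((4 powr - (p - q)) ^ j) * I j))"
      unfolding \<Theta>_def S_def
    proof (rule suminf_cong)
      fix j
      have "W ^ j * (D / (4 powr p) ^ j) = D * (4 powr - (p - q)) ^ j"
        by (simp add: W_def powr_diff power_divide)
      then have "ennreal (W ^ j) * ennreal (D / (4 powr p) ^ j) = ennreal D * ennreal ((4 powr - (p - q)) ^ j)"
        using D0 W by (simp flip: ennreal_mult)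
      then show "ennreal (W ^ j) * (ennreal (D / (4 powr p) ^ j) * I j) = ennreal D * (ennreal ((4 powr - (p - q)) ^ j) * I j)"
        by (simp only: mult.assoc[symmetric])
    qed
    also have "\<dots> = ennreal D * (\<Sum>j. ennreal ((4 powr - (p - q)) ^ j) * I j)" by (rule ennreal_suminf_cmult)
    also have "\<dots> \<le> ennreal D * (ennreal ?c2 * ?G)"
      unfolding I_def by (intro mult_left_mono suminf_truncated_energy_le) (use q \<tau> in auto)
    finally have "S m + 2 * \<Theta> \<le> ennreal ?c1 * ?G + 2 * (ennreal D * (ennreal ?c2 * ?G))"
      using Sm by (intro add_mono mult_left_mono) auto
    also have "\<dots> = (ennreal ?c1 + 2 * (ennreal D * ennreal ?c2)) * ?G"
      by (simp only: distrib_right mult.assoc)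
    also have "ennreal ?c1 + 2 * (ennreal D * ennreal ?c2) = ennreal (?c1 + 2 * (D * ?c2))"
      using c1 c2 D0 by (simp only: ennreal_plus ennreal_mult mult_nonneg_nonneg zero_le_numeral ennreal_numeral)
    also have "?c1 + 2 * (D * ?c2) = energy_const DIM('a) p q k \<kappa> \<tau>"
      by (simp only: energy_const_def D_def)
    finally show ?thesis .
  qed
  finally show ?thesis .
qed

end

section \<open>Self-improvement\<close>

lemma grad_norm_cong_open:
  fixes f g :: "'a::euclidean_space \<Rightarrow> real"
  assumes S: "open S" "x \<in> S" and eq: "\<And>y. y \<in> S \<Longrightarrow> f y = g y"
  shows "grad_norm f x = grad_norm g x"
proof -
  have "(f has_derivative D) (at x) \<longleftrightarrow> (g has_derivative D) (at x)" for D
    using has_derivative_transform_within_open[of f D x UNIV S g] has_derivative_transform_within_open[of g D x UNIV S f] S eq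
    by auto
  then show ?thesis by (simp add: grad_norm_def differentiable_def frechet_derivative_def)
qed

text \<open>The projection onto a ball reaches an interior point only from that interior.\<close>

lemma norm_closest_point_cball:
  fixes x :: "'a::euclidean_space"
  assumes "1 \<le> norm x"
  shows "norm (closest_point (cball 0 1) x) = 1"
proof -
  let ?S = "cball (0::'a) 1"
  have int: "interior ?S \<noteq> {}" by simp
  have "affine hull ?S = UNIV" by (rule affine_hull_nonempty_interior[OF int])
  then have "closest_point ?S x \<in> rel_interior ?S \<longleftrightarrow> x \<in> rel_interior ?S"
    by (intro closest_point_in_rel_interior) auto
  moreover have "rel_interior ?S = ball 0 1" using rel_interior_nonempty_interior[OF int] by simp
  moreover have "closest_point ?S x \<in> ?S" by (rule closest_point_in_set) auto
  ultimately show ?thesis using assms by auto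
qed

text \<open>A competitor is controlled only on the closed ball. Composing it with the nearest-point
  projection keeps its Lipschitz constant, and the zero boundary values make the result vanish
  outside. Rademacher's theorem then permits replacing \<open>grad_norm\<close> by
  \<open>local_lip\<close> in the energy.\<close>

lemma cap_admissible_extension:
  fixes u :: "'a::euclidean_space \<Rightarrow> real"
  assumes u: "cap_admissible K (ball 0 1) u" and q: "0 < q"
  obtains U L where "L-lipschitz_on UNIV U" "\<And>y. 0 \<le> U y" "\<And>y. y \<in> K \<Longrightarrow> norm y \<le> 1 \<Longrightarrow> 1 \<le> U y"
    "\<And>y. 1 \<le> norm y \<Longrightarrow> U y = 0"
    "(\<integral>\<^sup>+y. ennreal (local_lip U y powr q) \<partial>lborel) \<le> (\<integral>\<^sup>+ y. indicator (ball 0 1) y * ennreal (grad_norm u y powr q) \<partial>lebesgue)"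
proof -
  let ?S = "cball (0::'a) 1"
  obtain L where L: "L-lipschitz_on ?S u" and ge: "\<And>y. y \<in> ?S \<Longrightarrow> u y \<ge> (if y \<in> K then 1 else 0)"
    and zero: "\<And>y. norm y = 1 \<Longrightarrow> u y = 0"
    using u by (auto simp: cap_admissible_def frontier_ball)
  define U where "U y = u (closest_point ?S y)" for y
  have in_S: "closest_point ?S y \<in> ?S" for y by (rule closest_point_in_set) auto
  have self: "U y = u y" if "norm y \<le> 1" for y using that by (simp add: U_def closest_point_self)
  have out: "U y = 0" if "1 \<le> norm y" for y using zero[OF norm_closest_point_cball[OF that]] by (simp add: U_def)
  have lip: "L-lipschitz_on UNIV U"
  proof (rule lipschitz_onI)
    fix x y
    have "dist (U x) (U y) \<le> L * dist (closest_point ?S x) (closest_point ?S y)"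
      unfolding U_def by (rule lipschitz_onD[OF L in_S in_S])
    also have "\<dots> \<le> L * dist x y"
      using lipschitz_on_nonneg[OF L] by (intro mult_left_mono closest_point_lipschitz) auto
    finally show "dist (U x) (U y) \<le> L * dist x y" .
  qed (rule lipschitz_on_nonneg[OF L])
  \<comment> \<open>On the sphere the extension has no usable relation to
    \<open>grad_norm u\<close>, whose integral covers only the open ball.\<close>
  have "sphere (0::'a) 1 \<in> null_sets lborel"
    using negligible_sphere[of "0::'a" 1] null_sets_completion_iff[of "sphere (0::'a) 1" lborel]
    by (auto simp: negligible_iff_null_sets borel_closed)
  then have sph: "AE y in lborel. y \<notin> sphere (0::'a) 1" by (rule AE_not_in)
  show thesis
  proof (rule that[OF lip])
    show "0 \<le> U y" for y using ge[OF in_S, of y] by (auto simp: U_def split: if_splits)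
    show "1 \<le> U y" if "y \<in> K" "norm y \<le> 1" for y using ge[of y] that by (simp add: self)
    show "U y = 0" if "1 \<le> norm y" for y by (rule out[OF that])
    have "(\<integral>\<^sup>+y. ennreal (local_lip U y powr q) \<partial>lborel) \<le> (\<integral>\<^sup>+ y. indicator (ball 0 1) y * ennreal (grad_norm u y powr q) \<partial>lborel)"
    proof (rule nn_integral_mono_AE)
      show "AE y in lborel. ennreal (local_lip U y powr q) \<le> indicator (ball 0 1) y * ennreal (grad_norm u y powr q)"
        using sph AE_local_lip_eq_grad_norm[OF lip]
      proof eventually_elim
        case (elim y)
        show ?case
        proof (cases "norm y < 1")
          case True
          have "grad_norm U y = grad_norm u y"
            by (rule grad_norm_cong_open[of "ball 0 1"]) (use True self in auto)
          then show ?thesis using elim True by simp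
        next
          case False
          then have y: "1 < norm y" using elim by simp
          have "local_lip U y \<le> 0"
          proof (rule local_lip_le[where r = "norm y - 1"])
            fix y' assume "dist y' y < norm y - 1"
            then have "1 \<le> norm y'" using norm_triangle_ineq2[of y y'] by (simp add: dist_norm norm_minus_commute)
            then show "\<bar>U y' - U y\<bar> \<le> 0 * dist y' y" using out y by simp
          qed (use y in auto)
          then have "local_lip U y = 0" using local_lip_nonneg[OF lip, of y] by simp
          then show ?thesis by simp
        qed
      qed
    qed
    then show "(\<integral>\<^sup>+y. ennreal (local_lip U y powr q) \<partial>lborel) \<le> (\<integral>\<^sup>+ y. indicator (ball 0 1) y * ennreal (grad_norm u y powr q) \<partial>lebesgue)"
      by (simp only: nn_integral_completion)
  qed
qed

text \<open>Poincare inequality by translation: moving any point of the unit ball by a fixed vector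
  of length 2 leaves the ball, where U vanishes. The factor 4 powr q combines 2 powr q from the
  level 1/2 with 2 powr q from the length.\<close>

lemma emeasure_superlevel_le_energy:
  fixes U :: "'a::euclidean_space \<Rightarrow> real"
  assumes lip: "L-lipschitz_on UNIV U" and U: "\<And>y. 0 \<le> U y" "\<And>y. 1 \<le> norm y \<Longrightarrow> U y = 0" and q: "1 \<le> q"
  shows "emeasure lborel {y. 1/2 \<le> U y} \<le> ennreal (4 powr q) * (\<integral>\<^sup>+y. ennreal (local_lip U y powr q) \<partial>lborel)"
proof -
  have [measurable]: "local_lip U \<in> borel_measurable borel" by (rule borel_measurable_local_lip[OF lip])
  have [measurable]: "U \<in> borel_measurable borel" by (rule lipschitz_on_borel_measurable[OF lip])
  define G where "G y = ennreal (local_lip U y powr q)" for y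
  have [measurable]: "G \<in> borel_measurable borel" unfolding G_def by measurable
  obtain b :: 'a where b: "b \<in> Basis" using nonempty_Basis by blast
  define v where "v = 2 *\<^sub>R b"
  have v: "norm v = 2" using b by (simp add: v_def)
  let ?J = "\<lambda>y. (\<integral>\<^sup>+s. G (y + s *\<^sub>R v) * indicator {0..1} s \<partial>lborel)"
  have "emeasure lborel {y. 1/2 \<le> U y} = (\<integral>\<^sup>+y. indicator {y. 1/2 \<le> U y} y \<partial>lborel)"
    by (rule nn_integral_indicator[symmetric]) measurable
  also have "\<dots> \<le> (\<integral>\<^sup>+y. ennreal (4 powr q) * ?J y \<partial>lborel)"
  proof (intro nn_integral_mono)
    fix y
    show "indicator {y. 1/2 \<le> U y} y \<le> ennreal (4 powr q) * ?J y"
    proof (cases "1/2 \<le> U y")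
      case True
      then have "norm y < 1" using U(2)[of y] by force
      then have "1 \<le> norm (y + v)" using norm_triangle_ineq2[of v "- y"] v by (simp add: add.commute)
      then have Uv: "U (y + v) = 0" by (rule U(2))
      have "1 \<le> 2 powr q * U y powr q"
      proof -
        have "1 = (2 * (1/2)) powr q" by simp
        also have "\<dots> \<le> (2 * U y) powr q" using True q by (intro powr_mono2) auto
        also have "\<dots> = 2 powr q * U y powr q" by (rule powr_mult)
        finally show ?thesis .
      qed
      then have "ennreal 1 \<le> ennreal (2 powr q * U y powr q)" by (rule ennreal_leI)
      also have "\<dots> = ennreal (2 powr q) * ennreal (\<bar>U (y + v) - U y\<bar> powr q)"
        using U(1)[of y] by (simp add: Uv ennreal_mult)
      also have "\<dots> \<le> ennreal (2 powr q) * (ennreal (norm v powr q) * (\<integral>\<^sup>+s\<in>{0..1}. G (y + s *\<^sub>R v) \<partial>lborel))"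
        unfolding G_def by (intro mult_left_mono segment_local_lip_powr[OF lip q]) simp
      also have "\<dots> = ennreal (4 powr q) * (\<integral>\<^sup>+s\<in>{0..1}. G (y + s *\<^sub>R v) \<partial>lborel)"
        using powr_mult[of 2 2 q] by (simp add: v mult.assoc[symmetric] flip: ennreal_mult)
      finally show ?thesis using True by simp
    qed simp
  qed
  also have "\<dots> = ennreal (4 powr q) * (\<integral>\<^sup>+y. ?J y \<partial>lborel)"
    by (rule nn_integral_cmult) measurable
  also have "(\<integral>\<^sup>+y. ?J y \<partial>lborel)
      = (\<integral>\<^sup>+s. (\<integral>\<^sup>+y. G (y + s *\<^sub>R v) * indicator {0..1} s \<partial>lborel) \<partial>lborel)"
    by (rule lborel_pair.Fubini') measurable
  also have "\<dots> = (\<integral>\<^sup>+s. (\<integral>\<^sup>+y. G y \<partial>lborel) * indicator {0..1::real} s \<partial>lborel)"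
  proof (intro nn_integral_cong)
    fix s :: real
    have "(\<integral>\<^sup>+y. G (y + s *\<^sub>R v) * indicator {0..1} s \<partial>lborel) = (\<integral>\<^sup>+y. G (s *\<^sub>R v + y) \<partial>lborel) * indicator {0..1} s"
      by (subst nn_integral_multc) (auto simp: add.commute)
    then show "(\<integral>\<^sup>+y. G (y + s *\<^sub>R v) * indicator {0..1} s \<partial>lborel) = (\<integral>\<^sup>+y. G y \<partial>lborel) * indicator {0..1} s"
      by (simp add: nn_integral_lborel_shift)
  qed
  also have "\<dots> = (\<integral>\<^sup>+y. G y \<partial>lborel)"
    by (subst nn_integral_cmult_indicator) auto
  finally show ?thesis by (simp add: G_def)
qed

lemma uniformly_fat_capacity_lower_bound:
  fixes E :: "'a::euclidean_space set" and k :: nat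
  assumes p: "1 < p" and c: "0 < c" and fat: "unif_fat p E (E \<inter> cball 0 1) c 2" and E: "closed E" "0 \<in> E"
    and \<tau>: "8 \<le> \<tau>" and k: "1 \<le> k" and \<kappa>: "0 < \<kappa>"
    and \<kappa>1: "hardy_const p TYPE('a) * (4 powr p * (2 * \<kappa>)) \<le> c" and \<kappa>2: "8 powr p \<le> \<kappa> * \<tau> powr p"
    and q: "1 < q" "q < p"
    and k1: "5 ^ DIM('a) / \<kappa> * (2 * trunc_const DIM('a)) powr p * real k powr (1 - p) \<le> 1 / 8"
    and k2: "(4 powr (p - q)) ^ k \<le> 2"
  shows "ennreal (measure lborel (ball (0::'a) (1 / (2 * \<tau>))) / (energy_const DIM('a) p q k \<kappa> \<tau> + 4 powr q))
     \<le> cap q {y \<in> cball 0 (1/2). y \<in> E} (ball 0 1)"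
  unfolding cap_def
proof (rule INF_greatest)
  fix u assume "u \<in> {u. cap_admissible {y \<in> cball 0 (1/2). y \<in> E} (ball 0 1) u}"
  then have "cap_admissible {y \<in> cball 0 (1/2). y \<in> E} (ball 0 1) u" by simp
  then obtain U L where lip: "L-lipschitz_on UNIV U" and U: "\<And>y. 0 \<le> U y"
    "\<And>y. y \<in> {y \<in> cball 0 (1/2). y \<in> E} \<Longrightarrow> norm y \<le> 1 \<Longrightarrow> 1 \<le> U y" "\<And>y. 1 \<le> norm y \<Longrightarrow> U y = 0"
    and Uu: "(\<integral>\<^sup>+y. ennreal (local_lip U y powr q) \<partial>lborel) \<le> (\<integral>\<^sup>+ y. indicator (ball 0 1) y * ennreal (grad_norm u y powr q) \<partial>lebesgue)"
    by (rule cap_admissible_extension[where q = q]) (use q in auto)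
  define X where "X = (\<integral>\<^sup>+y. ennreal (local_lip U y powr q) \<partial>lborel)"
  define f where "f y = max 0 (1 - U y)" for y
  have f: "0 \<le> f y" "\<bar>f y\<bar> \<le> 1" for y using U(1)[of y] by (auto simp: f_def)
  have fd: "\<bar>f y' - f y\<bar> \<le> 1 * \<bar>U (0 + 1 *\<^sub>R y') - U (0 + 1 *\<^sub>R y)\<bar>" for y y' by (auto simp: f_def max_def)
  note fl = local_lip_comp_affine_le[OF lip zero_le_one zero_less_one fd]
  have cut8: "8-lipschitz_on UNIV (cutoff 8 :: 'a \<Rightarrow> real)" by (rule lipschitz_on_cutoff) simp
  \<comment> \<open>The cutoff vanishes from radius 1/4 on, inside the half ball where U \<ge> 1 on
    E, so w is 0 on all of E. It is 1 up to radius 1/8, which covers the ball of radius 1 / (2 *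
    \<tau>) used below.\<close>
  define w where "w y = cutoff 8 y * f y" for y
  have lipw: "(8 + 1 * 1 * L)-lipschitz_on UNIV w"
    unfolding w_def[abs_def] by (rule lipschitz_on_cutoff_mult[OF cut8 cutoff_nonneg cutoff_le_1 fl(2) f(2)])
  interpret truncation E w "local_lip U" "8 + 1 * 1 * L" L p c
  proof
    show "1 < p" "0 < c" "unif_fat p E (E \<inter> cball 0 1) c 2" "closed E" "0 \<in> E" by fact+
    show "(8 + 1 * 1 * L)-lipschitz_on UNIV w" by (rule lipw)
    show "0 \<le> w y" for y unfolding w_def using f(1)[of y] cutoff_nonneg[of 8 y] by simp
    show "w y = 0" if "1/4 \<le> norm y" for y using that by (simp add: w_def cutoff_eq_0)
    show "w y = 0" if "y \<in> E" for y
    proof (cases "1/4 \<le> norm y")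
      case False
      then have "1 \<le> U y" using that by (intro U(2)) auto
      then show ?thesis by (simp add: w_def f_def)
    qed (simp add: w_def cutoff_eq_0)
    show "local_lip U \<in> borel_measurable borel" by (rule borel_measurable_local_lip[OF lip])
    show "0 \<le> local_lip U y" for y by (rule local_lip_nonneg[OF lip])
    show "local_lip U y \<le> L" for y by (rule local_lip_le_const[OF lip])
    show "local_lip w y \<le> local_lip U y + 8" for y
    proof -
      have "local_lip w y \<le> 8 * \<bar>f y\<bar> + local_lip f y"
        unfolding w_def[abs_def] by (rule local_lip_cutoff_mult[OF cut8 cutoff_nonneg cutoff_le_1 fl(2)])
      then show ?thesis using fl(1)[of y] f(2)[of y] by simp
    qed
  qed
  have st: "emeasure lborel (steep \<tau>) \<le> ennreal (energy_const DIM('a) p q k \<kappa> \<tau>) * X"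
    unfolding X_def by (rule energy_estimate) fact+
  \<comment> \<open>With this radius \<tau> * infdist y E \<le> \<tau> * norm y < 1/2, because 0
    lies in E; where U < 1/2 this is below w.\<close>
  let ?\<rho> = "1 / (2 * \<tau>)"
  have "ball 0 ?\<rho> \<subseteq> steep \<tau> \<union> {y. 1/2 \<le> U y}"
  proof
    fix y :: 'a assume "y \<in> ball 0 ?\<rho>"
    then have y: "\<tau> * norm y < 1/2" using \<tau> by (simp add: field_simps)
    have "8 * norm y \<le> \<tau> * norm y" using \<tau> by (intro mult_right_mono) auto
    then have cut: "cutoff 8 y = 1" using y by (intro cutoff_eq_1) simp
    show "y \<in> steep \<tau> \<union> {y. 1/2 \<le> U y}"
    proof (cases "1/2 \<le> U y")
      case False
      have "\<tau> * infdist y E \<le> \<tau> * norm y" using infdist_le[OF E(2), of y] \<tau> by (intro mult_left_mono) auto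
      also have "\<dots> < w y" using y False by (simp add: w_def cut f_def)
      finally show ?thesis by (simp add: steep_def)
    qed simp
  qed
  moreover have Um: "{y. 1/2 \<le> U y} \<in> sets borel"
    by (intro borel_closed closed_Collect_le continuous_intros lipschitz_on_continuous_on[OF lip])
  ultimately have "emeasure lborel (ball (0::'a) ?\<rho>) \<le> emeasure lborel (steep \<tau> \<union> {y. 1/2 \<le> U y})"
    by (intro emeasure_mono) auto
  also have "\<dots> \<le> emeasure lborel (steep \<tau>) + emeasure lborel {y. 1/2 \<le> U y}"
    using Um by (intro emeasure_subadditive) auto
  also have "\<dots> \<le> ennreal (energy_const DIM('a) p q k \<kappa> \<tau>) * X + ennreal (4 powr q) * X"
    using st emeasure_superlevel_le_energy[OF lip U(1,3), of q] q unfolding X_def by (intro add_mono) auto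
  also have "\<dots> = ennreal (energy_const DIM('a) p q k \<kappa> \<tau> + 4 powr q) * X"
    using energy_const_nonneg[of q p \<kappa> \<tau> "DIM('a)" k] q \<kappa> \<tau> by (simp add: distrib_right)
  finally have le: "ennreal (measure lborel (ball (0::'a) ?\<rho>)) \<le> ennreal (energy_const DIM('a) p q k \<kappa> \<tau> + 4 powr q) * X"
    by (simp add: emeasure_lborel_ball_eq)
  define e where "e = energy_const DIM('a) p q k \<kappa> \<tau> + 4 powr q"
  have e: "0 < e"
    unfolding e_def using energy_const_nonneg[of q p \<kappa> \<tau> "DIM('a)" k] q \<kappa> \<tau> by (intro add_nonneg_pos) auto
  have "ennreal (measure lborel (ball (0::'a) ?\<rho>) / e) = ennreal (1 / e) * ennreal (measure lborel (ball (0::'a) ?\<rho>))"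
    using e by (simp flip: ennreal_mult)
  also have "\<dots> \<le> ennreal (1 / e) * (ennreal e * X)" using le unfolding e_def by (rule mult_left_mono) simp
  also have "\<dots> = X" using e by (simp add: mult.assoc[symmetric] flip: ennreal_mult)
  also have "X \<le> (\<integral>\<^sup>+ y. indicator (ball 0 1) y * ennreal (grad_norm u y powr q) \<partial>lebesgue)"
    unfolding X_def by (rule Uu)
  finally show "ennreal (measure lborel (ball (0::'a) ?\<rho>) / (energy_const DIM('a) p q k \<kappa> \<tau> + 4 powr q))
    \<le> (\<integral>\<^sup>+ y. indicator (ball 0 1) y * ennreal (grad_norm u y powr q) \<partial>lebesgue)" unfolding e_def .
qed

text \<open>Order of the choices: \<kappa> from c and the Hardy constant, \<tau> from \<kappa>, k
  from \<kappa> using p > 1, and last \<epsilon> from k. None of them sees E.\<close>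

lemma unif_fat_self_improvement_unit:
  fixes p c :: real
  assumes p: "1 < p" and c: "0 < c"
  obtains q c' where "1 < q" "q < p" "0 < c'"
    "\<And>E::'a::euclidean_space set. closed E \<Longrightarrow> 0 \<in> E \<Longrightarrow> unif_fat p E (E \<inter> cball 0 1) c 2 \<Longrightarrow>
       ennreal c' \<le> cap q {y \<in> cball 0 (1/2). y \<in> E} (ball 0 1)"
proof -
  define \<kappa> where "\<kappa> = c / (hardy_const p TYPE('a) * (4 powr p * 2))"
  have h: "0 < hardy_const p TYPE('a)" by (rule hardy_const_pos)
  have \<kappa>: "0 < \<kappa>" "hardy_const p TYPE('a) * (4 powr p * (2 * \<kappa>)) \<le> c"
    using c h by (simp_all add: \<kappa>_def)
  \<comment> \<open>The first entry lets the truncations ignore the additive 8; the second is the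
    height from which \<kappa> * \<tau> powr p dominates 8 powr p.\<close>
  define \<tau> where "\<tau> = max 8 (8 / \<kappa> powr (1 / p))"
  have \<tau>: "8 \<le> \<tau>" by (simp add: \<tau>_def)
  have \<tau>2: "8 powr p \<le> \<kappa> * \<tau> powr p"
  proof -
    have "8 powr p = \<kappa> * (8 / \<kappa> powr (1 / p)) powr p" using \<kappa> p by (simp add: powr_divide powr_powr)
    also have "\<dots> \<le> \<kappa> * \<tau> powr p" using \<kappa> p by (intro mult_left_mono powr_mono2) (auto simp: \<tau>_def)
    finally show ?thesis .
  qed
  have "((\<lambda>k. real k powr (1 - p)) \<longlongrightarrow> 0) sequentially"
    by (rule tendsto_neg_powr) (use p in \<open>auto simp: filterlim_real_sequentially\<close>)
  from tendsto_mult_left[OF this, of "5 ^ DIM('a) / \<kappa> * (2 * trunc_const DIM('a)) powr p"]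
  have "(\<lambda>k. 5 ^ DIM('a) / \<kappa> * (2 * trunc_const DIM('a)) powr p * real k powr (1 - p)) \<longlonglongrightarrow> 0" by simp
  then have "\<forall>\<^sub>F k in sequentially. 5 ^ DIM('a) / \<kappa> * (2 * trunc_const DIM('a)) powr p * real k powr (1 - p) < 1 / 8"
    by (rule order_tendstoD) simp
  with eventually_ge_at_top[of 1] have "\<forall>\<^sub>F k in sequentially. 1 \<le> k \<and> 5 ^ DIM('a) / \<kappa> * (2 * trunc_const DIM('a)) powr p * real k powr (1 - p) < 1 / 8"
    by eventually_elim simp
  then obtain k :: nat where k: "1 \<le> k" "5 ^ DIM('a) / \<kappa> * (2 * trunc_const DIM('a)) powr p * real k powr (1 - p) < 1 / 8"
    by (auto dest: eventually_happens)
  \<comment> \<open>The first entry keeps p - \<epsilon> above 1, the second gives 4 powr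
    (\<epsilon> * k) \<le> 4 powr (1/2) = 2.\<close>
  define \<epsilon> where "\<epsilon> = min ((p - 1) / 2) (1 / (2 * real k))"
  have \<epsilon>: "0 < \<epsilon>" "\<epsilon> < p - 1" using p k by (auto simp: \<epsilon>_def min_def field_simps)
  have k2: "(4 powr (p - (p - \<epsilon>))) ^ k \<le> 2"
  proof -
    have "\<epsilon> * real k \<le> 1 / (2 * real k) * real k" unfolding \<epsilon>_def by (intro mult_right_mono) auto
    then have "\<epsilon> * real k \<le> 1 / 2" using k(1) by simp
    then have "4 powr (\<epsilon> * real k) \<le> 4 powr (1 / 2)" by (intro powr_mono) auto
    also have "4 powr (1 / 2) = (2::real)" by (simp add: powr_half_sqrt)
    finally show ?thesis by (simp add: powr_realpow[symmetric] powr_powr)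
  qed
  define e where "e = energy_const DIM('a) p (p - \<epsilon>) k \<kappa> \<tau> + 4 powr (p - \<epsilon>)"
  have e: "0 < e"
    unfolding e_def using energy_const_nonneg[of "p - \<epsilon>" p \<kappa> \<tau> "DIM('a)" k] \<epsilon> \<kappa> \<tau> by (intro add_nonneg_pos) auto
  show thesis
  proof (rule that[of "p - \<epsilon>" "measure lborel (ball (0::'a) (1 / (2 * \<tau>))) / e"])
    show "1 < p - \<epsilon>" "p - \<epsilon> < p" using \<epsilon> by auto
    show "0 < measure lborel (ball (0::'a) (1 / (2 * \<tau>))) / e"
      using e \<tau> by (intro divide_pos_pos content_ball_pos) auto
    fix E :: "'a set" assume E: "closed E" "0 \<in> E" "unif_fat p E (E \<inter> cball 0 1) c 2"
    show "ennreal (measure lborel (ball (0::'a) (1 / (2 * \<tau>))) / e) \<le> cap (p - \<epsilon>) {y \<in> cball 0 (1/2). y \<in> E} (ball 0 1)"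
      unfolding e_def
      by (rule uniformly_fat_capacity_lower_bound[OF p c E(3,1,2) \<tau> k(1) \<kappa> \<tau>2 _ _ less_imp_le[OF k(2)] k2]) (use \<epsilon> in auto)
  qed
qed

text \<open>A radius below 2 at a point of the unit ball corresponds to a radius below 2 * r at a
  point within r of z; the two side conditions keep both in the range where fatness is
  assumed.\<close>

lemma unif_fat_rescale:
  fixes E :: "'a::euclidean_space set"
  assumes fat: "unif_fat p E (E \<inter> cball x R) c \<rho>" and r: "0 < r" "2 * r \<le> \<rho>" and z: "dist x z + r \<le> R"
  shows "unif_fat p {y. z + r *\<^sub>R y \<in> E} ({y. z + r *\<^sub>R y \<in> E} \<inter> cball 0 1) c 2"
  unfolding unif_fat_def
proof (intro ballI allI impI)
  fix y0 :: 'a and t :: real assume y0: "y0 \<in> {y. z + r *\<^sub>R y \<in> E} \<inter> cball 0 1" and t: "0 < t \<and> t < 2"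
  have "dist x (z + r *\<^sub>R y0) \<le> dist x z + norm (r *\<^sub>R y0)"
    using dist_triangle[of x "z + r *\<^sub>R y0" z] by (simp add: dist_norm)
  also have "norm (r *\<^sub>R y0) \<le> r * 1" using y0 r by (simp add: mult_left_le)
  finally have "dist x (z + r *\<^sub>R y0) \<le> R" using z by simp
  then have mem: "z + r *\<^sub>R y0 \<in> E \<inter> cball x R" using y0 by simp
  have "t * r < 2 * r" using t r by (intro mult_strict_right_mono) auto
  then have rt: "0 < r * t \<and> r * t < \<rho>" using t r by (auto simp only: mult.commute[of r t] intro: mult_pos_pos elim: less_le_trans)
  have eq: "z + r *\<^sub>R (y0 + t *\<^sub>R y) = z + r *\<^sub>R y0 + (r * t) *\<^sub>R y" for y by (simp add: scaleR_add_right)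
  have "ennreal c \<le> cap p {y \<in> cball 0 (1/2). z + r *\<^sub>R y0 + (r * t) *\<^sub>R y \<in> E} (ball 0 1)"
    using fat mem rt unfolding unif_fat_def by blast
  then show "ennreal c \<le> cap p {y \<in> cball 0 (1/2). y0 + t *\<^sub>R y \<in> {y. z + r *\<^sub>R y \<in> E}} (ball 0 1)"
    by (simp only: mem_Collect_eq eq)
qed

text \<open>The dependence of the constants is expressed by the order of the quantifiers: both are
  fixed before the set, the centre and the radii, while the dimension comes from the type.\<close>

theorem theorem3p1:
  fixes p c_fat :: real
  assumes "1 < p" and "0 < c_fat"
  shows "\<exists>\<epsilon> c'. 0 < \<epsilon> \<and> \<epsilon> < p - 1 \<and> 0 < c' \<and>
    (\<forall>(E::'a::euclidean_space set) x r_a r\<^sub>0.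
       closed E \<and> x \<in> E \<and> 0 < r_a \<and> 0 < r\<^sub>0 \<and>
       unif_fat p E (E \<inter> cball x r_a) c_fat r\<^sub>0 \<longrightarrow>
       unif_fat (p - \<epsilon>) E (E \<inter> cball x (min r_a r\<^sub>0 / 4)) c' (min r_a r\<^sub>0 / 4))"
proof -
  obtain q c' where q: "1 < q" "q < p" and c': "0 < c'"
    and unit: "\<And>E::'a set. closed E \<Longrightarrow> 0 \<in> E \<Longrightarrow> unif_fat p E (E \<inter> cball 0 1) c_fat 2 \<Longrightarrow>
       ennreal c' \<le> cap q {y \<in> cball 0 (1/2). y \<in> E} (ball 0 1)"
    using unif_fat_self_improvement_unit[OF assms] by blast
  show ?thesis
  proof (rule exI[of _ "p - q"], rule exI[of _ c'], intro conjI allI impI c')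
    show "0 < p - q" "p - q < p - 1" using q by auto
    fix E :: "'a set" and x :: 'a and r_a r0 :: real
    assume A: "closed E \<and> x \<in> E \<and> 0 < r_a \<and> 0 < r0 \<and> unif_fat p E (E \<inter> cball x r_a) c_fat r0"
    show "unif_fat (p - (p - q)) E (E \<inter> cball x (min r_a r0 / 4)) c' (min r_a r0 / 4)"
      unfolding unif_fat_def
    proof (intro ballI allI impI)
      fix z :: 'a and r :: real assume z: "z \<in> E \<inter> cball x (min r_a r0 / 4)" and r: "0 < r \<and> r < min r_a r0 / 4"
      let ?E = "{y. z + r *\<^sub>R y \<in> E}"
      have "closed ((\<lambda>y. z + r *\<^sub>R y) -` E)"
        using A by (intro closed_vimage continuous_intros) auto
      then have cl: "closed ?E" by (simp add: vimage_def)
      \<comment> \<open>Both dist x z and r are at most a quarter of min r_a r0, so their sum stays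
        within r_a and 2 * r within r0.\<close>
      have "unif_fat p ?E (?E \<inter> cball 0 1) c_fat 2"
        by (rule unif_fat_rescale[of p E x r_a c_fat r0]) (use A z r in auto)
      then have "ennreal c' \<le> cap q {y \<in> cball 0 (1/2). y \<in> ?E} (ball 0 1)"
        using z by (intro unit cl) auto
      then show "ennreal c' \<le> cap (p - (p - q)) {y \<in> cball 0 (1/2). z + r *\<^sub>R y \<in> E} (ball 0 1)" by simp
    qed
  qed
qed

end
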